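(* Let $\Gamma$ be an acyclic perfect cylindrical network with $N$ sources, all on one boundary component, and $N$ sinks, all on the other, let $\mathcal C$ be the category of paths in the associated torus network between the $N$ marked points, equipped with its double bracket $\{\!\{-,-\}\!\}$, and let $\{-,-\}:\mathcal C_\natural\otimes\mathcal C\to\mathcal C$ be the induced $H_0$-Poisson bracket. Then for every integer $k\ge1$ the boundary measurement matrix $B(\lambda)$ satisfies the Lax equation $$\Big\{\overline{\mathrm{tr}\,B(\lambda)^k},\,B(\mu)\Big\}=M(\lambda,\mu;k)\,B(\mu)-B(\mu)\,M(\lambda,\mu;k)$$ (the bracket on the left being taken entrywise in $B(\mu)$), where $$M(\lambda,\mu;k)_{ab}=k\,\rho_{ba}(\lambda,\mu)\,\big(B(\lambda)^k\big)_{ab},\qquad 1\le a,b\le N.$$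
   Context: Networks. A perfect cylindrical network is a finite directed graph $\Gamma$ embedded in a cylinder such that boundary vertices are univalent and internal vertices are trivalent and are neither sources nor sinks. An internal vertex is white if it has exactly one incoming edge, black if it has exactly one outgoing edge. Fix a cut: a smooth simple oriented curve from the source boundary component to the sink boundary component, avoiding the vertices and transversal to the edges. Cutting gives a rectangle drawn with sources on the left edge, sinks on the right edge, and the cut as top and bottom edges, oriented left to right. Sources and sinks are numbered $1,\dots,N$ from top to bottom. Boundary measurements. $\mathbf k=\mathbb C(\lambda,\mu)$. $B(\lambda)$ is the $N\times N$ matrix with entries $b_{ij}(\lambda)=\sum_{p:i\to j}\lambda^{d(p)}\,p$, the sum over directed paths in $\Gamma$ from source $i$ to sink $j$; $d(p)$ counts crossings of $p$ with the cut, $+1$ when $p$ leaves the rectangle through the top edge and re-enters through the bottom edge, $-1$ in the opposite direction. Standard bracket on paths in $\Gamma$. Paths are concatenated left to right, tensors are multiplied componentwise, $(f\otimes g)^\tau=g\otimes f$, and $s,t$ denote source and target. On the $\mathbf k$-linear category of directed paths in $\Gamma$ (objects: vertices) the bracket is the collection of $\mathbf k$-linear maps $\mathrm{Hom}(A,A')\otimes\mathrm{Hom}(D,D')\to\mathrm{Hom}(D,A')\otimes\mathrm{Hom}(A,D')$ determined by skew-symmetry $\{\!\{f,g\}\!\}=-\{\!\{g,f\}\!\}^\tau$, the Leibniz rules $\{\!\{fg,h\}\!\}=(\mathbf 1_{s(h)}\otimes f)\{\!\{g,h\}\!\}+\{\!\{f,h\}\!\}(g\otimes\mathbf 1_{t(h)})$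 and $\{\!\{f,gh\}\!\}=(g\otimes\mathbf 1_{s(f)})\{\!\{f,h\}\!\}+\{\!\{f,g\}\!\}(\mathbf 1_{t(f)}\otimes h)$, and values on pairs of edges, which are sums of contributions of internal vertices: at a white vertex with incoming edge $x_3$ and outgoing $x_1,x_2$ ($x_1,x_2,x_3$ in counterclockwise cyclic order in the rectangle), $\{\!\{x_1,x_2\}\!\}=\frac12x_1\otimes x_2$; at a black vertex with outgoing edge $y_3$ and incoming $y_1,y_2$ ($y_1,y_2,y_3$ in counterclockwise cyclic order), $\{\!\{y_1,y_2\}\!\}=-\frac12y_2\otimes y_1$; all other contributions, except those following by skew-symmetry, are zero. Torus category. Glue the two boundary components of the cylinder so that sink $i$ is identified with source $i$, $i=1,\dots,N$. $\mathcal C$ is the $\mathbf k$-linear category with objects $1,\dots,N$ whose morphisms are linear combinations of directed paths in the resulting torus network starting and ending at these points; it is freely generated by the directed source-to-sink paths $i\to j$ in $\Gamma$. The double bracket on $\mathcal C$ is given on these generators by the standard bracket (which takes a pair $p:i\to k$, $q:j\to l$ to a combination of tensors of source-to-sink paths $j\to k$ and $i\to l$), extended by the two Leibniz rules. Induced bracket. $\mathcal C_\natural=\big(\bigoplus_X\mathrm{Hom}(X,X)\big)/[\mathcal C,\mathcal C]$, where $[\mathcal C,\mathcal C]$ is spanned by all $fg-gf$ with $f\in\mathrm{Hom}(X,Y)$, $g\in\mathrm{Hom}(Y,X)$; $\overline f$ denotes the class of a loop $f$. For a loop $f$ and a morphism $g$, $\{\overline f,g\}=\mu(\{\!\{f,g\}\!\})$,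 with $\mu$ here denoting concatenation $x\otimes y\mapsto xy$; this is well defined. $r$-matrix coefficients: $\rho_{ab}(\lambda,\mu)=\frac{\lambda}{\mu-\lambda}$ if $a<b$, $\ \frac12\frac{\mu+\lambda}{\mu-\lambda}$ if $a=b$, $\ \frac{\mu}{\mu-\lambda}$ if $a>b$. *)

theory Defs
  imports
    "HOL-Analysis.Analysis"
    "HOL-Library.Poly_Mapping"
    "HOL-Computational_Algebra.Polynomial"
    "HOL-Computational_Algebra.Fraction_Field"
    "Graph_Theory.Arc_Walk"
begin

section \<open>Perfect cylindrical networks\<close>

text \<open>
  The cylinder obtained from the rectangle \<open>[0,1] \<times> [0,1]\<close> by gluing its bottom edge to its top
  edge is modelled by the closed annulus \<open>1 \<le> |z| \<le> 2\<close>, via the orientation preserving map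
  \<open>(x, y) \<mapsto> (1 + x) exp (2 \<pi> i y)\<close>.  The source component is the circle \<open>|z| = 1\<close> (the left
  edge), the sink component is \<open>|z| = 2\<close> (the right edge), and the cut (the top and bottom edges,
  oriented from left to right) is the segment from 1 to 2 on the real axis.  Moving upwards in
  the rectangle is moving counterclockwise in the annulus.
\<close>

record ('v, 'e) cyl_network =
  digraph_of :: "('v, 'e) pre_digraph"
  width :: nat
  source :: "nat \<Rightarrow> 'v"
  sink :: "nat \<Rightarrow> 'v"
  point :: "'v \<Rightarrow> complex"
  curve :: "'e \<Rightarrow> real \<Rightarrow> complex"

definition sources :: "('v, 'e) cyl_network \<Rightarrow> 'v set" where
  "sources \<Gamma> = source \<Gamma> ` {1..width \<Gamma>}"

definition sinks :: "('v, 'e) cyl_network \<Rightarrow> 'v set" where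
  "sinks \<Gamma> = sink \<Gamma> ` {1..width \<Gamma>}"

definition internal :: "('v, 'e) cyl_network \<Rightarrow> 'v set" where
  "internal \<Gamma> = verts (digraph_of \<Gamma>) - sources \<Gamma> - sinks \<Gamma>"

definition cut :: "complex set" where
  "cut = closed_segment 1 2"

text \<open>Since the cut lies on the positive real axis, the sides of the cut near one of its points
  are told apart by the sign of the imaginary part.\<close>

definition crosses_up :: "(real \<Rightarrow> complex) \<Rightarrow> real \<Rightarrow> bool" where
  "crosses_up g t \<longleftrightarrow> g t \<in> cut \<and>
     (\<forall>\<^sub>F s in at_left t. Im (g s) < 0) \<and> (\<forall>\<^sub>F s in at_right t. Im (g s) > 0)"

definition crosses_down :: "(real \<Rightarrow> complex) \<Rightarrow> real \<Rightarrow> bool" where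
  "crosses_down g t \<longleftrightarrow> g t \<in> cut \<and>
     (\<forall>\<^sub>F s in at_left t. Im (g s) > 0) \<and> (\<forall>\<^sub>F s in at_right t. Im (g s) < 0)"

locale perfect_cylindrical_network =
  fixes \<Gamma> :: "('v, 'e) cyl_network"
  assumes fin_digraph: "fin_digraph (digraph_of \<Gamma>)"
    and boundary_verts: "sources \<Gamma> \<union> sinks \<Gamma> \<subseteq> verts (digraph_of \<Gamma>)"
    and inj_source: "inj_on (source \<Gamma>) {1..width \<Gamma>}"
    and inj_sink: "inj_on (sink \<Gamma>) {1..width \<Gamma>}"
    and sources_sinks_disjoint: "sources \<Gamma> \<inter> sinks \<Gamma> = {}"
    and source_degree: "\<And>v. v \<in> sources \<Gamma> \<Longrightarrow>
      in_degree (digraph_of \<Gamma>) v = 0 \<and> out_degree (digraph_of \<Gamma>) v = 1"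
    and sink_degree: "\<And>v. v \<in> sinks \<Gamma> \<Longrightarrow>
      in_degree (digraph_of \<Gamma>) v = 1 \<and> out_degree (digraph_of \<Gamma>) v = 0"
    and internal_degree: "\<And>v. v \<in> internal \<Gamma> \<Longrightarrow>
      in_degree (digraph_of \<Gamma>) v + out_degree (digraph_of \<Gamma>) v = 3 \<and>
      in_degree (digraph_of \<Gamma>) v \<noteq> 0 \<and> out_degree (digraph_of \<Gamma>) v \<noteq> 0"
    and inj_point: "inj_on (point \<Gamma>) (verts (digraph_of \<Gamma>))"
    and source_on_boundary: "\<And>v. v \<in> sources \<Gamma> \<Longrightarrow> cmod (point \<Gamma> v) = 1"
    and sink_on_boundary: "\<And>v. v \<in> sinks \<Gamma> \<Longrightarrow> cmod (point \<Gamma> v) = 2"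
    and internal_in_interior: "\<And>v. v \<in> internal \<Gamma> \<Longrightarrow>
      1 < cmod (point \<Gamma> v) \<and> cmod (point \<Gamma> v) < 2"
    and curve_simple: "\<And>e. e \<in> arcs (digraph_of \<Gamma>) \<Longrightarrow> simple_path (curve \<Gamma> e)"
    and curve_start: "\<And>e. e \<in> arcs (digraph_of \<Gamma>) \<Longrightarrow>
      pathstart (curve \<Gamma> e) = point \<Gamma> (tail (digraph_of \<Gamma>) e)"
    and curve_finish: "\<And>e. e \<in> arcs (digraph_of \<Gamma>) \<Longrightarrow>
      pathfinish (curve \<Gamma> e) = point \<Gamma> (head (digraph_of \<Gamma>) e)"
    and curve_in_interior: "\<And>e t. \<lbrakk>e \<in> arcs (digraph_of \<Gamma>); 0 < t; t < 1\<rbrakk> \<Longrightarrow>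
      1 < cmod (curve \<Gamma> e t) \<and> cmod (curve \<Gamma> e t) < 2"
    and curve_avoids_verts: "\<And>e t v. \<lbrakk>e \<in> arcs (digraph_of \<Gamma>); 0 < t; t < 1;
      v \<in> verts (digraph_of \<Gamma>)\<rbrakk> \<Longrightarrow> curve \<Gamma> e t \<noteq> point \<Gamma> v"
    and curves_disjoint: "\<And>e f s t. \<lbrakk>e \<in> arcs (digraph_of \<Gamma>); f \<in> arcs (digraph_of \<Gamma>); e \<noteq> f;
      0 < s; s < 1; 0 < t; t < 1\<rbrakk> \<Longrightarrow> curve \<Gamma> e s \<noteq> curve \<Gamma> f t"
    and cut_avoids_verts: "\<And>v. v \<in> verts (digraph_of \<Gamma>) \<Longrightarrow> point \<Gamma> v \<notin> cut"
    and cut_transversal: "\<And>e t. \<lbrakk>e \<in> arcs (digraph_of \<Gamma>); 0 < t; t < 1; curve \<Gamma> e t \<in> cut\<rbrakk> \<Longrightarrow>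
      crosses_up (curve \<Gamma> e) t \<or> crosses_down (curve \<Gamma> e) t"
    and sources_top_to_bottom: "\<And>i j. \<lbrakk>1 \<le> i; i < j; j \<le> width \<Gamma>\<rbrakk> \<Longrightarrow>
      Arg2pi (point \<Gamma> (source \<Gamma> j)) < Arg2pi (point \<Gamma> (source \<Gamma> i))"
    and sinks_top_to_bottom: "\<And>i j. \<lbrakk>1 \<le> i; i < j; j \<le> width \<Gamma>\<rbrakk> \<Longrightarrow>
      Arg2pi (point \<Gamma> (sink \<Gamma> j)) < Arg2pi (point \<Gamma> (sink \<Gamma> i))"

definition acyclic_network :: "('v, 'e) cyl_network \<Rightarrow> bool" where
  "acyclic_network \<Gamma> \<longleftrightarrow> (\<nexists>c. pre_digraph.cycle (digraph_of \<Gamma>) c)"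

definition white :: "('v, 'e) cyl_network \<Rightarrow> 'v \<Rightarrow> bool" where
  "white \<Gamma> v \<longleftrightarrow> v \<in> internal \<Gamma> \<and> in_degree (digraph_of \<Gamma>) v = 1"

definition black :: "('v, 'e) cyl_network \<Rightarrow> 'v \<Rightarrow> bool" where
  "black \<Gamma> v \<longleftrightarrow> v \<in> internal \<Gamma> \<and> out_degree (digraph_of \<Gamma>) v = 1"

text \<open>The cyclic order of edges at a vertex is read off from the points where they first meet a
  small circle centred at the vertex.\<close>

definition half_edge :: "('v, 'e) cyl_network \<Rightarrow> 'v \<Rightarrow> 'e \<Rightarrow> real \<Rightarrow> complex" where
  "half_edge \<Gamma> v e =
     (if tail (digraph_of \<Gamma>) e = v then curve \<Gamma> e else reversepath (curve \<Gamma> e))"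

definition first_exit :: "(real \<Rightarrow> complex) \<Rightarrow> real \<Rightarrow> complex" where
  "first_exit g r = g (Inf {t \<in> {0..1}. dist (g 0) (g t) = r})"

definition ccw_at :: "('v, 'e) cyl_network \<Rightarrow> 'v \<Rightarrow> 'e \<Rightarrow> 'e \<Rightarrow> 'e \<Rightarrow> bool" where
  "ccw_at \<Gamma> v e f g \<longleftrightarrow> (\<forall>\<^sub>F r in at_right 0.
     let dir = (\<lambda>x. first_exit (half_edge \<Gamma> v x) r - point \<Gamma> v)
     in 0 < Arg2pi (dir f / dir e) \<and> Arg2pi (dir f / dir e) < Arg2pi (dir g / dir e))"

definition edge_crossings :: "('v, 'e) cyl_network \<Rightarrow> 'e \<Rightarrow> int" where
  "edge_crossings \<Gamma> e =
     int (card {t \<in> {0<..<1}. crosses_up (curve \<Gamma> e) t}) -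
     int (card {t \<in> {0<..<1}. crosses_down (curve \<Gamma> e) t})"

definition crossings :: "('v, 'e) cyl_network \<Rightarrow> 'e list \<Rightarrow> int" where
  "crossings \<Gamma> p = (\<Sum>e\<leftarrow>p. edge_crossings \<Gamma> e)"


section \<open>Linear combinations of paths\<close>

text \<open>The field of fractions of \<open>\<complex>[\<lambda>][\<mu>]\<close>, that is, the field of rational functions in \<open>\<lambda>\<close> and \<open>\<mu>\<close>.\<close>

type_synonym scalar = "complex poly poly fract"

definition lam :: scalar where "lam = Fract [:[:0, 1:]:] 1"
definition mu :: scalar where "mu = Fract [:0, 1:] 1"

text \<open>A path is a triple of its start, its list of edges and its end; identity morphisms have an
  empty list of edges.\<close>

type_synonym ('v, 'e) dpath = "'v \<times> 'e list \<times> 'v"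
type_synonym ('v, 'e) mor = "('v, 'e) dpath \<Rightarrow>\<^sub>0 scalar"
type_synonym ('v, 'e) tensor = "(('v, 'e) dpath \<times> ('v, 'e) dpath) \<Rightarrow>\<^sub>0 scalar"

definition psrc :: "('v, 'e) dpath \<Rightarrow> 'v" where "psrc p = fst p"
definition ptgt :: "('v, 'e) dpath \<Rightarrow> 'v" where "ptgt p = snd (snd p)"

definition scal :: "scalar \<Rightarrow> ('a \<Rightarrow>\<^sub>0 scalar) \<Rightarrow> ('a \<Rightarrow>\<^sub>0 scalar)" where
  "scal c f = Poly_Mapping.map ((*) c) f"

abbreviation basis :: "'a \<Rightarrow> ('a \<Rightarrow>\<^sub>0 scalar)" where
  "basis x \<equiv> Poly_Mapping.single x 1"

definition extend_linear :: "('a \<Rightarrow> ('b \<Rightarrow>\<^sub>0 scalar)) \<Rightarrow> ('a \<Rightarrow>\<^sub>0 scalar) \<Rightarrow> ('b \<Rightarrow>\<^sub>0 scalar)" where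
  "extend_linear F f = (\<Sum>x\<in>Poly_Mapping.keys f. scal (Poly_Mapping.lookup f x) (F x))"

definition extend_bilinear ::
  "('a \<Rightarrow> 'b \<Rightarrow> ('c \<Rightarrow>\<^sub>0 scalar)) \<Rightarrow> ('a \<Rightarrow>\<^sub>0 scalar) \<Rightarrow> ('b \<Rightarrow>\<^sub>0 scalar) \<Rightarrow> ('c \<Rightarrow>\<^sub>0 scalar)" where
  "extend_bilinear F f g = extend_linear (\<lambda>x. extend_linear (F x) g) f"

lemma lookup_scal: "Poly_Mapping.lookup (scal c f) x = c * Poly_Mapping.lookup f x"
  by (simp add: scal_def Poly_Mapping.map.rep_eq when_def)

global_interpretation pm: vector_space "scal :: scalar \<Rightarrow> ('a \<Rightarrow>\<^sub>0 scalar) \<Rightarrow> ('a \<Rightarrow>\<^sub>0 scalar)"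
  by unfold_locales
    (simp_all add: poly_mapping_eq_iff fun_eq_iff lookup_add lookup_scal algebra_simps)

definition concat_path :: "('v, 'e) dpath \<Rightarrow> ('v, 'e) dpath \<Rightarrow> ('v, 'e) dpath" where
  "concat_path p q = (psrc p, fst (snd p) @ fst (snd q), ptgt q)"

text \<open>Concatenation, left to right; the product of non-composable paths is zero, so that all the
  hom spaces live in one algebra.\<close>

definition path_mult :: "('v, 'e) dpath \<Rightarrow> ('v, 'e) dpath \<Rightarrow> ('v, 'e) mor" where
  "path_mult p q = (if ptgt p = psrc q then basis (concat_path p q) else 0)"

definition mor_mult :: "('v, 'e) mor \<Rightarrow> ('v, 'e) mor \<Rightarrow> ('v, 'e) mor" where
  "mor_mult = extend_bilinear path_mult"

definition id_path :: "'v \<Rightarrow> ('v, 'e) dpath" where "id_path v = (v, [], v)"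

definition arc_path :: "('v, 'e) pre_digraph \<Rightarrow> 'e \<Rightarrow> ('v, 'e) dpath" where
  "arc_path G e = (tail G e, [e], head G e)"

definition tens :: "('v, 'e) dpath \<Rightarrow> ('v, 'e) dpath \<Rightarrow> ('v, 'e) tensor" where
  "tens p q = basis (p, q)"

definition flip :: "('v, 'e) tensor \<Rightarrow> ('v, 'e) tensor" where
  "flip = extend_linear (\<lambda>(p, q). tens q p)"

definition tens_mult :: "('v, 'e) tensor \<Rightarrow> ('v, 'e) tensor \<Rightarrow> ('v, 'e) tensor" where
  "tens_mult = extend_bilinear (\<lambda>(p, q) (p', q').
     if ptgt p = psrc p' \<and> ptgt q = psrc q' then tens (concat_path p p') (concat_path q q') else 0)"

definition tens_concat :: "('v, 'e) tensor \<Rightarrow> ('v, 'e) mor" where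
  "tens_concat = extend_linear (\<lambda>(p, q). path_mult p q)"

definition dpaths :: "('v, 'e) pre_digraph \<Rightarrow> ('v, 'e) dpath set" where
  "dpaths G = {(u, p, v). pre_digraph.awalk G u p v}"

definition hom_paths :: "('v, 'e) dpath set \<Rightarrow> 'v \<Rightarrow> 'v \<Rightarrow> ('v, 'e) dpath set" where
  "hom_paths P u v = {p \<in> P. psrc p = u \<and> ptgt p = v}"

definition hom_space :: "('v, 'e) dpath set \<Rightarrow> 'v \<Rightarrow> 'v \<Rightarrow> ('v, 'e) mor set" where
  "hom_space P u v = {f. Poly_Mapping.keys f \<subseteq> hom_paths P u v}"


section \<open>Double brackets\<close>

text \<open>A bracket is a bilinear map and is therefore given by its values on pairs of paths.\<close>

type_synonym ('v, 'e) bracket = "('v, 'e) dpath \<Rightarrow> ('v, 'e) dpath \<Rightarrow> ('v, 'e) tensor"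

definition bracket_hom :: "('v, 'e) dpath set \<Rightarrow> ('v, 'e) bracket \<Rightarrow> bool" where
  "bracket_hom P br \<longleftrightarrow> (\<forall>f\<in>P. \<forall>g\<in>P.
     Poly_Mapping.keys (br f g) \<subseteq> hom_paths P (psrc g) (ptgt f) \<times> hom_paths P (psrc f) (ptgt g))"

definition bracket_skew :: "('v, 'e) dpath set \<Rightarrow> ('v, 'e) bracket \<Rightarrow> bool" where
  "bracket_skew P br \<longleftrightarrow> (\<forall>f\<in>P. \<forall>g\<in>P. br f g = - flip (br g f))"

definition bracket_leibniz :: "('v, 'e) dpath set \<Rightarrow> ('v, 'e) bracket \<Rightarrow> bool" where
  "bracket_leibniz P br \<longleftrightarrow>
     (\<forall>f\<in>P. \<forall>g\<in>P. \<forall>h\<in>P. ptgt f = psrc g \<longrightarrow>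
        br (concat_path f g) h =
          tens_mult (tens (id_path (psrc h)) f) (br g h) +
          tens_mult (br f h) (tens g (id_path (ptgt h)))) \<and>
     (\<forall>f\<in>P. \<forall>g\<in>P. \<forall>h\<in>P. ptgt g = psrc h \<longrightarrow>
        br f (concat_path g h) =
          tens_mult (tens g (id_path (psrc f))) (br f h) +
          tens_mult (br f g) (tens (id_path (ptgt f)) h))"

text \<open>The value at an internal vertex on a pair of edges listed in the order \<open>x\<^sub>1, x\<^sub>2\<close> (white) or
  \<open>y\<^sub>1, y\<^sub>2\<close> (black); pairs in the opposite order are covered by skew-symmetry in the definition of
  \<open>edge_bracket\<close> below.\<close>

definition vertex_term :: "('v, 'e) cyl_network \<Rightarrow> 'v \<Rightarrow> 'e \<Rightarrow> 'e \<Rightarrow> ('v, 'e) tensor" where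
  "vertex_term \<Gamma> v e f = (let G = digraph_of \<Gamma> in
     if white \<Gamma> v \<and> e \<in> out_arcs G v \<and> f \<in> out_arcs G v \<and> (\<exists>g \<in> in_arcs G v. ccw_at \<Gamma> v e f g)
     then scal (1/2) (tens (arc_path G e) (arc_path G f))
     else if black \<Gamma> v \<and> e \<in> in_arcs G v \<and> f \<in> in_arcs G v \<and> (\<exists>g \<in> out_arcs G v. ccw_at \<Gamma> v e f g)
     then scal (- 1/2) (tens (arc_path G f) (arc_path G e))
     else 0)"

definition edge_bracket :: "('v, 'e) cyl_network \<Rightarrow> 'e \<Rightarrow> 'e \<Rightarrow> ('v, 'e) tensor" where
  "edge_bracket \<Gamma> e f = (\<Sum>v\<in>internal \<Gamma>. vertex_term \<Gamma> v e f - flip (vertex_term \<Gamma> v f e))"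

definition standard_bracket :: "('v, 'e) cyl_network \<Rightarrow> ('v, 'e) bracket \<Rightarrow> bool" where
  "standard_bracket \<Gamma> br \<longleftrightarrow> (let G = digraph_of \<Gamma> in
     bracket_hom (dpaths G) br \<and> bracket_skew (dpaths G) br \<and> bracket_leibniz (dpaths G) br \<and>
     (\<forall>e \<in> arcs G. \<forall>f \<in> arcs G. br (arc_path G e) (arc_path G f) = edge_bracket \<Gamma> e f))"


section \<open>The torus category\<close>

text \<open>Gluing identifies \<open>sink i\<close> with \<open>source i\<close>; the vertex \<open>source i\<close> represents the object \<open>i\<close>.\<close>

definition glue :: "('v, 'e) cyl_network \<Rightarrow> 'v \<Rightarrow> 'v" where
  "glue \<Gamma> v = (if v \<in> sinks \<Gamma> then source \<Gamma> (inv_into {1..width \<Gamma>} (sink \<Gamma>) v) else v)"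

definition torus_digraph :: "('v, 'e) cyl_network \<Rightarrow> ('v, 'e) pre_digraph" where
  "torus_digraph \<Gamma> =
     \<lparr>verts = glue \<Gamma> ` verts (digraph_of \<Gamma>), arcs = arcs (digraph_of \<Gamma>),
      tail = glue \<Gamma> \<circ> tail (digraph_of \<Gamma>), head = glue \<Gamma> \<circ> head (digraph_of \<Gamma>)\<rparr>"

definition torus_paths :: "('v, 'e) cyl_network \<Rightarrow> ('v, 'e) dpath set" where
  "torus_paths \<Gamma> =
     {p \<in> dpaths (torus_digraph \<Gamma>). psrc p \<in> sources \<Gamma> \<and> ptgt p \<in> sources \<Gamma>}"

definition through_paths :: "('v, 'e) cyl_network \<Rightarrow> ('v, 'e) dpath set" where
  "through_paths \<Gamma> =
     {p \<in> dpaths (digraph_of \<Gamma>). psrc p \<in> sources \<Gamma> \<and> ptgt p \<in> sinks \<Gamma>}"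

definition glue_path :: "('v, 'e) cyl_network \<Rightarrow> ('v, 'e) dpath \<Rightarrow> ('v, 'e) dpath" where
  "glue_path \<Gamma> p = (glue \<Gamma> (psrc p), fst (snd p), glue \<Gamma> (ptgt p))"

definition glue_tensor :: "('v, 'e) cyl_network \<Rightarrow> ('v, 'e) tensor \<Rightarrow> ('v, 'e) tensor" where
  "glue_tensor \<Gamma> = extend_linear (\<lambda>(p, q). tens (glue_path \<Gamma> p) (glue_path \<Gamma> q))"

definition torus_bracket ::
  "('v, 'e) cyl_network \<Rightarrow> ('v, 'e) bracket \<Rightarrow> ('v, 'e) bracket \<Rightarrow> bool" where
  "torus_bracket \<Gamma> br dbr \<longleftrightarrow>
     bracket_hom (torus_paths \<Gamma>) dbr \<and> bracket_leibniz (torus_paths \<Gamma>) dbr \<and>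
     (\<forall>p \<in> through_paths \<Gamma>. \<forall>q \<in> through_paths \<Gamma>.
        dbr (glue_path \<Gamma> p) (glue_path \<Gamma> q) = glue_tensor \<Gamma> (br p q))"


section \<open>Cyclic space and induced bracket\<close>

definition loops :: "('v, 'e) cyl_network \<Rightarrow> ('v, 'e) mor set" where
  "loops \<Gamma> = {f. Poly_Mapping.keys f \<subseteq> (\<Union>X \<in> sources \<Gamma>. hom_paths (torus_paths \<Gamma>) X X)}"

definition commutator_space :: "('v, 'e) cyl_network \<Rightarrow> ('v, 'e) mor set" where
  "commutator_space \<Gamma> = pm.span
     {mor_mult f g - mor_mult g f | f g. \<exists>X \<in> sources \<Gamma>. \<exists>Y \<in> sources \<Gamma>.
        f \<in> hom_space (torus_paths \<Gamma>) X Y \<and> g \<in> hom_space (torus_paths \<Gamma>) Y X}"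

definition cyclic_rel :: "('v, 'e) cyl_network \<Rightarrow> (('v, 'e) mor \<times> ('v, 'e) mor) set" where
  "cyclic_rel \<Gamma> = {(f, g). f \<in> loops \<Gamma> \<and> g \<in> loops \<Gamma> \<and> f - g \<in> commutator_space \<Gamma>}"

definition cyclic_class :: "('v, 'e) cyl_network \<Rightarrow> ('v, 'e) mor \<Rightarrow> ('v, 'e) mor set" where
  "cyclic_class \<Gamma> f = cyclic_rel \<Gamma> `` {f}"

text \<open>The bracket of an element of the quotient \<open>loops \<Gamma> // cyclic_rel \<Gamma>\<close> with a morphism: the
  common value computed from all representatives (it exists since the concatenated bracket with a
  commutator vanishes).\<close>

definition induced_bracket :: "('v, 'e) bracket \<Rightarrow> ('v, 'e) mor set \<Rightarrow> ('v, 'e) mor \<Rightarrow> ('v, 'e) mor"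
  where
  "induced_bracket dbr c g = (THE h. \<forall>f\<in>c. tens_concat (extend_bilinear dbr f g) = h)"


section \<open>Matrices over the torus category\<close>

type_synonym ('v, 'e) mor_matrix = "nat \<Rightarrow> nat \<Rightarrow> ('v, 'e) mor"

definition mat_mult ::
  "('v, 'e) cyl_network \<Rightarrow> ('v, 'e) mor_matrix \<Rightarrow> ('v, 'e) mor_matrix \<Rightarrow> ('v, 'e) mor_matrix" where
  "mat_mult \<Gamma> A B = (\<lambda>a b. \<Sum>c\<in>{1..width \<Gamma>}. mor_mult (A a c) (B c b))"

definition mat_one :: "('v, 'e) cyl_network \<Rightarrow> ('v, 'e) mor_matrix" where
  "mat_one \<Gamma> = (\<lambda>a b. if a = b then basis (id_path (source \<Gamma> a)) else 0)"

definition mat_power :: "('v, 'e) cyl_network \<Rightarrow> ('v, 'e) mor_matrix \<Rightarrow> nat \<Rightarrow> ('v, 'e) mor_matrix"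
  where
  "mat_power \<Gamma> A k = (mat_mult \<Gamma> A ^^ k) (mat_one \<Gamma>)"

definition mat_trace :: "('v, 'e) cyl_network \<Rightarrow> ('v, 'e) mor_matrix \<Rightarrow> ('v, 'e) mor" where
  "mat_trace \<Gamma> A = (\<Sum>a\<in>{1..width \<Gamma>}. A a a)"

definition boundary_measurement :: "('v, 'e) cyl_network \<Rightarrow> scalar \<Rightarrow> ('v, 'e) mor_matrix" where
  "boundary_measurement \<Gamma> x = (\<lambda>i j.
     \<Sum>p | pre_digraph.awalk (digraph_of \<Gamma>) (source \<Gamma> i) p (sink \<Gamma> j).
       scal (x powi crossings \<Gamma> p) (basis (glue_path \<Gamma> (source \<Gamma> i, p, sink \<Gamma> j))))"

definition rho :: "nat \<Rightarrow> nat \<Rightarrow> scalar" where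
  "rho a b = (if a < b then lam / (mu - lam)
              else if a = b then 1/2 * ((mu + lam) / (mu - lam))
              else mu / (mu - lam))"

definition lax_matrix :: "('v, 'e) cyl_network \<Rightarrow> nat \<Rightarrow> ('v, 'e) mor_matrix" where
  "lax_matrix \<Gamma> k = (\<lambda>a b.
     scal (of_nat k * rho b a) (mat_power \<Gamma> (boundary_measurement \<Gamma> lam) k a b))"

end

theory Submission
  imports Defs
begin

text \<open>
  The bracket of two source-to-sink paths is a sum over the vertices at which they separate or merge; each
  term exchanges the parts of the two paths behind such a vertex. Grouping the terms of
  \<open>{{B(\<lambda>)\<^bsub>ij\<^esub>, B(\<mu>)\<^bsub>ab\<^esub>}}\<close> by the rerouted pair \<open>u: a \<rightarrow> j\<close>, \<open>w: i \<rightarrow> b\<close>, one has to sum the signs of the vertices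
  common to \<open>u\<close> and \<open>w\<close>, weighted by \<open>(\<mu>/\<lambda>)\<^sup>n\<close>, where \<open>n\<close> is the difference of the numbers of crossings with
  the cut before that vertex. For fixed \<open>n\<close> these are the vertices where the lift of \<open>u\<close> to the universal cover
  meets the \<open>n\<close>-th translate of the lift of \<open>w\<close>. Acyclicity allows both lifts to be parametrised by a common
  height function, so that the two strands have a well defined relative position, which changes at
  the common vertices exactly by their signs. The sum therefore telescopes to the difference of the relative
  positions at the two ends, and summing the resulting step functions of \<open>n\<close> against \<open>(\<mu>/\<lambda>)\<^sup>n\<close> gives
  \<open>\<rho>\<^bsub>ia\<^esub> B(\<lambda>)\<^bsub>aj\<^esub> \<otimes> B(\<mu>)\<^bsub>ib\<^esub> - \<rho>\<^bsub>bj\<^esub> B(\<mu>)\<^bsub>aj\<^esub> \<otimes> B(\<lambda>)\<^bsub>ib\<^esub>\<close>. By the Leibniz rule and cyclicity all \<open>k\<close> factors of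
  \<open>tr B(\<lambda>)\<^sup>k\<close> contribute equally, which yields the Lax equation.
\<close>

section \<open>Turning around a trivalent vertex\<close>

text \<open>The edges are merely continuous curves, so a vertex has no tangent directions, and the
  cyclic order seen on small circles must be related to positions along whole strands by topology
  alone. The tool is a continuous logarithm of the chord from one strand to the other. Strands f, g
  meet only at equal times, so on the convex triangle s < t the chords g t - f s and f t - g s never
  vanish and have logarithms \<open>A\<close> and \<open>B\<close>. Position is read from
  \<open>B - A\<close> near the diagonal and not on it, because the strands may coincide there for a
  while. At a vertex the logarithms of the chords between three half-edges change by \<plusminus> i
  pi in total, found by adding three angles on a small circle. At both ends of time the chords from
  or to an end point run rightwards, so principal logarithms give the boundary values. As functions
  of the sheet n these are sign functions with a step; multiplied by x^n, x = mu / lam, and summed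
  they are geometric series. The steps of sources and sinks agree for large |n|, so a finite window
  suffices, its boundary terms cancel, and \<open>rho\<close> is what one step leaves
  behind.\<close>

lemma log_difference_constant:
  fixes f g :: "'a::topological_space \<Rightarrow> complex"
  assumes "connected S" "continuous_on S f" "continuous_on S g"
    and "\<And>x. x \<in> S \<Longrightarrow> exp (f x) = exp (g x)" "x \<in> S" "y \<in> S"
  shows "f x - g x = f y - g y"
proof -
  have "(\<lambda>x. f x - g x) constant_on S"
  proof (rule continuous_discrete_range_constant)
    fix u assume u: "u \<in> S"
    \<comment> \<open>The values are integer multiples of 2 pi i, so distinct ones are at least 2 pi
      apart.\<close>
    have "2 * pi \<le> norm ((f v - g v) - (f u - g u))"
      if v: "v \<in> S" and ne: "f v - g v \<noteq> f u - g u" for v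
    proof -
      have "exp (f v - g v) = 1" "exp (f u - g u) = 1"
        using assms(4) u v by (auto simp: exp_diff)
      then have "exp ((f v - g v) - (f u - g u)) = 1" by (simp add: exp_diff)
      then obtain n :: int where n: "Re ((f v - g v) - (f u - g u)) = 0"
        "Im ((f v - g v) - (f u - g u)) = of_int (2 * n) * pi"
        by (auto simp: exp_eq_1)
      with ne have "n \<noteq> 0" by (auto simp: complex_eq_iff)
      then have "1 \<le> \<bar>real_of_int n\<bar>" by linarith
      then have "2 * pi \<le> \<bar>Im ((f v - g v) - (f u - g u))\<bar>"
        unfolding n(2) by (simp add: abs_mult)
      also have "\<dots> \<le> norm ((f v - g v) - (f u - g u))" by (rule abs_Im_le_cmod)
      finally show ?thesis .
    qed
    then show "\<exists>e>0. \<forall>v. v \<in> S \<and> f v - g v \<noteq> f u - g u \<longrightarrow> e \<le> norm ((f v - g v) - (f u - g u))"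
      using pi_gt_zero by (intro exI[of _ "2 * pi"]) auto
  qed (use assms in \<open>auto intro: continuous_on_diff\<close>)
  then show ?thesis using assms(5,6) unfolding constant_on_def by auto
qed

text \<open>In the open half plane around the direction \<open>d\<close> the quotient
  \<open>F / d\<close> avoids the branch cut, so its principal logarithm is continuous and differs
  from \<open>L\<close> by a constant.\<close>

lemma log_change_in_half_plane:
  fixes F L :: "'a::topological_space \<Rightarrow> complex"
  assumes "connected S" "continuous_on S L" "\<And>x. x \<in> S \<Longrightarrow> exp (L x) = F x"
    and pos: "\<And>x. x \<in> S \<Longrightarrow> 0 < Re (F x * cnj d)" and "x \<in> S" "y \<in> S"
  shows "L y - L x = Ln (F y / d) - Ln (F x / d)"
proof -
  have d: "d \<noteq> 0" using pos[OF \<open>x \<in> S\<close>] by auto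
  have contF: "continuous_on S F"
    using continuous_on_exp[OF assms(2)] assms(3) by (simp cong: continuous_on_cong)
  have re: "0 < Re (F u / d)" if "u \<in> S" for u
    using pos[OF that] d
    by (metis complex_div_cnj Re_divide_of_real of_real_power zero_less_divide_iff zero_less_norm_iff zero_less_power)
  have "continuous_on S (\<lambda>u. Ln (F u / d))"
  proof (rule continuous_on_Ln')
    show "continuous_on S (\<lambda>u. F u / d)" using contF d by (intro continuous_intros) auto
    show "F u / d \<notin> \<real>\<^sub>\<le>\<^sub>0" if "u \<in> S" for u
      using re[OF that] by (auto simp: complex_nonpos_Reals_iff)
  qed
  moreover have "exp (L u - Ln d) = exp (Ln (F u / d))" if "u \<in> S" for u
  proof -
    have "F u / d \<noteq> 0" using re[OF that] by auto
    then show ?thesis using assms(3)[OF that] d by (simp add: exp_diff)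
  qed
  ultimately have "(L y - Ln d) - Ln (F y / d) = (L x - Ln d) - Ln (F x / d)"
    using assms by (intro log_difference_constant[where S=S]) (auto intro: continuous_on_diff)
  then show ?thesis by (simp add: algebra_simps)
qed

text \<open>Polarisation: the real part is half of |a|^2 - |u|^2 + |a - u|^2. This supplies the half
  planes for chords with one end on a circle and the other in its disc.\<close>

lemma Re_mult_cnj_chord:
  assumes "cmod u \<le> cmod a" "u \<noteq> a"
  shows "0 < Re ((a - u) * cnj a)"
proof -
  have "Re ((a - u) * cnj a) = inner a a - inner u a"
    by (simp add: inner_complex_def algebra_simps)
  also have "\<dots> = (cmod a)\<^sup>2 - ((cmod u)\<^sup>2 + (cmod a)\<^sup>2 - (cmod (u - a))\<^sup>2) / 2"
    unfolding dot_norm_neg[of u a] by (simp add: power2_norm_eq_inner)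
  also have "0 < \<dots>"
  proof -
    have "0 < (cmod (u - a))\<^sup>2" using assms(2) by simp
    moreover have "(cmod u)\<^sup>2 \<le> (cmod a)\<^sup>2" using assms(1) by (intro power_mono) auto
    ultimately have "(cmod u)\<^sup>2 < (cmod a)\<^sup>2 + (cmod (u - a))\<^sup>2" by linarith
    then show ?thesis by (simp add: field_simps)
  qed
  finally show ?thesis .
qed
text \<open>On the unit circle 1 / w is the conjugate of w, so the difference is 2i times the
  argument of 1 - w; and (1 - w)^2 is -w times a positive number, so that doubled argument is the
  principal argument of -w.\<close>

lemma Ln_chord:
  assumes "cmod w = 1" "w \<noteq> 1"
  shows "Ln (1 - w) - Ln (1 - 1 / w) = \<i> * of_real (Arg2pi w - pi)"
proof -
  have w0: "w \<noteq> 0" using assms by auto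
  have inv: "1 / w = cnj w"
    using assms(1) by (metis complex_norm_square divide_complex_def inverse_unique lambda_one mult.commute of_real_1 one_power2)
  have sq: "w * cnj w = 1" using inv w0 by (simp add: field_simps)
  have re: "0 < Re (1 - w)"
    using Re_mult_cnj_chord[of w 1] assms by simp
  have "Ln (1 - cnj w) = cnj (Ln (1 - w))"
    using cnj_Ln[of "1 - w"] re by (auto simp: complex_nonpos_Reals_iff)
  then have lhs: "Ln (1 - w) - Ln (1 - 1 / w) = \<i> * of_real (2 * Im (Ln (1 - w)))"
    unfolding inv by (simp add: complex_eq_iff)
  have "w * cnj (1 - w) = w - 1" using sq by (simp add: algebra_simps)
  then have "(1 - w)\<^sup>2 = - w * ((1 - w) * cnj (1 - w))"
    by (simp add: power2_eq_square algebra_simps)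
  also have "\<dots> = - w * of_real ((cmod (1 - w))\<^sup>2)"
    using complex_norm_square[of "1 - w"] by simp
  finally have e: "(1 - w)\<^sup>2 = - w * of_real ((cmod (1 - w))\<^sup>2)" .
  have n0: "0 < (cmod (1 - w))\<^sup>2" using assms by simp
  have im: "\<bar>Im (Ln (1 - w))\<bar> < pi / 2"
    using re by (intro Re_Ln_pos_lt_imp) auto
  have "Ln ((1 - w)\<^sup>2) = 2 * Ln (1 - w)"
  proof -
    have "exp (2 * Ln (1 - w)) = (1 - w)\<^sup>2"
      using assms by (simp add: exp_double)
    then show ?thesis using im by (intro Ln_unique) (auto simp: abs_if split: if_splits)
  qed
  moreover have "Ln (- w * of_real ((cmod (1 - w))\<^sup>2)) = of_real (ln ((cmod (1 - w))\<^sup>2)) + Ln (- w)"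
    using Ln_times_of_real[OF n0, of "- w"] Ln_of_real[OF n0] w0
    by (simp only: mult.commute neg_equal_0_iff_equal not_False_eq_True)
  ultimately have "2 * Ln (1 - w) = of_real (ln ((cmod (1 - w))\<^sup>2)) + Ln (- w)"
    using e by simp
  from arg_cong[OF this, of Im] have "2 * Im (Ln (1 - w)) = Im (Ln (- w))" by simp
  moreover have "0 < Arg2pi w"
  proof -
    have "Arg2pi w \<noteq> 0"
    proof
      assume "Arg2pi w = 0"
      then have "Im w = 0" "0 \<le> Re w" by (auto simp: Arg2pi_eq_0 complex_is_Real_iff)
      moreover from this have "Re w = 1" using assms(1) by (simp add: cmod_def)
      ultimately show False using assms(2) by (simp add: complex_eq_iff)
    qed
    then show ?thesis using Arg2pi[of w] by linarith
  qed
  ultimately show ?thesis unfolding lhs using Arg2pi_Ln[of w] by simp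
qed

text \<open>The square is punctured at the corner, where both arcs sit at their common starting
  point. Its sides s = 0 and t = 0 are kept: there the chord joins one arc to that point.\<close>

definition difference_log ::
  "real \<Rightarrow> (real \<Rightarrow> complex) \<Rightarrow> (real \<Rightarrow> complex) \<Rightarrow> (real \<times> real \<Rightarrow> complex) \<Rightarrow> bool" where
  "difference_log \<epsilon> a b L \<longleftrightarrow> continuous_on ({0..\<epsilon>} \<times> {0..\<epsilon>} - {(0, 0)}) L \<and>
     (\<forall>s\<in>{0..\<epsilon>}. \<forall>t\<in>{0..\<epsilon>}. (s, t) \<noteq> (0, 0) \<longrightarrow> exp (L (s, t)) = b t - a s)"

text \<open>How much the chord rotates on its way from \<open>(x, 0)\<close>, where it runs from the
  first arc to the common point, to \<open>(0, y)\<close>, where it runs from that point to the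
  second arc.\<close>

definition turn :: "(real \<times> real \<Rightarrow> complex) \<Rightarrow> real \<Rightarrow> real \<Rightarrow> complex" where
  "turn L x y = L (0, y) - L (x, 0)"

definition ccw_triple :: "complex \<Rightarrow> complex \<Rightarrow> complex \<Rightarrow> bool" where
  "ccw_triple u v w \<longleftrightarrow> 0 < Arg2pi (v / u) \<and> Arg2pi (v / u) < Arg2pi (w / u)"

lemma difference_logD:
  assumes "difference_log \<epsilon> a b L" "0 \<le> s" "s \<le> \<epsilon>" "0 \<le> t" "t \<le> \<epsilon>" "s \<noteq> 0 \<or> t \<noteq> 0"
  shows "exp (L (s, t)) = b t - a s" "b t \<noteq> a s"
proof -
  show "exp (L (s, t)) = b t - a s" using assms by (auto simp: difference_log_def)
  then show "b t \<noteq> a s" by (metis exp_not_eq_zero right_minus_eq)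
qed

text \<open>The chord is moved through the position \<open>(x, y)\<close>. On both stretches one end
  is fixed on the circle while the other stays in the disc, so the chord remains in a half plane;
  \<open>Ln_chord\<close> combines the two changes.\<close>

lemma turn_on_circle:
  assumes L: "difference_log \<epsilon> a b L" and p: "a 0 = p" "b 0 = p"
    and x: "0 < x" "x \<le> \<epsilon>" and y: "0 < y" "y \<le> \<epsilon>" and r: "0 < r"
    and ax: "cmod (a x - p) = r" "\<And>s. 0 \<le> s \<Longrightarrow> s \<le> x \<Longrightarrow> cmod (a s - p) \<le> r"
    and bx: "cmod (b y - p) = r" "\<And>t. 0 \<le> t \<Longrightarrow> t \<le> y \<Longrightarrow> cmod (b t - p) \<le> r"
  shows "turn L x y = \<i> * of_real (Arg2pi ((b y - p) / (a x - p)) - pi)"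
proof -
  let ?\<alpha> = "a x - p" and ?\<beta> = "b y - p"
  have "b y \<noteq> a x" using difference_logD(2)[OF L, of x y] x y by simp
  then have nz: "?\<alpha> \<noteq> 0" "?\<beta> \<noteq> 0" "?\<beta> \<noteq> ?\<alpha>"
    using ax(1) bx(1) r by auto
  have cont: "continuous_on ({0..\<epsilon>} \<times> {0..\<epsilon>} - {(0, 0)}) L"
    using L by (simp add: difference_log_def)
  have "L (x, y) - L (x, 0) = Ln ((b y - a x) / (- ?\<alpha>)) - Ln ((b 0 - a x) / (- ?\<alpha>))"
  proof (rule log_change_in_half_plane[where S = "{0..y}" and F = "\<lambda>t. b t - a x"])
    show "continuous_on {0..y} (\<lambda>t. L (x, t))"
      using x y by (intro continuous_on_compose2[OF cont] continuous_intros) auto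
    fix t assume t: "t \<in> {0..y}"
    show "exp (L (x, t)) = b t - a x" using t x y by (intro difference_logD(1)[OF L]) auto
    have "b t \<noteq> a x" using t x y by (intro difference_logD(2)[OF L]) auto
    then have "0 < Re ((?\<alpha> - (b t - p)) * cnj ?\<alpha>)"
      using ax bx(2)[of t] t by (intro Re_mult_cnj_chord) auto
    then show "0 < Re ((b t - a x) * cnj (- ?\<alpha>))"
      by (simp add: algebra_simps)
  qed (use y in auto)
  also have "(b 0 - a x) / (- ?\<alpha>) = 1" using p nz by (simp add: field_simps)
  finally have 1: "L (x, y) - L (x, 0) = Ln ((b y - a x) / (- ?\<alpha>))" by simp
  have "L (x, y) - L (0, y) = Ln ((b y - a x) / ?\<beta>) - Ln ((b y - a 0) / ?\<beta>)"
  proof (rule log_change_in_half_plane[where S = "{0..x}" and F = "\<lambda>s. b y - a s"])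
    show "continuous_on {0..x} (\<lambda>s. L (s, y))"
      using x y by (intro continuous_on_compose2[OF cont] continuous_intros) auto
    fix s assume s: "s \<in> {0..x}"
    show "exp (L (s, y)) = b y - a s" using s x y by (intro difference_logD(1)[OF L]) auto
    have "b y \<noteq> a s" using s x y by (intro difference_logD(2)[OF L]) auto
    then have "0 < Re ((?\<beta> - (a s - p)) * cnj ?\<beta>)"
      using bx(1) ax(2)[of s] s by (intro Re_mult_cnj_chord) auto
    then show "0 < Re ((b y - a s) * cnj ?\<beta>)"
      by (simp add: algebra_simps)
  qed (use x in auto)
  also have "(b y - a 0) / ?\<beta> = 1" using p nz by (simp add: field_simps)
  finally have 2: "L (x, y) - L (0, y) = Ln ((b y - a x) / ?\<beta>)" by simp
  have "turn L x y = Ln ((b y - a x) / (- ?\<alpha>)) - Ln ((b y - a x) / ?\<beta>)"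
    unfolding turn_def 1[symmetric] 2[symmetric] by simp
  also have "(b y - a x) / (- ?\<alpha>) = 1 - ?\<beta> / ?\<alpha>" using nz by (simp add: field_simps)
  also have "(b y - a x) / ?\<beta> = 1 - 1 / (?\<beta> / ?\<alpha>)" using nz by (simp add: field_simps)
  finally have t: "turn L x y = Ln (1 - ?\<beta> / ?\<alpha>) - Ln (1 - 1 / (?\<beta> / ?\<alpha>))" .
  have "cmod (?\<beta> / ?\<alpha>) = 1" using ax(1) bx(1) r by (simp add: norm_divide)
  moreover have "?\<beta> / ?\<alpha> \<noteq> 1" using nz by simp
  ultimately show ?thesis unfolding t by (rule Ln_chord)
qed

lemma Arg2pi_positive:
  assumes "cmod u = cmod v" "u \<noteq> v" "v \<noteq> 0"
  shows "0 < Arg2pi (u / v)"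
proof -
  have "Arg2pi (u / v) \<noteq> 0"
  proof
    assume "Arg2pi (u / v) = 0"
    then have "Im (u / v) = 0" "0 \<le> Re (u / v)" by (auto simp: Arg2pi_eq_0 complex_is_Real_iff)
    moreover have "cmod (u / v) = 1" using assms by (auto simp: norm_divide)
    ultimately have "u / v = 1" by (auto simp: cmod_def complex_eq_iff)
    then show False using assms by simp
  qed
  then show ?thesis using Arg2pi[of "u / v"] by linarith
qed

text \<open>Visiting three points of a circle counterclockwise takes one full turn if this is their
  cyclic order, and two if it is the opposite one.\<close>

lemma Arg2pi_sum_three:
  assumes "cmod u = cmod v" "cmod v = cmod w" "u \<noteq> v" "v \<noteq> w" "u \<noteq> w" "u \<noteq> 0"
  defines "S \<equiv> Arg2pi (v / u) + Arg2pi (w / v) + Arg2pi (u / w)"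
  shows "(ccw_triple u v w \<and> S = 2 * pi) \<or> (ccw_triple v u w \<and> S = 4 * pi)"
proof -
  have nz: "v \<noteq> 0" "w \<noteq> 0" using assms by auto
  have inv: "Arg2pi (x / y) = 2 * pi - Arg2pi (y / x)"
    if "cmod x = cmod y" "x \<noteq> y" "x \<noteq> 0" "y \<noteq> 0" for x y
  proof (cases "y / x \<in> \<real>")
    case True
    have "0 < Arg2pi (y / x)" using that by (intro Arg2pi_positive) auto
    then have "Arg2pi (y / x) = pi" using True by (auto simp: Arg2pi_real split: if_splits)
    then show ?thesis using Arg2pi_inverse[of "y / x"] True by simp
  qed (use Arg2pi_inverse[of "y / x"] in simp)
  have e: "w / v = (w / u) / (v / u)" "v / w = (v / u) / (w / u)" using nz assms by auto
  have p: "0 < Arg2pi (v / u)" "0 < Arg2pi (w / u)" "0 < Arg2pi (w / v)"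
    using assms nz by (auto intro!: Arg2pi_positive)
  have l: "Arg2pi (v / u) < 2 * pi" "Arg2pi (w / u) < 2 * pi" using Arg2pi by auto
  have uw: "Arg2pi (u / w) = 2 * pi - Arg2pi (w / u)" "Arg2pi (u / v) = 2 * pi - Arg2pi (v / u)"
    "Arg2pi (w / v) = 2 * pi - Arg2pi (v / w)"
    using assms nz by (auto intro!: inv)
  show ?thesis
  proof (cases "Arg2pi (v / u) \<le> Arg2pi (w / u)")
    case True
    then have "Arg2pi (w / v) = Arg2pi (w / u) - Arg2pi (v / u)"
      unfolding e using nz assms by (intro Arg2pi_divide) auto
    then show ?thesis using p uw unfolding S_def ccw_triple_def by auto
  next
    case False
    then have "Arg2pi (v / w) = Arg2pi (v / u) - Arg2pi (w / u)"
      unfolding e using nz assms by (intro Arg2pi_divide) auto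
    then show ?thesis using p uw l unfolding S_def ccw_triple_def by auto
  qed
qed

text \<open>Three arcs that leave a common point. Their total turn is \<open>\<plusminus> \<i> \<pi>\<close>, and its sign records their
  cyclic order.\<close>

locale tripod =
  fixes \<epsilon> :: real and a b c :: "real \<Rightarrow> complex" and p :: complex and L1 L2 L3
  assumes ab: "difference_log \<epsilon> a b L1" and bc: "difference_log \<epsilon> b c L2"
    and ca: "difference_log \<epsilon> c a L3" and p: "a 0 = p" "b 0 = p" "c 0 = p" and \<epsilon>: "0 < \<epsilon>"
begin

definition "total_turn x y z = turn L1 x y + turn L2 y z + turn L3 z x"

text \<open>Each of the three differences to \<open>p\<close> occurs once in a numerator and once,
  negated, in a denominator; three signs remain.\<close>

lemma exp_total_turn:
  assumes "x \<in> {0<..\<epsilon>}" "y \<in> {0<..\<epsilon>}" "z \<in> {0<..\<epsilon>}"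
  shows "exp (total_turn x y z) = -1"
proof -
  have 1: "exp (L1 (0, y)) = b y - p" "exp (L1 (x, 0)) = p - a x"
       "exp (L2 (0, z)) = c z - p" "exp (L2 (y, 0)) = p - b y"
       "exp (L3 (0, x)) = a x - p" "exp (L3 (z, 0)) = p - c z"
    using assms difference_logD(1)[OF ab] difference_logD(1)[OF bc] difference_logD(1)[OF ca] p by auto
  have nz: "a x - p \<noteq> 0" "b y - p \<noteq> 0" "c z - p \<noteq> 0"
    using 1(1,3,5) exp_not_eq_zero by (auto simp del: right_minus_eq simp flip: 1)
  have "exp (total_turn x y z) = (exp (L1 (0, y)) / exp (L1 (x, 0))) *
      (exp (L2 (0, z)) / exp (L2 (y, 0))) * (exp (L3 (0, x)) / exp (L3 (z, 0)))"
    unfolding total_turn_def turn_def exp_add exp_diff by (rule refl)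
  also have "\<dots> = ((b y - p) / - (a x - p)) * ((c z - p) / - (b y - p)) * ((a x - p) / - (c z - p))"
    unfolding 1 by simp
  also have "\<dots> = -1"
  proof -
    have "(Y / - X) * (Z / - Y) * (X / - Z) = -1" if "X \<noteq> 0" "Y \<noteq> 0" "Z \<noteq> 0" for X Y Z :: complex
      using that by simp
    then show ?thesis using nz by blast
  qed
  finally show ?thesis .
qed

lemma total_turn_constant:
  assumes "x \<in> {0<..\<epsilon>}" "y \<in> {0<..\<epsilon>}" "z \<in> {0<..\<epsilon>}" "x' \<in> {0<..\<epsilon>}" "y' \<in> {0<..\<epsilon>}" "z' \<in> {0<..\<epsilon>}"
  shows "total_turn x y z = total_turn x' y' z'"
proof -
  let ?S = "{0<..\<epsilon>} \<times> {0<..\<epsilon>} \<times> {0<..\<epsilon>}"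
  let ?D = "{0..\<epsilon>} \<times> {0..\<epsilon>} - {(0::real, 0::real)}"
  have cont: "continuous_on ?D L1" "continuous_on ?D L2" "continuous_on ?D L3"
    using ab bc ca by (auto simp: difference_log_def)
  have "continuous_on ?S (\<lambda>(x, y, z). total_turn x y z)"
    unfolding total_turn_def turn_def case_prod_unfold using \<epsilon>
    by (intro continuous_intros continuous_on_compose2[OF cont(1)] continuous_on_compose2[OF cont(2)] continuous_on_compose2[OF cont(3)]) auto
  moreover have "connected ?S" by (intro convex_connected convex_Times) auto
  ultimately have "(\<lambda>(x, y, z). total_turn x y z) (x, y, z) - \<i> * pi = (\<lambda>(x, y, z). total_turn x y z) (x', y', z') - \<i> * pi"
    using assms exp_total_turn
    by (intro log_difference_constant[where S = ?S and g = "\<lambda>_. \<i> * pi"]) (auto simp del: One_nat_def)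
  then show ?thesis by simp
qed

text \<open>Each pair contributes its angle minus pi, so the angle sums 2 pi and 4 pi become -pi and
  pi. Counterclockwise order thus gives the negative sign, the origin of the minus in
  \<open>index_jump\<close>.\<close>

lemma total_turn_on_circle:
  assumes x: "0 < x" "x \<le> \<epsilon>" and y: "0 < y" "y \<le> \<epsilon>" and z: "0 < z" "z \<le> \<epsilon>" and r: "0 < r"
    and ax: "cmod (a x - p) = r" "\<And>s. 0 \<le> s \<Longrightarrow> s \<le> x \<Longrightarrow> cmod (a s - p) \<le> r"
    and bx: "cmod (b y - p) = r" "\<And>t. 0 \<le> t \<Longrightarrow> t \<le> y \<Longrightarrow> cmod (b t - p) \<le> r"
    and cx: "cmod (c z - p) = r" "\<And>t. 0 \<le> t \<Longrightarrow> t \<le> z \<Longrightarrow> cmod (c t - p) \<le> r"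
  shows "(ccw_triple (a x - p) (b y - p) (c z - p) \<and> total_turn x y z = - \<i> * pi) \<or>
         (ccw_triple (b y - p) (a x - p) (c z - p) \<and> total_turn x y z = \<i> * pi)"
proof -
  let ?\<phi> = "\<lambda>u v. Arg2pi (v / u)"
  let ?A = "a x - p" and ?B = "b y - p" and ?C = "c z - p"
  have "total_turn x y z = \<i> * of_real (?\<phi> ?A ?B - pi) + \<i> * of_real (?\<phi> ?B ?C - pi) + \<i> * of_real (?\<phi> ?C ?A - pi)"
    unfolding total_turn_def
    using turn_on_circle[OF ab p(1,2) x y r ax bx] turn_on_circle[OF bc p(2,3) y z r bx cx]
      turn_on_circle[OF ca p(3,1) z x r cx ax] by simp
  also have "\<dots> = \<i> * of_real ((?\<phi> ?A ?B + ?\<phi> ?B ?C + ?\<phi> ?C ?A) - 3 * pi)"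
    by (simp add: algebra_simps)
  finally have e: "total_turn x y z = \<i> * of_real ((?\<phi> ?A ?B + ?\<phi> ?B ?C + ?\<phi> ?C ?A) - 3 * pi)" .
  have "b y \<noteq> a x" "c z \<noteq> b y" "a x \<noteq> c z"
    using difference_logD(2)[OF ab, of x y] difference_logD(2)[OF bc, of y z]
      difference_logD(2)[OF ca, of z x] x y z by auto
  then have "?A \<noteq> ?B" "?B \<noteq> ?C" "?A \<noteq> ?C" by auto
  moreover have "?A \<noteq> 0" using ax(1) r by auto
  ultimately have "(ccw_triple ?A ?B ?C \<and> ?\<phi> ?A ?B + ?\<phi> ?B ?C + ?\<phi> ?C ?A = 2 * pi) \<or>
    (ccw_triple ?B ?A ?C \<and> ?\<phi> ?A ?B + ?\<phi> ?B ?C + ?\<phi> ?C ?A = 4 * pi)"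
    using ax(1) bx(1) cx(1) by (intro Arg2pi_sum_three) auto
  then show ?thesis
  proof (elim disjE conjE)
    assume "?\<phi> ?A ?B + ?\<phi> ?B ?C + ?\<phi> ?C ?A = 2 * pi"
    then have "total_turn x y z = - \<i> * pi" unfolding e by simp
    then show ?thesis if "ccw_triple ?A ?B ?C" using that by simp
  next
    assume "?\<phi> ?A ?B + ?\<phi> ?B ?C + ?\<phi> ?C ?A = 4 * pi"
    then have "total_turn x y z = \<i> * pi" unfolding e by simp
    then show ?thesis if "ccw_triple ?B ?A ?C" using that by simp
  qed
qed

end

text \<open>The times at distance \<open>r\<close> form a nonempty closed set, so the infimum in
  \<open>first_exit\<close> is one of them; a larger distance before it would force an earlier such
  time.\<close>

lemma first_exit_attained:
  assumes "continuous_on {0..1} g" "0 < r" "0 < \<tau>" "\<tau> \<le> 1" "r \<le> cmod (g \<tau> - g 0)"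
  obtains x where "0 < x" "x \<le> \<tau>" "first_exit g r = g x" "cmod (g x - g 0) = r"
    "\<And>t. 0 \<le> t \<Longrightarrow> t \<le> x \<Longrightarrow> cmod (g t - g 0) \<le> r"
proof -
  define d where "d t = cmod (g t - g 0)" for t
  let ?S = "{t \<in> {0..1}. d t = r}"
  have cont: "continuous_on {0..1} d" unfolding d_def using assms(1) by (intro continuous_intros)
  have S: "{t \<in> {0..1}. dist (g 0) (g t) = r} = ?S"
    by (auto simp: d_def dist_norm norm_minus_commute)
  have "\<exists>x\<ge>0. x \<le> \<tau> \<and> d x = r"
    using assms continuous_on_subset[OF cont, of "{0..\<tau>}"] by (intro IVT') (auto simp: d_def)
  then obtain x0 where x0: "0 \<le> x0" "x0 \<le> \<tau>" "d x0 = r" by auto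
  have clS: "closed ?S"
    using continuous_closed_preimage[OF cont, of "{r}"] by (simp add: vimage_def Int_def)
  have bdd: "bdd_below ?S" by (rule bdd_belowI[of _ 0]) auto
  define x where "x = Inf ?S"
  have "x \<in> ?S" unfolding x_def
  proof (rule closed_contains_Inf[OF _ bdd clS])
    show "?S \<noteq> {}" using x0 assms(4) by fastforce
  qed
  then have x: "0 \<le> x" "x \<le> 1" "d x = r" by auto
  have le: "x \<le> \<tau>" unfolding x_def using bdd x0 assms(4) by (intro cInf_lower2[of x0]) auto
  have pos: "0 < x" using x assms(2) by (cases "x = 0") (auto simp: d_def)
  have "d t \<le> r" if t: "0 \<le> t" "t \<le> x" for t
  proof (rule ccontr)
    assume "\<not> d t \<le> r"
    then have "r \<le> d t" by simp
    then have "\<exists>y\<ge>0. y \<le> t \<and> d y = r"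
      using assms(2) t x continuous_on_subset[OF cont, of "{0..t}"] by (intro IVT') (auto simp: d_def)
    then obtain y where y: "0 \<le> y" "y \<le> t" "d y = r" by auto
    then have "x \<le> y" unfolding x_def using bdd t x by (intro cInf_lower) auto
    with y t have "y = x" "t = x" by auto
    then show False using \<open>\<not> d t \<le> r\<close> x(3) by simp
  qed
  moreover have "first_exit g r = g x" unfolding first_exit_def S x_def by simp
  ultimately show thesis using that[of x] pos le x by (auto simp: d_def)
qed

text \<open>The factor by which the chord from \<open>exp u\<close> to \<open>exp v\<close> differs from the one from \<open>u\<close> to \<open>v\<close>, close
  to 1 near \<open>p\<close>: hence a tripod turns in the same way in the annulus and in its universal cover.\<close>

definition exp_chord :: "complex \<Rightarrow> complex \<Rightarrow> complex \<Rightarrow> complex" where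
  "exp_chord p u v = (exp v - exp u) / ((v - u) * exp p)"

lemma exp_chord_commute: "exp_chord p u v = exp_chord p v u"
proof -
  have "(u - v) * exp p = - ((v - u) * exp p)" "exp u - exp v = - (exp v - exp u)"
    by (simp_all add: algebra_simps)
  then show ?thesis unfolding exp_chord_def by (simp only: minus_divide_divide)
qed

text \<open>Mean value estimate for exp z - z exp p, whose derivative exp z - exp p is small near
  \<open>p\<close>: the factor stays within 1/2 of 1, off the branch cut.\<close>

lemma exp_chord_near:
  obtains \<eta> where "0 < \<eta>"
    "\<And>u v. u \<in> ball p \<eta> \<Longrightarrow> v \<in> ball p \<eta> \<Longrightarrow> u \<noteq> v \<Longrightarrow> exp_chord p u v \<notin> \<real>\<^sub>\<le>\<^sub>0"
proof -
  let ?B = "cmod (exp p) / 2"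
  have "isCont exp p" by simp
  moreover have B: "0 < ?B" by simp
  ultimately obtain \<eta> where \<eta>: "0 < \<eta>" "\<And>z. dist z p < \<eta> \<Longrightarrow> dist (exp z) (exp p) < ?B"
    unfolding continuous_at_eps_delta by blast
  have "exp_chord p u v \<notin> \<real>\<^sub>\<le>\<^sub>0" if u: "u \<in> ball p \<eta>" and v: "v \<in> ball p \<eta>" and ne: "u \<noteq> v" for u v
  proof -
    have "cmod ((exp v - v * exp p) - (exp u - u * exp p)) \<le> ?B * cmod (v - u)"
    proof (rule field_differentiable_bound[of "ball p \<eta>" _ "\<lambda>z. exp z - exp p"])
      fix z assume z: "z \<in> ball p \<eta>"
      show "((\<lambda>z. exp z - z * exp p) has_field_derivative exp z - exp p) (at z within ball p \<eta>)"
        by (auto intro!: derivative_eq_intros)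
      show "cmod (exp z - exp p) \<le> ?B" using \<eta>(2)[of z] z by (simp add: dist_norm norm_minus_commute)
    qed (use u v in auto)
    moreover have "exp_chord p u v - 1 = ((exp v - v * exp p) - (exp u - u * exp p)) / ((v - u) * exp p)"
      using ne by (simp add: exp_chord_def field_simps)
    ultimately have "cmod (exp_chord p u v - 1) \<le> ?B * cmod (v - u) / (cmod (v - u) * cmod (exp p))"
      using ne by (simp only: norm_divide norm_mult divide_right_mono mult_nonneg_nonneg norm_ge_zero)
    also have "\<dots> = 1 / 2" using ne by simp
    finally have "\<bar>Re (exp_chord p u v - 1)\<bar> \<le> 1 / 2" using abs_Re_le_cmod order_trans by blast
    then show ?thesis by (auto simp: complex_nonpos_Reals_iff)
  qed
  then show thesis using that \<eta>(1) by blast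
qed

lemma difference_log_subset:
  assumes "difference_log \<epsilon> a b L" "\<epsilon>' \<le> \<epsilon>"
  shows "difference_log \<epsilon>' a b L"
proof -
  have "{0..\<epsilon>'} \<times> {0..\<epsilon>'} - {(0, 0)} \<subseteq> {0..\<epsilon>} \<times> {0..\<epsilon>} - {(0, 0)}" using assms(2) by auto
  then show ?thesis
    using assms unfolding difference_log_def by (auto intro: continuous_on_subset)
qed

text \<open>The difference exp (b t) - exp (a s) is the chord upstairs times
  \<open>exp_chord\<close> times exp p, and the middle factor has a principal logarithm near
  \<open>p\<close>.\<close>

lemma difference_log_exp:
  assumes L: "difference_log \<epsilon> a b L" and a: "continuous_on {0..\<epsilon>} a" and b: "continuous_on {0..\<epsilon>} b"
    and \<eta>: "\<And>u v. u \<in> ball p \<eta> \<Longrightarrow> v \<in> ball p \<eta> \<Longrightarrow> u \<noteq> v \<Longrightarrow> exp_chord p u v \<notin> \<real>\<^sub>\<le>\<^sub>0"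
    and near: "\<And>s. s \<in> {0..\<epsilon>} \<Longrightarrow> a s \<in> ball p \<eta>" "\<And>s. s \<in> {0..\<epsilon>} \<Longrightarrow> b s \<in> ball p \<eta>"
  shows "difference_log \<epsilon> (\<lambda>s. exp (a s)) (\<lambda>s. exp (b s)) (\<lambda>x. L x + Ln (exp_chord p (a (fst x)) (b (snd x))) + p)"
  unfolding difference_log_def
proof (intro conjI ballI impI)
  let ?D = "{0..\<epsilon>} \<times> {0..\<epsilon>} - {(0::real, 0::real)}"
  have ne: "b (snd x) - a (fst x) \<noteq> 0" if "x \<in> ?D" for x
    using difference_logD(2)[OF L, of "fst x" "snd x"] that by (cases x) auto
  have "continuous_on ?D L" using L by (simp add: difference_log_def)
  moreover have "continuous_on ?D (\<lambda>x. a (fst x))" "continuous_on ?D (\<lambda>x. b (snd x))"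
    by (auto intro!: continuous_on_compose2[OF a] continuous_on_compose2[OF b] continuous_intros)
  then have "continuous_on ?D (\<lambda>x. exp_chord p (a (fst x)) (b (snd x)))"
    unfolding exp_chord_def using ne by (intro continuous_intros) auto
  then have "continuous_on ?D (\<lambda>x. Ln (exp_chord p (a (fst x)) (b (snd x))))"
  proof (rule continuous_on_Ln')
    fix x assume x: "x \<in> ?D"
    then have "a (fst x) \<in> ball p \<eta>" "b (snd x) \<in> ball p \<eta>" by (auto intro: near simp del: mem_ball)
    then show "exp_chord p (a (fst x)) (b (snd x)) \<notin> \<real>\<^sub>\<le>\<^sub>0" using ne[OF x] by (intro \<eta>) auto
  qed
  ultimately show "continuous_on ?D (\<lambda>x. L x + Ln (exp_chord p (a (fst x)) (b (snd x))) + p)"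
    by (intro continuous_on_add continuous_on_const)
  fix s t assume st: "s \<in> {0..\<epsilon>}" "t \<in> {0..\<epsilon>}" "(s, t) \<noteq> (0, 0)"
  have "b t \<noteq> a s" "exp (L (s, t)) = b t - a s" using difference_logD[OF L, of s t] st by auto
  moreover from this have "exp_chord p (a s) (b t) \<noteq> 0" using \<eta>[OF near(1)[OF st(1)] near(2)[OF st(2)]] by auto
  ultimately show "exp (L (s, t) + Ln (exp_chord p (a (fst (s, t))) (b (snd (s, t)))) + p) = exp (b t) - exp (a s)"
    by (simp add: exp_add) (simp add: exp_chord_def)
qed

context tripod begin

text \<open>\<open>a\<close>, \<open>b\<close>, \<open>c\<close> are arcs in the cover,
  \<open>\<alpha>\<close>, \<open>\<beta>\<close>, \<open>\<gamma>\<close> the half-edges below them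
  with their own speeds, hence the scales \<open>ka\<close>, \<open>kb\<close>, \<open>kc\<close>.
  The total turn does not depend on the times, so it may be evaluated in the annulus where the arcs
  first leave a small circle, which is where the cyclic order at a vertex is defined.\<close>

lemma total_turn_orientation:
  assumes cont_a: "continuous_on {0..\<epsilon>} a" and cont_b: "continuous_on {0..\<epsilon>} b" and cont_c: "continuous_on {0..\<epsilon>} c"
    and \<alpha>: "continuous_on {0..1} \<alpha>" "\<epsilon> \<le> ka" "\<And>s. 0 \<le> s \<Longrightarrow> s \<le> \<epsilon> \<Longrightarrow> \<alpha> (s / ka) = exp (a s)"
    and \<beta>: "continuous_on {0..1} \<beta>" "\<epsilon> \<le> kb" "\<And>s. 0 \<le> s \<Longrightarrow> s \<le> \<epsilon> \<Longrightarrow> \<beta> (s / kb) = exp (b s)"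
    and \<gamma>: "continuous_on {0..1} \<gamma>" "\<epsilon> \<le> kc" "\<And>s. 0 \<le> s \<Longrightarrow> s \<le> \<epsilon> \<Longrightarrow> \<gamma> (s / kc) = exp (c s)"
  defines "dir \<equiv> \<lambda>g r. first_exit g r - exp p"
  shows "((\<forall>x\<in>{0<..\<epsilon>}. \<forall>y\<in>{0<..\<epsilon>}. \<forall>z\<in>{0<..\<epsilon>}. total_turn x y z = - \<i> * pi) \<and>
      (\<forall>\<^sub>F r in at_right 0. ccw_triple (dir \<alpha> r) (dir \<beta> r) (dir \<gamma> r))) \<or>
    ((\<forall>x\<in>{0<..\<epsilon>}. \<forall>y\<in>{0<..\<epsilon>}. \<forall>z\<in>{0<..\<epsilon>}. total_turn x y z = \<i> * pi) \<and>
      (\<forall>\<^sub>F r in at_right 0. ccw_triple (dir \<beta> r) (dir \<alpha> r) (dir \<gamma> r)))"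
proof -
  obtain \<eta> where \<eta>: "0 < \<eta>"
    "\<And>u v. u \<in> ball p \<eta> \<Longrightarrow> v \<in> ball p \<eta> \<Longrightarrow> u \<noteq> v \<Longrightarrow> exp_chord p u v \<notin> \<real>\<^sub>\<le>\<^sub>0"
    using exp_chord_near[of p] by blast
  have near: "\<exists>d>0. \<forall>s\<in>{0..\<epsilon>}. s < d \<longrightarrow> f s \<in> ball p \<eta>" if cf: "continuous_on {0..\<epsilon>} f" and f0: "f 0 = p" for f
  proof -
    have "0 \<in> {0..\<epsilon>}" using \<epsilon> by simp
    then obtain d where "d > 0" "\<forall>s\<in>{0..\<epsilon>}. dist s 0 < d \<longrightarrow> dist (f s) (f 0) < \<eta>"
      using cf[unfolded continuous_on_iff, THEN bspec, THEN spec, THEN mp, OF _ \<eta>(1)] by blast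
    then show ?thesis using f0 by (intro exI[of _ d]) (auto simp: dist_commute dist_real_def)
  qed
  obtain da where da: "da > 0" "\<forall>s\<in>{0..\<epsilon>}. s < da \<longrightarrow> a s \<in> ball p \<eta>"
    using near[OF cont_a p(1)] by blast
  obtain db where db: "db > 0" "\<forall>s\<in>{0..\<epsilon>}. s < db \<longrightarrow> b s \<in> ball p \<eta>"
    using near[OF cont_b p(2)] by blast
  obtain dc where dc: "dc > 0" "\<forall>s\<in>{0..\<epsilon>}. s < dc \<longrightarrow> c s \<in> ball p \<eta>"
    using near[OF cont_c p(3)] by blast
  define \<epsilon>' where "\<epsilon>' = min \<epsilon> (min da (min db dc)) / 2"
  have \<epsilon>': "0 < \<epsilon>'" "\<epsilon>' \<le> \<epsilon>" "\<epsilon>' < da" "\<epsilon>' < db" "\<epsilon>' < dc"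
    using da(1) db(1) dc(1) \<epsilon> by (auto simp: \<epsilon>'_def min_def)
  have sub: "{0..\<epsilon>'} \<subseteq> {0..\<epsilon>}" using \<epsilon>' by auto
  have n: "\<And>s. s \<in> {0..\<epsilon>'} \<Longrightarrow> a s \<in> ball p \<eta>" "\<And>s. s \<in> {0..\<epsilon>'} \<Longrightarrow> b s \<in> ball p \<eta>"
    "\<And>s. s \<in> {0..\<epsilon>'} \<Longrightarrow> c s \<in> ball p \<eta>"
    using da(2) db(2) dc(2) \<epsilon>' by (auto simp del: mem_ball)
  have cont': "continuous_on {0..\<epsilon>'} a" "continuous_on {0..\<epsilon>'} b" "continuous_on {0..\<epsilon>'} c"
    using cont_a cont_b cont_c continuous_on_subset sub by blast+
  interpret E: tripod \<epsilon>' "\<lambda>s. exp (a s)" "\<lambda>s. exp (b s)" "\<lambda>s. exp (c s)" "exp p"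
    "\<lambda>x. L1 x + Ln (exp_chord p (a (fst x)) (b (snd x))) + p"
    "\<lambda>x. L2 x + Ln (exp_chord p (b (fst x)) (c (snd x))) + p"
    "\<lambda>x. L3 x + Ln (exp_chord p (c (fst x)) (a (snd x))) + p"
  proof
    show "difference_log \<epsilon>' (\<lambda>s. exp (a s)) (\<lambda>s. exp (b s)) (\<lambda>x. L1 x + Ln (exp_chord p (a (fst x)) (b (snd x))) + p)"
      by (rule difference_log_exp[OF difference_log_subset[OF ab \<epsilon>'(2)] cont'(1,2) \<eta>(2) n(1,2)])
    show "difference_log \<epsilon>' (\<lambda>s. exp (b s)) (\<lambda>s. exp (c s)) (\<lambda>x. L2 x + Ln (exp_chord p (b (fst x)) (c (snd x))) + p)"
      by (rule difference_log_exp[OF difference_log_subset[OF bc \<epsilon>'(2)] cont'(2,3) \<eta>(2) n(2,3)])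
    show "difference_log \<epsilon>' (\<lambda>s. exp (c s)) (\<lambda>s. exp (a s)) (\<lambda>x. L3 x + Ln (exp_chord p (c (fst x)) (a (snd x))) + p)"
      by (rule difference_log_exp[OF difference_log_subset[OF ca \<epsilon>'(2)] cont'(3,1) \<eta>(2) n(3,1)])
  qed (use p \<epsilon>' in auto)
  \<comment> \<open>The corrections depend on one end each and cancel cyclically because
    \<open>exp_chord\<close> is symmetric.\<close>
  have same: "E.total_turn x y z = total_turn x y z" for x y z
    unfolding E.total_turn_def total_turn_def turn_def
    by (simp add: p exp_chord_commute[of p p] algebra_simps)
  have const: "total_turn x y z = total_turn x' y' z'" if "x \<in> {0<..\<epsilon>}" "y \<in> {0<..\<epsilon>}" "z \<in> {0<..\<epsilon>}"
    "x' \<in> {0<..\<epsilon>'}" "y' \<in> {0<..\<epsilon>'}" "z' \<in> {0<..\<epsilon>'}" for x y z x' y' z'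
    using that \<epsilon>' by (intro total_turn_constant) auto
  \<comment> \<open>For every radius below \<open>R\<close> all three arcs reach the circle before
    time \<open>\<epsilon>'\<close>.\<close>
  define R where "R = Min {cmod (exp (f \<epsilon>') - exp p) | f. f \<in> {a, b, c}}"
  have "exp (a \<epsilon>') \<noteq> exp p" "exp (b \<epsilon>') \<noteq> exp p" "exp (c \<epsilon>') \<noteq> exp p"
    using difference_logD(2)[OF E.ab, of 0 \<epsilon>'] difference_logD(2)[OF E.bc, of 0 \<epsilon>']
      difference_logD(2)[OF E.ca, of 0 \<epsilon>'] \<epsilon>' p by auto
  moreover have "{cmod (exp (f \<epsilon>') - exp p) | f. f \<in> {a, b, c}} =
      {cmod (exp (a \<epsilon>') - exp p), cmod (exp (b \<epsilon>') - exp p), cmod (exp (c \<epsilon>') - exp p)}" by auto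
  ultimately have R: "0 < R" "R \<le> cmod (exp (a \<epsilon>') - exp p)" "R \<le> cmod (exp (b \<epsilon>') - exp p)"
     "R \<le> cmod (exp (c \<epsilon>') - exp p)"
    unfolding R_def by auto
  have exit: "\<exists>x>0. x \<le> \<epsilon>' \<and> first_exit g r = exp (f x) \<and> cmod (exp (f x) - exp p) = r \<and>
      (\<forall>t. 0 \<le> t \<and> t \<le> x \<longrightarrow> cmod (exp (f t) - exp p) \<le> r)"
    if g: "continuous_on {0..1} g" "\<epsilon> \<le> k" "\<And>s. 0 \<le> s \<Longrightarrow> s \<le> \<epsilon> \<Longrightarrow> g (s / k) = exp (f s)"
      and f: "f 0 = p" "r \<le> cmod (exp (f \<epsilon>') - exp p)" and r: "0 < r" for g k f r
  proof -
    have k: "0 < k" using g(2) \<epsilon> by simp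
    have g0: "g 0 = exp p" using g(3)[of 0] \<epsilon> f by simp
    obtain x where x: "0 < x" "x \<le> \<epsilon>' / k" "first_exit g r = g x" "cmod (g x - g 0) = r"
      "\<And>t. 0 \<le> t \<Longrightarrow> t \<le> x \<Longrightarrow> cmod (g t - g 0) \<le> r"
    proof (rule first_exit_attained[OF g(1) r, of "\<epsilon>' / k"])
      show "0 < \<epsilon>' / k" "\<epsilon>' / k \<le> 1" using \<epsilon>' k g(2) by auto
      show "r \<le> cmod (g (\<epsilon>' / k) - g 0)" using f g(3)[of \<epsilon>'] g0 \<epsilon>' by simp
    qed blast
    have le: "x * k \<le> \<epsilon>'" using x(2) k by (simp add: field_simps)
    have gk: "g t = exp (f (t * k))" if "0 \<le> t" "t \<le> x" for t
    proof -
      have "t * k \<le> \<epsilon>" using that le k \<epsilon>'(2) by (meson mult_right_mono order_trans less_imp_le)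
      then show ?thesis using g(3)[of "t * k"] that k by simp
    qed
    show ?thesis
    proof (intro exI[of _ "x * k"] conjI allI impI)
      fix t assume t: "0 \<le> t \<and> t \<le> x * k"
      then have "exp (f t) = g (t / k)" using gk[of "t / k"] k by (simp add: field_simps)
      then show "cmod (exp (f t) - exp p) \<le> r" using x(5)[of "t / k"] t k g0 by (simp add: field_simps)
    qed (use x k le gk[of x] g0 in auto)
  qed
  have circle: "(ccw_triple (dir \<alpha> r) (dir \<beta> r) (dir \<gamma> r) \<and> (\<forall>x\<in>{0<..\<epsilon>}. \<forall>y\<in>{0<..\<epsilon>}. \<forall>z\<in>{0<..\<epsilon>}. total_turn x y z = - \<i> * pi)) \<or>
    (ccw_triple (dir \<beta> r) (dir \<alpha> r) (dir \<gamma> r) \<and> (\<forall>x\<in>{0<..\<epsilon>}. \<forall>y\<in>{0<..\<epsilon>}. \<forall>z\<in>{0<..\<epsilon>}. total_turn x y z = \<i> * pi))"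
    if r: "0 < r" "r < R" for r
  proof -
    obtain x where x: "0 < x" "x \<le> \<epsilon>'" "first_exit \<alpha> r = exp (a x)" "cmod (exp (a x) - exp p) = r"
      "\<And>t. 0 \<le> t \<Longrightarrow> t \<le> x \<Longrightarrow> cmod (exp (a t) - exp p) \<le> r"
      using exit[OF \<alpha>(1,2,3), of r] p R r by auto
    obtain y where y: "0 < y" "y \<le> \<epsilon>'" "first_exit \<beta> r = exp (b y)" "cmod (exp (b y) - exp p) = r"
      "\<And>t. 0 \<le> t \<Longrightarrow> t \<le> y \<Longrightarrow> cmod (exp (b t) - exp p) \<le> r"
      using exit[OF \<beta>(1,2,3), of r] p R r by auto
    obtain z where z: "0 < z" "z \<le> \<epsilon>'" "first_exit \<gamma> r = exp (c z)" "cmod (exp (c z) - exp p) = r"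
      "\<And>t. 0 \<le> t \<Longrightarrow> t \<le> z \<Longrightarrow> cmod (exp (c t) - exp p) \<le> r"
      using exit[OF \<gamma>(1,2,3), of r] p R r by auto
    have same_value: "\<forall>x'\<in>{0<..\<epsilon>}. \<forall>y'\<in>{0<..\<epsilon>}. \<forall>z'\<in>{0<..\<epsilon>}. total_turn x' y' z' = w"
      if "total_turn x y z = w" for w
      using that const[of _ _ _ x y z] x y z by simp
    have "ccw_triple (exp (a x) - exp p) (exp (b y) - exp p) (exp (c z) - exp p) \<and> total_turn x y z = - \<i> * pi \<or>
        ccw_triple (exp (b y) - exp p) (exp (a x) - exp p) (exp (c z) - exp p) \<and> total_turn x y z = \<i> * pi"
      using x(5) y(5) z(5)
      by (intro E.total_turn_on_circle[OF x(1,2) y(1,2) z(1,2) r(1) x(4) _ y(4) _ z(4), unfolded same])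
    then show ?thesis
      unfolding dir_def x(3) y(3) z(3) same
    proof (elim disjE conjE)
      assume t: "total_turn x y z = - \<i> * pi"
        and o: "ccw_triple (exp (a x) - exp p) (exp (b y) - exp p) (exp (c z) - exp p)"
      from o same_value[OF t] show "ccw_triple (exp (a x) - exp p) (exp (b y) - exp p) (exp (c z) - exp p) \<and>
          (\<forall>x\<in>{0<..\<epsilon>}. \<forall>y\<in>{0<..\<epsilon>}. \<forall>z\<in>{0<..\<epsilon>}. total_turn x y z = - \<i> * pi) \<or>
        ccw_triple (exp (b y) - exp p) (exp (a x) - exp p) (exp (c z) - exp p) \<and>
          (\<forall>x\<in>{0<..\<epsilon>}. \<forall>y\<in>{0<..\<epsilon>}. \<forall>z\<in>{0<..\<epsilon>}. total_turn x y z = \<i> * pi)" by blast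
    next
      assume t: "total_turn x y z = \<i> * pi"
        and o: "ccw_triple (exp (b y) - exp p) (exp (a x) - exp p) (exp (c z) - exp p)"
      from o same_value[OF t] show "ccw_triple (exp (a x) - exp p) (exp (b y) - exp p) (exp (c z) - exp p) \<and>
          (\<forall>x\<in>{0<..\<epsilon>}. \<forall>y\<in>{0<..\<epsilon>}. \<forall>z\<in>{0<..\<epsilon>}. total_turn x y z = - \<i> * pi) \<or>
        ccw_triple (exp (b y) - exp p) (exp (a x) - exp p) (exp (c z) - exp p) \<and>
          (\<forall>x\<in>{0<..\<epsilon>}. \<forall>y\<in>{0<..\<epsilon>}. \<forall>z\<in>{0<..\<epsilon>}. total_turn x y z = \<i> * pi)" by blast
    qed
  qed
  show ?thesis
  proof (cases "total_turn \<epsilon> \<epsilon> \<epsilon> = - \<i> * pi")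
    case True
    have "\<forall>x\<in>{0<..\<epsilon>}. \<forall>y\<in>{0<..\<epsilon>}. \<forall>z\<in>{0<..\<epsilon>}. total_turn x y z = - \<i> * pi"
      using total_turn_constant[of _ _ _ \<epsilon> \<epsilon> \<epsilon>] True \<epsilon> by simp
    moreover have "\<forall>\<^sub>F r in at_right 0. ccw_triple (dir \<alpha> r) (dir \<beta> r) (dir \<gamma> r)"
      unfolding eventually_at_right_field
    proof (intro exI[of _ R] conjI allI impI)
      fix r assume "0 < r" "r < R"
      from circle[OF this] show "ccw_triple (dir \<alpha> r) (dir \<beta> r) (dir \<gamma> r)"
        using True \<epsilon> by auto
    qed (use R in auto)
    ultimately show ?thesis by blast
  next
    case False
    have "\<forall>x\<in>{0<..\<epsilon>}. \<forall>y\<in>{0<..\<epsilon>}. \<forall>z\<in>{0<..\<epsilon>}. total_turn x y z = \<i> * pi"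
      using circle[of "R / 2"] R(1) False \<epsilon> by auto
    moreover have "\<forall>\<^sub>F r in at_right 0. ccw_triple (dir \<beta> r) (dir \<alpha> r) (dir \<gamma> r)"
      unfolding eventually_at_right_field
    proof (intro exI[of _ R] conjI allI impI)
      fix r assume "0 < r" "r < R"
      from circle[OF this] show "ccw_triple (dir \<beta> r) (dir \<alpha> r) (dir \<gamma> r)"
        using False \<epsilon> by auto
    qed (use R in auto)
    ultimately show ?thesis by blast
  qed
qed

end

section \<open>The index of a pair of strands\<close>

text \<open>Stated in units of i pi, the common scale for coinciding strands (even multiples) and
  separate ones (odd multiples).\<close>

lemma exp_eq_1_imp_multiple:
  assumes "exp z = 1"
  shows "\<exists>k::int. z = \<i> * pi * of_int k"
proof -
  obtain n :: int where "Re z = 0" "Im z = of_int (2 * n) * pi" using assms by (auto simp: exp_eq_1)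
  then have "z = \<i> * pi * of_int (2 * n)" by (simp add: complex_eq_iff)
  then show ?thesis by blast
qed

lemma exp_eq_minus_1_imp_multiple:
  assumes "exp z = -1"
  shows "\<exists>k::int. z = \<i> * pi * of_int k"
proof -
  have "exp (z - \<i> * pi) = 1" using assms by (simp add: exp_diff)
  then obtain k :: int where "z - \<i> * pi = \<i> * pi * of_int k" using exp_eq_1_imp_multiple by blast
  then have "z = \<i> * pi * of_int (k + 1)" by (simp add: algebra_simps)
  then show ?thesis by blast
qed

text \<open>Two paths in the universal cover of the annulus (a plane, via \<open>exp\<close>), parametrised so that they can
  only meet at equal times. The index at \<open>\<tau>\<close> is the limit of \<open>(B - A) / (\<i> \<pi>)\<close> at \<open>(\<tau>, \<tau>)\<close>: for \<open>f \<tau> \<noteq> g \<tau>\<close> it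
  is odd and tells on which side of \<open>f\<close> the path \<open>g\<close> runs, and it does not change until the paths
  meet or separate.\<close>

locale strand_pair =
  fixes M :: real and f g :: "real \<Rightarrow> complex" and A B :: "real \<times> real \<Rightarrow> complex"
  assumes M: "0 < M" and cont: "continuous_on {0..M} f" "continuous_on {0..M} g"
    and off_diagonal: "\<And>s t. s \<in> {0..M} \<Longrightarrow> t \<in> {0..M} \<Longrightarrow> s \<noteq> t \<Longrightarrow> g t \<noteq> f s"
    and contA: "continuous_on {(s, t). 0 \<le> s \<and> s < t \<and> t \<le> M} A"
    and contB: "continuous_on {(s, t). 0 \<le> s \<and> s < t \<and> t \<le> M} B"
    and expA: "\<And>s t. 0 \<le> s \<Longrightarrow> s < t \<Longrightarrow> t \<le> M \<Longrightarrow> exp (A (s, t)) = g t - f s"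
    and expB: "\<And>s t. 0 \<le> s \<Longrightarrow> s < t \<Longrightarrow> t \<le> M \<Longrightarrow> exp (B (s, t)) = f t - g s"
begin

definition T where "T = {(s, t). 0 \<le> s \<and> s < t \<and> t \<le> M}"

definition has_index :: "real \<Rightarrow> int \<Rightarrow> bool" where
  "has_index \<tau> k \<longleftrightarrow> ((\<lambda>x. B x - A x) \<longlongrightarrow> \<i> * pi * of_int k) (at (\<tau>, \<tau>) within T)"

text \<open>The excluded times are those at which the strands touch without coinciding nearby: the
  moments of merging or separating.\<close>

definition regular :: "real \<Rightarrow> bool" where
  "regular \<tau> \<longleftrightarrow> f \<tau> \<noteq> g \<tau> \<or> (\<exists>\<epsilon>>0. \<forall>s\<in>{0..M}. \<bar>s - \<tau>\<bar> < \<epsilon> \<longrightarrow> f s = g s)"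

text \<open>Ensures that the limit in \<open>has_index\<close> is not vacuous, also at the two ends
  of the time interval.\<close>

lemma diagonal_islimpt:
  assumes "\<tau> \<in> {0..M}"
  shows "(\<tau>, \<tau>) islimpt T"
  unfolding islimpt_approachable
proof (intro allI impI)
  fix e :: real assume e: "0 < e"
  show "\<exists>x'\<in>T. x' \<noteq> (\<tau>, \<tau>) \<and> dist x' (\<tau>, \<tau>) < e"
  proof (cases "\<tau> < M")
    case True
    then show ?thesis using e assms
      by (intro bexI[of _ "(\<tau>, \<tau> + min (e / 2) (M - \<tau>))"]) (auto simp: T_def dist_Pair_Pair dist_real_def)
  next
    case False
    then show ?thesis using e assms M
      by (intro bexI[of _ "(\<tau> - min (e / 2) M, \<tau>)"]) (auto simp: T_def dist_Pair_Pair dist_real_def)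
  qed
qed

lemma index_unique:
  assumes "has_index \<tau> k" "has_index \<tau> l" "\<tau> \<in> {0..M}"
  shows "k = l"
proof -
  have "at (\<tau>, \<tau>) within T \<noteq> bot"
    using diagonal_islimpt[OF assms(3)] trivial_limit_within by blast
  from tendsto_unique[OF this] assms(1,2) have "\<i> * pi * of_int k = \<i> * pi * of_int l"
    unfolding has_index_def by blast
  then show ?thesis by simp
qed

text \<open>Part of the triangle near a diagonal point. It is convex, so
  \<open>log_difference_constant\<close> applies on it.\<close>

definition box where "box \<tau> d = T \<inter> ({\<tau> - d<..<\<tau> + d} \<times> {\<tau> - d<..<\<tau> + d})"

lemma convex_T: "convex T"
proof -
  have "T = ({0..} \<times> {..M}) \<inter> {x. inner x (1, -1) < 0}"
    by (auto simp: T_def inner_prod_def)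
  moreover have "{x. inner x (1, -1) < 0} = {x :: real \<times> real. inner (1, -1) x < 0}"
    by (simp only: inner_commute)
  ultimately show ?thesis
    by (metis convex_Int convex_Times convex_halfspace_lt convex_real_interval(1,2))
qed

lemma connected_box: "connected (box \<tau> d)"
  unfolding box_def by (intro convex_connected convex_Int convex_T convex_Times) auto

lemma box_nonempty:
  assumes "\<tau> \<in> {0..M}" "0 < d"
  obtains x where "x \<in> box \<tau> d"
proof -
  obtain x where x: "x \<in> T" "dist x (\<tau>, \<tau>) < d"
    using diagonal_islimpt[OF assms(1)] assms(2) unfolding islimpt_approachable by blast
  have "dist (fst x) \<tau> < d" "dist (snd x) \<tau> < d"
    using x(2) dist_fst_le[of x "(\<tau>, \<tau>)"] dist_snd_le[of x "(\<tau>, \<tau>)"] by auto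
  then have "x \<in> box \<tau> d" using x(1) by (cases x) (auto simp: box_def dist_real_def abs_less_iff)
  then show thesis by (rule that)
qed

lemma eventually_box:
  assumes "\<bar>\<tau>' - \<tau>\<bar> < d"
  shows "\<forall>\<^sub>F x in at (\<tau>', \<tau>') within T. x \<in> box \<tau> d"
proof -
  have "open ({\<tau> - d<..<\<tau> + d} \<times> {\<tau> - d<..<\<tau> + d})" by (intro open_Times) auto
  then show ?thesis using assms
    unfolding eventually_at_topological by (intro exI[of _ "{\<tau> - d<..<\<tau> + d} \<times> {\<tau> - d<..<\<tau> + d}"]) (auto simp: box_def)
qed

text \<open>Near \<open>\<tau>\<close> all chords g t - f s lie in a half plane around their value
  F0 at \<open>\<tau>\<close>, so \<open>A\<close> and \<open>B\<close> are principal logarithms up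
  to constants. On the diagonal these logarithms agree, and the constants have exponentials F0 and
  -F0.\<close>

lemma regular_index_apart:
  assumes \<tau>: "\<tau> \<in> {0..M}" and ne: "f \<tau> \<noteq> g \<tau>"
  shows "\<exists>k::int. \<exists>d>0. \<forall>\<tau>'\<in>{0..M}. \<bar>\<tau>' - \<tau>\<bar> < d \<longrightarrow> has_index \<tau>' k"
proof -
  define F0 where "F0 = g \<tau> - f \<tau>"
  have F0: "F0 \<noteq> 0" using ne by (simp add: F0_def)
  have "0 < cmod F0 / 2" using F0 by simp
  then obtain d1 d2 where d1: "0 < d1" "\<And>s. s \<in> {0..M} \<Longrightarrow> dist s \<tau> < d1 \<Longrightarrow> dist (f s) (f \<tau>) < cmod F0 / 2"
    and d2: "0 < d2" "\<And>s. s \<in> {0..M} \<Longrightarrow> dist s \<tau> < d2 \<Longrightarrow> dist (g s) (g \<tau>) < cmod F0 / 2"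
    using cont \<tau> unfolding continuous_on_iff by metis
  define d where "d = min d1 d2"
  have d: "0 < d" using d1 d2 by (simp add: d_def)
  have re: "0 < Re ((g t - f s) / F0)" if "s \<in> {0..M}" "t \<in> {0..M}" "\<bar>s - \<tau>\<bar> < d" "\<bar>t - \<tau>\<bar> < d" for s t
  proof -
    have "cmod ((g t - g \<tau>) - (f s - f \<tau>)) \<le> cmod (g t - g \<tau>) + cmod (f s - f \<tau>)" by (rule norm_triangle_ineq4)
    also have "\<dots> < cmod F0 / 2 + cmod F0 / 2"
      using d1(2)[of s] d2(2)[of t] that by (intro add_strict_mono) (auto simp: d_def dist_norm)
    finally have "cmod ((g t - f s) - F0) < cmod F0" by (simp add: F0_def algebra_simps)
    then have "cmod ((g t - f s) / F0 - 1) < 1" using F0 by (simp add: norm_divide diff_divide_eq_iff divide_simps)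
    then have "\<bar>Re ((g t - f s) / F0 - 1)\<bar> < 1" using abs_Re_le_cmod le_less_trans by blast
    then show ?thesis by auto
  qed
  have in_box: "0 \<le> fst x" "fst x < snd x" "snd x \<le> M" "fst x \<in> {0..M}" "snd x \<in> {0..M}" "\<bar>fst x - \<tau>\<bar> < d" "\<bar>snd x - \<tau>\<bar> < d"
    if "x \<in> box \<tau> d" for x
    using that by (auto simp: box_def T_def)
  define LA where "LA x = Ln ((g (snd x) - f (fst x)) / F0)" for x
  \<comment> \<open>\<open>B\<close> belongs to f t - g s; the sign is reversed so that the quotient
    by \<open>F0\<close> stays in the right half plane.\<close>
  define LB where "LB x = Ln ((g (fst x) - f (snd x)) / F0)" for x
  have contf: "continuous_on ({0..M} \<times> {0..M}) (\<lambda>x. f (fst x))" "continuous_on ({0..M} \<times> {0..M}) (\<lambda>x. g (fst x))"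
     "continuous_on ({0..M} \<times> {0..M}) (\<lambda>x. f (snd x))" "continuous_on ({0..M} \<times> {0..M}) (\<lambda>x. g (snd x))"
    by (auto intro!: continuous_on_compose2[OF cont(1)] continuous_on_compose2[OF cont(2)] continuous_intros)
  let ?Q = "({0..M} \<inter> {\<tau> - d<..<\<tau> + d}) \<times> ({0..M} \<inter> {\<tau> - d<..<\<tau> + d})"
  have QM: "?Q \<subseteq> {0..M} \<times> {0..M}" by auto
  have "(g (snd x) - f (fst x)) / F0 \<notin> \<real>\<^sub>\<le>\<^sub>0" "(g (fst x) - f (snd x)) / F0 \<notin> \<real>\<^sub>\<le>\<^sub>0" if "x \<in> ?Q" for x
    using re[of "fst x" "snd x"] re[of "snd x" "fst x"] that
    by (auto simp: complex_nonpos_Reals_iff abs_less_iff simp del: Re_divide)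
  then have contL: "continuous_on ?Q LA" "continuous_on ?Q LB"
    unfolding LA_def LB_def using F0
    by (auto intro!: continuous_on_Ln' continuous_on_divide continuous_on_diff continuous_on_const
      contf[THEN continuous_on_subset, OF QM])
  have boxQ: "box \<tau> d \<subseteq> ?Q" by (auto simp: box_def T_def)
  have boxT: "box \<tau> d \<subseteq> T" by (auto simp: box_def)
  obtain x0 where x0: "x0 \<in> box \<tau> d" using box_nonempty[OF \<tau> d] by blast
  have nz: "(g t - f s) / F0 \<noteq> 0" if "s \<in> {0..M}" "t \<in> {0..M}" "\<bar>s - \<tau>\<bar> < d" "\<bar>t - \<tau>\<bar> < d" for s t
    using re[OF that] by auto
  have eA: "A x - (LA x + Ln F0) = A x0 - (LA x0 + Ln F0)" if x: "x \<in> box \<tau> d" for x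
  proof (rule log_difference_constant[OF connected_box _ _ _ x x0])
    show "continuous_on (box \<tau> d) A" using contA boxT unfolding T_def by (rule continuous_on_subset)
    show "continuous_on (box \<tau> d) (\<lambda>x. LA x + Ln F0)"
      by (intro continuous_intros continuous_on_subset[OF contL(1) boxQ])
    fix y assume y: "y \<in> box \<tau> d"
    show "exp (A y) = exp (LA y + Ln F0)"
      using in_box[OF y] expA[of "fst y" "snd y"] F0 nz[of "fst y" "snd y"] by (simp add: exp_add LA_def)
  qed
  have eB: "B x - (LB x + Ln (- F0)) = B x0 - (LB x0 + Ln (- F0))" if x: "x \<in> box \<tau> d" for x
  proof (rule log_difference_constant[OF connected_box _ _ _ x x0])
    show "continuous_on (box \<tau> d) B" using contB boxT unfolding T_def by (rule continuous_on_subset)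
    show "continuous_on (box \<tau> d) (\<lambda>x. LB x + Ln (- F0))"
      by (intro continuous_intros continuous_on_subset[OF contL(2) boxQ])
    fix y assume y: "y \<in> box \<tau> d"
    show "exp (B y) = exp (LB y + Ln (- F0))"
      using in_box[OF y] expB[of "fst y" "snd y"] F0 nz[of "snd y" "fst y"] by (simp add: exp_add LB_def)
  qed
  define c where "c = (B x0 - LB x0) - (A x0 - LA x0)"
  have ratio: "u / (v / F0) = - F0 \<and> v / (v / F0) = F0" if "u = - v" "v / F0 \<noteq> 0" for u v
    using that F0 by simp
  have "exp (B x0 - LB x0) = - F0"
  proof -
    have "exp (B x0 - LB x0) = (f (snd x0) - g (fst x0)) / ((g (fst x0) - f (snd x0)) / F0)"
      using in_box[OF x0] expB[of "fst x0" "snd x0"] nz[of "snd x0" "fst x0"]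
      by (simp add: exp_diff LB_def)
    also have "\<dots> = - F0"
      by (rule ratio[THEN conjunct1]) (use nz[of "snd x0" "fst x0"] in_box[OF x0] in auto)
    finally show ?thesis .
  qed
  moreover have "exp (A x0 - LA x0) = F0"
  proof -
    have "exp (A x0 - LA x0) = (g (snd x0) - f (fst x0)) / ((g (snd x0) - f (fst x0)) / F0)"
      using in_box[OF x0] expA[of "fst x0" "snd x0"] nz[of "fst x0" "snd x0"]
      by (simp add: exp_diff LA_def)
    also have "\<dots> = F0"
      by (rule ratio[of "- (g (snd x0) - f (fst x0))", THEN conjunct2]) (use nz[of "fst x0" "snd x0"] in_box[OF x0] in auto)
    finally show ?thesis .
  qed
  ultimately have "exp c = -1" using F0 by (simp add: c_def exp_diff[of "B x0 - LB x0"])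
  then obtain k :: int where k: "c = \<i> * pi * of_int k" using exp_eq_minus_1_imp_multiple by blast
  have "has_index \<tau>' k" if \<tau>': "\<tau>' \<in> {0..M}" "\<bar>\<tau>' - \<tau>\<bar> < d" for \<tau>'
  proof -
    have Q: "(\<tau>', \<tau>') \<in> ?Q" using \<tau>' by auto
    have "((\<lambda>x. LB x - LA x) \<longlongrightarrow> LB (\<tau>', \<tau>') - LA (\<tau>', \<tau>')) (at (\<tau>', \<tau>') within ?Q)"
      using contL Q unfolding continuous_on_def by (intro tendsto_diff) auto
    then have "((\<lambda>x. LB x - LA x) \<longlongrightarrow> 0) (at (\<tau>', \<tau>') within box \<tau> d)"
      using tendsto_within_subset[OF _ boxQ] by (simp add: LA_def LB_def)
    then have "((\<lambda>x. c + (LB x - LA x)) \<longlongrightarrow> c + 0) (at (\<tau>', \<tau>') within box \<tau> d)"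
      by (intro tendsto_intros)
    then have "((\<lambda>x. B x - A x) \<longlongrightarrow> c + 0) (at (\<tau>', \<tau>') within box \<tau> d)"
    proof (rule Lim_transform_eventually)
      show "\<forall>\<^sub>F x in at (\<tau>', \<tau>') within box \<tau> d. c + (LB x - LA x) = B x - A x"
        unfolding eventually_at_filter
      proof (rule always_eventually, intro allI impI)
        fix x assume "x \<in> box \<tau> d"
        from eA[OF this] eB[OF this] have "A x = LA x + (A x0 - LA x0)" "B x = LB x + (B x0 - LB x0)"
          by (simp_all add: algebra_simps)
        then show "c + (LB x - LA x) = B x - A x" by (simp add: c_def)
      qed
    qed
    moreover have "at (\<tau>', \<tau>') within box \<tau> d = at (\<tau>', \<tau>') within T"
      using \<tau>' by (intro at_within_nhd[of _ "{\<tau> - d<..<\<tau> + d} \<times> {\<tau> - d<..<\<tau> + d}"] open_Times)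
        (auto simp: box_def)
    ultimately show ?thesis unfolding has_index_def k by simp
  qed
  then show ?thesis using d by blast
qed

text \<open>Where f = g at both times, g t - f s and f t - g s are the same number, so
  \<open>A\<close> and \<open>B\<close> are logarithms of one function.\<close>

lemma difference_constant_on_common:
  assumes "S \<subseteq> T" "convex S" "\<And>x. x \<in> S \<Longrightarrow> f (fst x) = g (fst x) \<and> f (snd x) = g (snd x)"
    "x \<in> S" "y \<in> S"
  shows "B x - A x = B y - A y" "exp (B x - A x) = 1"
proof -
  have in_T: "exp (A z) = g (snd z) - f (fst z)" "exp (B z) = f (snd z) - g (fst z)" if "z \<in> S" for z
    using that assms(1) expA[of "fst z" "snd z"] expB[of "fst z" "snd z"] by (auto simp: T_def)
  show "B x - A x = B y - A y"
    using assms in_T contA contB convex_connected unfolding T_def[symmetric]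
    by (intro log_difference_constant[of S]) (auto intro: continuous_on_subset)
  have "exp (A x) \<noteq> 0" by simp
  then show "exp (B x - A x) = 1" using in_T[OF assms(4)] assms(3)[OF assms(4)] by (simp add: exp_diff)
qed

lemma regular_index_common:
  assumes \<tau>: "\<tau> \<in> {0..M}" and d: "0 < d" "\<And>s. s \<in> {0..M} \<Longrightarrow> \<bar>s - \<tau>\<bar> < d \<Longrightarrow> f s = g s"
  shows "\<exists>k::int. \<forall>\<tau>'\<in>{0..M}. \<bar>\<tau>' - \<tau>\<bar> < d \<longrightarrow> has_index \<tau>' k"
proof -
  obtain x0 where x0: "x0 \<in> box \<tau> d" using box_nonempty[OF \<tau> d(1)] by blast
  have sub: "box \<tau> d \<subseteq> T" by (auto simp: box_def)
  have cv: "convex (box \<tau> d)" unfolding box_def by (intro convex_Int convex_T convex_Times) auto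
  have eq: "f (fst x) = g (fst x) \<and> f (snd x) = g (snd x)" if "x \<in> box \<tau> d" for x
    using that by (auto simp: box_def T_def intro!: d(2))
  note const = difference_constant_on_common[OF sub cv eq _ x0]
  obtain k :: int where k: "B x0 - A x0 = \<i> * pi * of_int k"
    using exp_eq_1_imp_multiple difference_constant_on_common(2)[OF sub cv eq x0 x0] by blast
  have "has_index \<tau>' k" if "\<tau>' \<in> {0..M}" "\<bar>\<tau>' - \<tau>\<bar> < d" for \<tau>'
    unfolding has_index_def
  proof (rule tendsto_eventually)
    show "\<forall>\<^sub>F x in at (\<tau>', \<tau>') within T. B x - A x = \<i> * pi * of_int k"
      using eventually_box[OF that(2)] by eventually_elim (use const k in auto)
  qed
  then show ?thesis by blast
qed

lemma regular_index:
  assumes "\<tau> \<in> {0..M}" "regular \<tau>"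
  shows "\<exists>k::int. \<exists>d>0. \<forall>\<tau>'\<in>{0..M}. \<bar>\<tau>' - \<tau>\<bar> < d \<longrightarrow> has_index \<tau>' k"
  using assms regular_index_apart[OF assms(1)] regular_index_common[OF assms(1)]
  unfolding regular_def by meson

text \<open>By \<open>regular_index\<close> the index is locally constant at regular times, and by
  \<open>index_unique\<close> it is a function of the time.\<close>

lemma index_constant:
  assumes "connected I" "I \<subseteq> {0..M}" "\<And>\<tau>. \<tau> \<in> I \<Longrightarrow> regular \<tau>" "has_index \<tau> k" "\<tau> \<in> I" "\<tau>' \<in> I"
  shows "has_index \<tau>' k"
proof -
  define idx where "idx \<tau> = (THE k. has_index \<tau> k)" for \<tau>
  have idx: "idx \<tau> = k" if "has_index \<tau> k" "\<tau> \<in> I" for \<tau> k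
    unfolding idx_def using that index_unique assms(2) by (intro the_equality) auto
  have "idx \<tau> = idx \<tau>'"
  proof (rule connected_local_const[OF assms(1,5,6)], rule ballI)
    fix a assume a: "a \<in> I"
    then obtain k d where kd: "0 < d" "\<And>\<tau>'. \<tau>' \<in> {0..M} \<Longrightarrow> \<bar>\<tau>' - a\<bar> < d \<Longrightarrow> has_index \<tau>' k"
      using regular_index[of a] assms(2,3) by blast
    then have "idx a = idx b" if "b \<in> I" "dist b a < d" for b
      using that a assms(2) idx[OF kd(2)[of a] a] idx[OF kd(2)[of b] that(1)] kd(1)
      by (simp add: dist_real_def subset_iff)
    then show "\<forall>\<^sub>F b in at a within I. idx a = idx b"
      unfolding eventually_at using kd(1) by blast
  qed
  moreover obtain k' where "has_index \<tau>' k'"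
    using regular_index[of \<tau>'] assms(2,3,6) by fastforce
  ultimately show ?thesis using idx assms(4-6) by metis
qed

text \<open>Carries the index from the inner time \<open>\<tau>\<close> to pairs with s = a, the
  exact moment of merging, which \<open>merging_index_jump\<close> has to evaluate.\<close>

lemma has_index_common:
  assumes "0 \<le> a" "a < b" "b \<le> M" "\<And>s. s \<in> {a..b} \<Longrightarrow> f s = g s" "a < \<tau>" "\<tau> < b" "has_index \<tau> k"
    "a \<le> s" "s < t" "t \<le> b"
  shows "B (s, t) - A (s, t) = \<i> * pi * of_int k"
proof -
  let ?S = "T \<inter> ({a..b} \<times> {a..b})"
  have "convex ?S" by (intro convex_Int convex_T convex_Times) auto
  then have const: "B x - A x = B (s, t) - A (s, t)" if "x \<in> ?S" for x
    using assms that by (intro difference_constant_on_common(1)[of ?S]) (auto simp: T_def)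
  have "\<forall>\<^sub>F x in at (\<tau>, \<tau>) within T. B x - A x = B (s, t) - A (s, t)"
    unfolding eventually_at_topological
  proof (intro exI[of _ "{a<..<b} \<times> {a<..<b}"] conjI ballI impI)
    show "open ({a<..<b} \<times> {a<..<b})" by (intro open_Times) auto
    show "(\<tau>, \<tau>) \<in> {a<..<b} \<times> {a<..<b}" using assms by auto
    show "B x - A x = B (s, t) - A (s, t)" if "x \<in> T" "x \<in> {a<..<b} \<times> {a<..<b}" for x
      using that by (intro const) (auto simp: less_imp_le)
  qed
  then have "((\<lambda>x. B x - A x) \<longlongrightarrow> B (s, t) - A (s, t)) (at (\<tau>, \<tau>) within T)"
    by (rule tendsto_eventually)
  moreover have "at (\<tau>, \<tau>) within T \<noteq> bot"
    using diagonal_islimpt[of \<tau>] assms trivial_limit_within by fastforce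
  ultimately show ?thesis
    using assms(7) tendsto_unique unfolding has_index_def by blast
qed

text \<open>The tripod consists of the two incoming branches and their common continuation. Between
  the branches its logarithm is \<open>C + c1\<close>, while \<open>B\<close> and a shifted
  \<open>A\<close> serve for the chords that involve the continuation. Up to constants
  \<open>C\<close> is \<open>A\<close> on one side of the diagonal and \<open>B\<close> on the
  other; these constants differ by the old index, and the pair \<open>(\<tau>, \<tau> + z)\<close>
  contributes the new one.\<close>

lemma merging_index_jump:
  assumes \<epsilon>: "0 < \<epsilon>" "0 \<le> \<tau> - \<epsilon>" "\<tau> + \<epsilon> \<le> M"
    and common: "\<And>s. s \<in> {\<tau>..\<tau> + \<epsilon>} \<Longrightarrow> f s = g s"
    and apart: "\<And>s. s \<in> {\<tau> - \<epsilon>..<\<tau>} \<Longrightarrow> f s \<noteq> g s"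
    and k1: "\<tau> - \<epsilon> < \<tau>1" "\<tau>1 < \<tau>" "has_index \<tau>1 k1"
    and k2: "\<tau> < \<tau>2" "\<tau>2 < \<tau> + \<epsilon>" "has_index \<tau>2 k2"
  shows "\<exists>L1 L2 L3. tripod \<epsilon> (\<lambda>x. f (\<tau> - x)) (\<lambda>x. g (\<tau> - x)) (\<lambda>x. f (\<tau> + x)) (f \<tau>) L1 L2 L3 \<and>
    (\<forall>x\<in>{0<..\<epsilon>}. \<forall>y\<in>{0<..\<epsilon>}. \<forall>z\<in>{0<..\<epsilon>}. tripod.total_turn L1 L2 L3 x y z = \<i> * pi * of_int (k2 - k1))"
proof -
  have bounds: "0 \<le> \<tau>" "\<tau> + \<epsilon> \<le> M" using \<epsilon> by auto
  let ?D = "{0..\<epsilon>} \<times> {0..\<epsilon>} - {(0::real, 0::real)}"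
  let ?F = "\<lambda>x. g (\<tau> - snd x) - f (\<tau> - fst x)"
  have ft: "f \<tau> = g \<tau>" using common \<epsilon> by auto
  have D: "?D = ({0..\<epsilon>} \<times> {0..\<epsilon>}) \<inter> {x. inner (1, 1) x > 0}"
    by (auto simp: inner_prod_def)
  have cvD: "convex ?D"
    unfolding D by (intro convex_Int convex_Times convex_halfspace_gt) auto
  have nz: "?F x \<noteq> 0" if "x \<in> ?D" for x
  proof (cases "fst x = snd x")
    case True
    then show ?thesis using apart[of "\<tau> - fst x"] that by (cases x) auto
  next
    case False
    then show ?thesis using off_diagonal[of "\<tau> - fst x" "\<tau> - snd x"] that \<epsilon> by (cases x) auto
  qed
  have "continuous_on ?D ?F"
    using \<epsilon> by (auto intro!: continuous_on_compose2[OF cont(1)] continuous_on_compose2[OF cont(2)] continuous_intros)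
  \<comment> \<open>Before \<open>\<tau>\<close> the branches do not meet even at equal times, so
    one logarithm covers both sides of the diagonal.\<close>
  then obtain C where C: "continuous_on ?D C" "\<And>x. x \<in> ?D \<Longrightarrow> ?F x = exp (C x)"
  proof (rule continuous_logarithm_on_contractible[OF _ convex_imp_contractible[OF cvD] nz])
    fix C assume "continuous_on ?D C" "\<And>x. x \<in> ?D \<Longrightarrow> ?F x = exp (C x)"
    then show thesis by (rule that)
  qed
  let ?U = "?D \<inter> {x. inner (1, -1) x > 0}" and ?V = "?D \<inter> {x. inner (1, -1) x < 0}"
  have U: "connected ?U" "connected ?V"
    by (auto intro!: convex_connected convex_Int cvD convex_halfspace_gt convex_halfspace_lt simp del: Diff_iff)
  have Uiff: "x \<in> ?U \<longleftrightarrow> x \<in> ?D \<and> snd x < fst x" "x \<in> ?V \<longleftrightarrow> x \<in> ?D \<and> fst x < snd x" for x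
    by (auto simp: inner_prod_def)
  have u0: "(\<epsilon>, 0) \<in> ?U" "(0, \<epsilon>) \<in> ?V" using \<epsilon> by (auto simp: inner_prod_def)
  have contA': "continuous_on ?U (\<lambda>x. A (\<tau> - fst x, \<tau> - snd x))"
    using \<epsilon> by (intro continuous_on_compose2[OF contA] continuous_intros) (auto simp: inner_prod_def)
  have contB': "continuous_on ?V (\<lambda>x. B (\<tau> - snd x, \<tau> - fst x))"
    using \<epsilon> by (intro continuous_on_compose2[OF contB] continuous_intros) (auto simp: inner_prod_def)
  define c1 where "c1 = A (\<tau> - \<epsilon>, \<tau>) - C (\<epsilon>, 0)"
  define c2 where "c2 = B (\<tau> - \<epsilon>, \<tau>) - C (0, \<epsilon>)"
  have A_eq: "A (\<tau> - x, \<tau> - y) = C (x, y) + c1" if "0 \<le> y" "y < x" "x \<le> \<epsilon>" for x y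
  proof -
    have "A (\<tau> - fst (x, y), \<tau> - snd (x, y)) - C (x, y) = A (\<tau> - fst (\<epsilon>, 0 :: real), \<tau> - snd (\<epsilon>, 0 :: real)) - C (\<epsilon>, 0)"
    proof (rule log_difference_constant[where g = C and f = "\<lambda>x. A (\<tau> - fst x, \<tau> - snd x)", OF U(1) contA' _ _ _ u0(1)])
      show "continuous_on ?U C" by (rule continuous_on_subset[OF C(1)]) auto
      show "(x, y) \<in> ?U" unfolding Uiff using that by auto
      fix z assume z: "z \<in> ?U"
      then show "exp (A (\<tau> - fst z, \<tau> - snd z)) = exp (C z)"
        using C(2)[of z] expA[of "\<tau> - fst z" "\<tau> - snd z"] \<epsilon> unfolding Uiff by (cases z) auto
    qed
    then show ?thesis by (simp add: c1_def algebra_simps)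
  qed
  have B_eq: "B (\<tau> - y, \<tau> - x) = C (x, y) + c2" if "0 \<le> x" "x < y" "y \<le> \<epsilon>" for x y
  proof -
    have "B (\<tau> - snd (x, y), \<tau> - fst (x, y)) - (C (x, y) + \<i> * pi) = B (\<tau> - snd (0 :: real, \<epsilon>), \<tau> - fst (0 :: real, \<epsilon>)) - (C (0, \<epsilon>) + \<i> * pi)"
    proof (rule log_difference_constant[where g = "\<lambda>x. C x + \<i> * pi" and f = "\<lambda>x. B (\<tau> - snd x, \<tau> - fst x)",
          OF U(2) contB' _ _ _ u0(2)])
      show "continuous_on ?V (\<lambda>x. C x + \<i> * pi)"
        by (intro continuous_intros continuous_on_subset[OF C(1)]) auto
      show "(x, y) \<in> ?V" unfolding Uiff using that by auto
      fix z assume z: "z \<in> ?V"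
      then have "exp (C z) = g (\<tau> - snd z) - f (\<tau> - fst z)" using C(2)[of z] by auto
      moreover have "exp (B (\<tau> - snd z, \<tau> - fst z)) = f (\<tau> - fst z) - g (\<tau> - snd z)"
        using z expB[of "\<tau> - snd z" "\<tau> - fst z"] \<epsilon> unfolding Uiff by (cases z) auto
      ultimately show "exp (B (\<tau> - snd z, \<tau> - fst z)) = exp (C z + \<i> * pi)"
        by (simp add: exp_add)
    qed
    then show ?thesis by (simp add: c2_def algebra_simps)
  qed
  \<comment> \<open>As the diagonal point of \<open>\<tau>1\<close> is approached, \<open>C\<close>
    cancels in B - A and leaves c2 - c1.\<close>
  have index1: "c2 - c1 = \<i> * pi * of_int k1"
  proof -
    let ?Q = "{\<tau> - \<epsilon><..<\<tau>} \<times> {\<tau> - \<epsilon><..<\<tau>}"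
    let ?x = "(\<tau> - \<tau>1, \<tau> - \<tau>1)"
    have "?x \<in> {0<..<\<epsilon>} \<times> {0<..<\<epsilon>}" using k1 by auto
    moreover have "open ({0<..<\<epsilon>} \<times> {0<..<\<epsilon>})" by (intro open_Times) auto
    moreover have "continuous_on ({0<..<\<epsilon>} \<times> {0<..<\<epsilon>}) C"
      by (rule continuous_on_subset[OF C(1)]) auto
    ultimately have "isCont C ?x" using continuous_on_eq_continuous_at by blast
    then have C_lim: "((\<lambda>z. C (h z)) \<longlongrightarrow> C ?x) (at (\<tau>1, \<tau>1) within T)"
      if "(h \<longlongrightarrow> ?x) (at (\<tau>1, \<tau>1) within T)" for h
      using that isCont_tendsto_compose by blast
    have "((\<lambda>z. (C (\<tau> - snd z, \<tau> - fst z) + c2) - (C (\<tau> - fst z, \<tau> - snd z) + c1)) \<longlongrightarrow>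
        (C ?x + c2) - (C ?x + c1)) (at (\<tau>1, \<tau>1) within T)"
      by (intro tendsto_intros C_lim) (auto intro!: tendsto_eq_intros)
    then have "((\<lambda>z. B z - A z) \<longlongrightarrow> (C ?x + c2) - (C ?x + c1)) (at (\<tau>1, \<tau>1) within T)"
    proof (rule Lim_transform_eventually)
      have "open ?Q" by (intro open_Times) auto
      then show "\<forall>\<^sub>F z in at (\<tau>1, \<tau>1) within T.
          (C (\<tau> - snd z, \<tau> - fst z) + c2) - (C (\<tau> - fst z, \<tau> - snd z) + c1) = B z - A z"
        unfolding eventually_at_topological
      proof (intro exI[of _ ?Q] conjI ballI impI)
        fix z assume z: "z \<in> T" "z \<in> ?Q"
        then show "(C (\<tau> - snd z, \<tau> - fst z) + c2) - (C (\<tau> - fst z, \<tau> - snd z) + c1) = B z - A z"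
          using A_eq[of "\<tau> - snd z" "\<tau> - fst z"] B_eq[of "\<tau> - snd z" "\<tau> - fst z"]
          by (cases z) (auto simp: T_def)
      qed (use k1 in auto)
    qed
    moreover have "at (\<tau>1, \<tau>1) within T \<noteq> bot"
      using diagonal_islimpt[of \<tau>1] k1 \<epsilon> trivial_limit_within by fastforce
    ultimately have "(C ?x + c2) - (C ?x + c1) = \<i> * pi * of_int k1"
      using k1(3) tendsto_unique unfolding has_index_def by blast
    then show ?thesis by simp
  qed
  define L1 where "L1 x = C x + c1" for x
  define L2 where "L2 x = B (\<tau> - fst x, \<tau> + snd x)" for x
  \<comment> \<open>After \<open>\<tau>\<close> the value of g may stand for that of f; the chord is
    traversed backwards, hence the shift by i pi.\<close>
  define L3 where "L3 x = A (\<tau> - snd x, \<tau> + fst x) + \<i> * pi" for x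
  interpret tripod \<epsilon> "\<lambda>x. f (\<tau> - x)" "\<lambda>x. g (\<tau> - x)" "\<lambda>x. f (\<tau> + x)" "f \<tau>" L1 L2 L3
  proof
    have "exp c1 = 1"
      using C(2)[of "(\<epsilon>, 0)"] expA[of "\<tau> - \<epsilon>" \<tau>] \<epsilon> unfolding c1_def by (simp add: exp_diff)
    then show "difference_log \<epsilon> (\<lambda>x. f (\<tau> - x)) (\<lambda>x. g (\<tau> - x)) L1"
      unfolding difference_log_def L1_def using C(2)
      by (auto intro!: continuous_intros C(1) simp: exp_add)
    have "continuous_on ?D L2" unfolding L2_def
      using \<epsilon> by (intro continuous_on_compose2[OF contB] continuous_intros) auto
    then show "difference_log \<epsilon> (\<lambda>x. g (\<tau> - x)) (\<lambda>x. f (\<tau> + x)) L2"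
      unfolding difference_log_def L2_def using expB \<epsilon> by auto
    have "continuous_on ?D L3" unfolding L3_def
      using \<epsilon> by (intro continuous_on_compose2[OF contA] continuous_intros) auto
    then show "difference_log \<epsilon> (\<lambda>x. f (\<tau> + x)) (\<lambda>x. f (\<tau> - x)) L3"
      unfolding difference_log_def L3_def using expA common \<epsilon> by (auto simp: exp_add)
  qed (use ft \<epsilon> in auto)
  have "total_turn x y z = \<i> * pi * of_int (k2 - k1)"
    if xyz: "x \<in> {0<..\<epsilon>}" "y \<in> {0<..\<epsilon>}" "z \<in> {0<..\<epsilon>}" for x y z
  proof -
    have "B (\<tau>, \<tau> + z) - A (\<tau>, \<tau> + z) = \<i> * pi * of_int k2"
    proof (rule has_index_common[of \<tau> "\<tau> + \<epsilon>" \<tau>2])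
    qed (use bounds xyz k2 common in auto)
    moreover have "A (\<tau> - x, \<tau>) = C (x, 0) + c1" "B (\<tau> - y, \<tau>) = C (0, y) + c2"
      using A_eq[of 0 x] B_eq[of 0 y] xyz by auto
    ultimately show ?thesis
      using index1 unfolding total_turn_def turn_def L1_def L2_def L3_def
      by (simp add: algebra_simps)
  qed
  then show ?thesis using tripod_axioms by blast
qed

text \<open>Reversing time exchanges the earlier and the later end of a chord: \<open>A\<close> and
  \<open>B\<close> trade places, and each chord changes sign, which costs i pi.\<close>

lemma reverse_strand_pair:
  "strand_pair M (\<lambda>s. f (M - s)) (\<lambda>s. g (M - s))
     (\<lambda>x. B (M - snd x, M - fst x) + \<i> * pi) (\<lambda>x. A (M - snd x, M - fst x) + \<i> * pi)"
proof
  show "continuous_on {0..M} (\<lambda>s. f (M - s))" "continuous_on {0..M} (\<lambda>s. g (M - s))"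
    by (auto intro!: continuous_on_compose2[OF cont(1)] continuous_on_compose2[OF cont(2)] continuous_intros)
  show "continuous_on {(s, t). 0 \<le> s \<and> s < t \<and> t \<le> M} (\<lambda>x. B (M - snd x, M - fst x) + \<i> * pi)"
    by (intro continuous_on_add continuous_on_const continuous_on_compose2[OF contB] continuous_intros) auto
  show "continuous_on {(s, t). 0 \<le> s \<and> s < t \<and> t \<le> M} (\<lambda>x. A (M - snd x, M - fst x) + \<i> * pi)"
    by (intro continuous_on_add continuous_on_const continuous_on_compose2[OF contA] continuous_intros) auto
  fix s t :: real
  show "g (M - t) \<noteq> f (M - s)" if "s \<in> {0..M}" "t \<in> {0..M}" "s \<noteq> t"
    using that by (intro off_diagonal) auto
  assume st: "0 \<le> s" "s < t" "t \<le> M"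
  show "exp (B (M - snd (s, t), M - fst (s, t)) + \<i> * pi) = g (M - t) - f (M - s)"
    using expB[of "M - t" "M - s"] st by (simp add: exp_add)
  show "exp (A (M - snd (s, t), M - fst (s, t)) + \<i> * pi) = f (M - t) - g (M - s)"
    using expA[of "M - t" "M - s"] st by (simp add: exp_add)
qed (rule M)

lemma reverse_has_index:
  assumes "has_index \<tau> k"
  shows "strand_pair.has_index M (\<lambda>x. B (M - snd x, M - fst x) + \<i> * pi) (\<lambda>x. A (M - snd x, M - fst x) + \<i> * pi) (M - \<tau>) (- k)"
proof -
  interpret R: strand_pair M "\<lambda>s. f (M - s)" "\<lambda>s. g (M - s)"
    "\<lambda>x. B (M - snd x, M - fst x) + \<i> * pi" "\<lambda>x. A (M - snd x, M - fst x) + \<i> * pi"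
    by (rule reverse_strand_pair)
  have "filterlim (\<lambda>x. (M - snd x, M - fst x)) (at (\<tau>, \<tau>) within T) (at (M - \<tau>, M - \<tau>) within T)"
    unfolding filterlim_at
  proof (intro conjI)
    have "((\<lambda>x. (M - snd x, M - fst x)) \<longlongrightarrow> (M - (M - \<tau>), M - (M - \<tau>))) (at (M - \<tau>, M - \<tau>) within T)"
      by (intro tendsto_Pair tendsto_diff tendsto_const) (auto intro: tendsto_eq_intros)
    then show "((\<lambda>x. (M - snd x, M - fst x)) \<longlongrightarrow> (\<tau>, \<tau>)) (at (M - \<tau>, M - \<tau>) within T)" by simp
    show "\<forall>\<^sub>F x in at (M - \<tau>, M - \<tau>) within T. (M - snd x, M - fst x) \<in> T \<and> (M - snd x, M - fst x) \<noteq> (\<tau>, \<tau>)"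
      unfolding eventually_at_filter by (rule always_eventually) (auto simp: T_def)
  qed
  then have "((\<lambda>x. B (M - snd x, M - fst x) - A (M - snd x, M - fst x)) \<longlongrightarrow> \<i> * pi * of_int k) (at (M - \<tau>, M - \<tau>) within T)"
    by (rule filterlim_compose[OF assms[unfolded has_index_def]])
  from tendsto_minus[OF this] have "((\<lambda>x. - (B (M - snd x, M - fst x) - A (M - snd x, M - fst x))) \<longlongrightarrow>
      \<i> * pi * of_int (- k)) (at (M - \<tau>, M - \<tau>) within T)"
    by (simp only: of_int_minus mult_minus_right)
  moreover have "(\<lambda>x. - (B (M - snd x, M - fst x) - A (M - snd x, M - fst x))) =
      (\<lambda>x. A (M - snd x, M - fst x) + \<i> * pi - (B (M - snd x, M - fst x) + \<i> * pi))"
    by (rule ext) simp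
  ultimately show ?thesis
    unfolding R.has_index_def by (simp only:)
qed

lemma splitting_index_jump:
  assumes \<epsilon>: "0 < \<epsilon>" "0 \<le> \<tau> - \<epsilon>" "\<tau> + \<epsilon> \<le> M"
    and common: "\<And>s. s \<in> {\<tau> - \<epsilon>..\<tau>} \<Longrightarrow> f s = g s"
    and apart: "\<And>s. s \<in> {\<tau><..\<tau> + \<epsilon>} \<Longrightarrow> f s \<noteq> g s"
    and k1: "\<tau> - \<epsilon> < \<tau>1" "\<tau>1 < \<tau>" "has_index \<tau>1 k1"
    and k2: "\<tau> < \<tau>2" "\<tau>2 < \<tau> + \<epsilon>" "has_index \<tau>2 k2"
  shows "\<exists>L1 L2 L3. tripod \<epsilon> (\<lambda>x. f (\<tau> + x)) (\<lambda>x. g (\<tau> + x)) (\<lambda>x. f (\<tau> - x)) (f \<tau>) L1 L2 L3 \<and>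
    (\<forall>x\<in>{0<..\<epsilon>}. \<forall>y\<in>{0<..\<epsilon>}. \<forall>z\<in>{0<..\<epsilon>}. tripod.total_turn L1 L2 L3 x y z = \<i> * pi * of_int (k2 - k1))"
proof -
  interpret R: strand_pair M "\<lambda>s. f (M - s)" "\<lambda>s. g (M - s)"
    "\<lambda>x. B (M - snd x, M - fst x) + \<i> * pi" "\<lambda>x. A (M - snd x, M - fst x) + \<i> * pi"
    by (rule reverse_strand_pair)
  have e: "M - (M - \<tau> - x) = \<tau> + x" "M - (M - \<tau> + x) = \<tau> - x" "M - (M - \<tau>) = \<tau>" for x by auto
  have "\<exists>L1 L2 L3. tripod \<epsilon> (\<lambda>x. f (M - (M - \<tau> - x))) (\<lambda>x. g (M - (M - \<tau> - x))) (\<lambda>x. f (M - (M - \<tau> + x))) (f (M - (M - \<tau>))) L1 L2 L3 \<and>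
    (\<forall>x\<in>{0<..\<epsilon>}. \<forall>y\<in>{0<..\<epsilon>}. \<forall>z\<in>{0<..\<epsilon>}. tripod.total_turn L1 L2 L3 x y z = \<i> * pi * of_int (- k1 - - k2))"
    by (rule R.merging_index_jump[OF \<epsilon>(1) _ _ _ _ _ _ reverse_has_index[OF k2(3)] _ _ reverse_has_index[OF k1(3)]])
      (use \<epsilon> k1 k2 in \<open>auto intro!: common apart\<close>)
  then show ?thesis unfolding e by simp
qed

text \<open>The legs s = 0 and t = M of the triangle share the corner \<open>(0, M)\<close>, and all
  chords on them point to the right; so \<open>L\<close> is the principal logarithm there up to one
  constant.\<close>

lemma log_on_sides:
  assumes L: "continuous_on {(s, t). 0 \<le> s \<and> s < t \<and> t \<le> M} L"
    and expL: "\<And>s t. 0 \<le> s \<Longrightarrow> s < t \<Longrightarrow> t \<le> M \<Longrightarrow> exp (L (s, t)) = v t - u s"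
    and left: "\<And>t. 0 < t \<Longrightarrow> t \<le> M \<Longrightarrow> 0 < Re (v t - u 0)"
    and right: "\<And>s. 0 \<le> s \<Longrightarrow> s < M \<Longrightarrow> 0 < Re (v M - u s)"
  shows "\<exists>c. (\<forall>t. 0 < t \<and> t \<le> M \<longrightarrow> L (0, t) = Ln (v t - u 0) + c) \<and>
    (\<forall>s. 0 \<le> s \<and> s < M \<longrightarrow> L (s, M) = Ln (v M - u s) + c)"
proof (intro exI[of _ "L (0, M) - Ln (v M - u 0)"] conjI allI impI)
  fix t assume t: "0 < t \<and> t \<le> M"
  have "L (0, M) - L (0, t) = Ln ((v M - u 0) / 1) - Ln ((v t - u 0) / 1)"
  proof (rule log_change_in_half_plane[of "{0<..M}" "\<lambda>t. L (0, t)" "\<lambda>t. v t - u 0"])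
    show "continuous_on {0<..M} (\<lambda>t. L (0, t))"
      by (rule continuous_on_compose2[OF L]) (auto intro!: continuous_intros)
    show "exp (L (0, t)) = v t - u 0" if "t \<in> {0<..M}" for t using that by (intro expL) auto
    show "0 < Re ((v t - u 0) * cnj 1)" if "t \<in> {0<..M}" for t using that left[of t] by simp
  qed (use t M in auto)
  then show "L (0, t) = Ln (v t - u 0) + (L (0, M) - Ln (v M - u 0))" by (simp add: algebra_simps)
next
  fix s assume s: "0 \<le> s \<and> s < M"
  have "L (s, M) - L (0, M) = Ln ((v M - u s) / 1) - Ln ((v M - u 0) / 1)"
  proof (rule log_change_in_half_plane[of "{0..<M}" "\<lambda>s. L (s, M)" "\<lambda>s. v M - u s"])
    show "continuous_on {0..<M} (\<lambda>s. L (s, M))"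
      by (rule continuous_on_compose2[OF L]) (auto intro!: continuous_intros)
    show "exp (L (s, M)) = v M - u s" if "s \<in> {0..<M}" for s using that by (intro expL) auto
    show "0 < Re ((v M - u s) * cnj 1)" if "s \<in> {0..<M}" for s using that right[of s] by simp
  qed (use s M in auto)
  then show "L (s, M) = Ln (v M - u s) + (L (0, M) - Ln (v M - u 0))" by (simp add: algebra_simps)
qed

lemma Ln_imaginary: "y \<noteq> 0 \<Longrightarrow> Ln (- (\<i> * of_real y)) - Ln (\<i> * of_real y) = - \<i> * pi * of_real (sgn y)"
proof -
  assume y: "y \<noteq> 0"
  have "Ln (\<i> * of_real z) = of_real (ln z) + \<i> * (pi / 2)" "Ln (- (\<i> * of_real z)) = of_real (ln z) - \<i> * (pi / 2)" if "0 < z" for z :: real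
    using Ln_times_of_real[OF that, of \<i>] Ln_times_of_real[OF that, of "- \<i>"] Ln_of_real[OF that] that
    by (auto simp: mult.commute)
  note ln = this
  show ?thesis
  proof (cases "0 < y")
    case True
    show ?thesis unfolding ln[OF True] using True by simp
  next
    case False
    then have "0 < - y" using y by simp
    from ln[OF this] have "Ln (- (\<i> * of_real y)) = of_real (ln (- y)) + \<i> * (pi / 2)"
      "Ln (\<i> * of_real y) = of_real (ln (- y)) - \<i> * (pi / 2)" by simp_all
    then show ?thesis using False y by simp
  qed
qed

text \<open>Both indices are limits along the legs of the triangle, where \<open>A\<close> and
  \<open>B\<close> are principal logarithms up to constants. These constants are the same at both
  ends and cancel; what remains is the sign of the vertical distance.\<close>

lemma index_difference:
  assumes left: "\<And>t. 0 < t \<Longrightarrow> t \<le> M \<Longrightarrow> 0 < Re (g t - f 0)" "\<And>t. 0 < t \<Longrightarrow> t \<le> M \<Longrightarrow> 0 < Re (f t - g 0)"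
    and right: "\<And>s. 0 \<le> s \<Longrightarrow> s < M \<Longrightarrow> 0 < Re (g M - f s)" "\<And>s. 0 \<le> s \<Longrightarrow> s < M \<Longrightarrow> 0 < Re (f M - g s)"
    and ends: "Re (f 0) = Re (g 0)" "Re (f M) = Re (g M)"
    and reg: "regular 0" "regular M" and k: "has_index 0 k0" "has_index M kM"
  shows "of_int (kM - k0) = sgn (Im (g 0 - f 0)) - sgn (Im (g M - f M))"
proof -
  obtain ca where ca: "\<And>t. 0 < t \<Longrightarrow> t \<le> M \<Longrightarrow> A (0, t) = Ln (g t - f 0) + ca"
    "\<And>s. 0 \<le> s \<Longrightarrow> s < M \<Longrightarrow> A (s, M) = Ln (g M - f s) + ca"
    using log_on_sides[OF contA expA left(1) right(1)] by blast
  obtain cb where cb: "\<And>t. 0 < t \<Longrightarrow> t \<le> M \<Longrightarrow> B (0, t) = Ln (f t - g 0) + cb"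
    "\<And>s. 0 \<le> s \<Longrightarrow> s < M \<Longrightarrow> B (s, M) = Ln (f M - g s) + cb"
    using log_on_sides[OF contB expB left(2) right(2)] by blast
  have index: "\<i> * pi * of_int k = cb - ca - \<i> * pi * of_real (sgn (Im (g \<tau> - f \<tau>)))"
    if \<tau>: "\<tau> \<in> {0..M}" and idx: "has_index \<tau> k" and reg: "regular \<tau>" and re: "Re (f \<tau>) = Re (g \<tau>)"
      and path: "F \<noteq> bot" "filterlim \<gamma> (at (\<tau>, \<tau>) within T) F"
      and uv: "\<And>x. x \<in> P \<Longrightarrow> A (\<gamma> x) = Ln (u x) + ca" "\<And>x. x \<in> P \<Longrightarrow> B (\<gamma> x) = Ln (v x) + cb"
      and ev: "\<forall>\<^sub>F x in F. x \<in> P" and lim: "(u \<longlongrightarrow> g \<tau> - f \<tau>) F" "(v \<longlongrightarrow> f \<tau> - g \<tau>) F"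
      and same: "\<And>\<epsilon>. 0 < \<epsilon> \<Longrightarrow> \<forall>s\<in>{0..M}. \<bar>s - \<tau>\<bar> < \<epsilon> \<longrightarrow> f s = g s \<Longrightarrow> \<forall>\<^sub>F x in F. u x = v x"
    for \<tau> k \<gamma> u v P and F :: "real filter"
  proof -
    define y where "y = Im (g \<tau> - f \<tau>)"
    have gf: "g \<tau> - f \<tau> = \<i> * of_real y" "f \<tau> - g \<tau> = - (\<i> * of_real y)"
      using re by (auto simp: complex_eq_iff y_def)
    have "((\<lambda>x. B (\<gamma> x) - A (\<gamma> x)) \<longlongrightarrow> \<i> * pi * of_int k) F"
      using filterlim_compose[OF idx[unfolded has_index_def] path(2)] .
    moreover have "((\<lambda>x. B (\<gamma> x) - A (\<gamma> x)) \<longlongrightarrow> cb - ca - \<i> * pi * of_real (sgn y)) F"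
    proof (cases "y = 0")
      case False
      have "((\<lambda>x. (Ln (v x) + cb) - (Ln (u x) + ca)) \<longlongrightarrow> (Ln (f \<tau> - g \<tau>) + cb) - (Ln (g \<tau> - f \<tau>) + ca)) F"
        using False re by (intro tendsto_intros tendsto_Ln lim) (auto simp: complex_nonpos_Reals_iff y_def)
      moreover have "(Ln (f \<tau> - g \<tau>) + cb) - (Ln (g \<tau> - f \<tau>) + ca) = cb - ca - \<i> * pi * of_real (sgn y)"
        using Ln_imaginary[OF False] unfolding gf by (simp add: algebra_simps)
      ultimately have "((\<lambda>x. (Ln (v x) + cb) - (Ln (u x) + ca)) \<longlongrightarrow> cb - ca - \<i> * pi * of_real (sgn y)) F"
        by (simp only:)
      moreover have "\<forall>\<^sub>F x in F. (Ln (v x) + cb) - (Ln (u x) + ca) = B (\<gamma> x) - A (\<gamma> x)"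
        using ev by eventually_elim (simp only: uv)
      ultimately show ?thesis by (rule Lim_transform_eventually)
    next
      \<comment> \<open>With equal end points, regularity makes the strands agree nearby, so the two
        principal logarithms coincide; this matches the value 0 of \<open>sgn\<close>.\<close>
      case True
      then have "f \<tau> = g \<tau>" using gf by simp
      then obtain \<epsilon> where "0 < \<epsilon>" "\<forall>s\<in>{0..M}. \<bar>s - \<tau>\<bar> < \<epsilon> \<longrightarrow> f s = g s" using reg unfolding regular_def by blast
      from same[OF this] ev have "\<forall>\<^sub>F x in F. B (\<gamma> x) - A (\<gamma> x) = cb - ca"
        by eventually_elim (simp only: uv, simp)
      then have "((\<lambda>x. B (\<gamma> x) - A (\<gamma> x)) \<longlongrightarrow> cb - ca) F" by (rule tendsto_eventually)
      then show ?thesis using True by simp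
    qed
    ultimately show ?thesis using tendsto_unique[OF path(1)] unfolding y_def by blast
  qed
  have cr: "(h \<longlongrightarrow> h 0) (at_right 0)" "(h \<longlongrightarrow> h M) (at_left M)" if "continuous_on {0..M} h" for h :: "real \<Rightarrow> complex"
    using that M by (auto simp: continuous_on_Icc_at_rightD continuous_on_Icc_at_leftD)
  have "\<i> * pi * of_int k0 = cb - ca - \<i> * pi * of_real (sgn (Im (g 0 - f 0)))"
  proof (rule index[of 0 k0 "at_right 0" "\<lambda>t. (0, t)" "{0<..<M}" "\<lambda>t. g t - f 0" "\<lambda>t. f t - g 0"])
    have ev: "\<forall>\<^sub>F x in at_right 0. x \<in> {0<..<M}" using M by (rule eventually_at_right_real)
    then show "\<forall>\<^sub>F x in at_right 0. x \<in> {0<..<M}" .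
    show "filterlim (\<lambda>t. (0, t)) (at (0, 0) within T) (at_right 0)"
      unfolding filterlim_at
    proof
      show "\<forall>\<^sub>F x in at_right 0. (0, x) \<in> T \<and> (0, x) \<noteq> (0, 0)"
        using ev by eventually_elim (auto simp: T_def)
    qed (auto intro!: tendsto_eq_intros)
    show "\<forall>\<^sub>F x in at_right 0. g x - f 0 = f x - g 0"
      if "0 < \<epsilon>" "\<forall>s\<in>{0..M}. \<bar>s - 0\<bar> < \<epsilon> \<longrightarrow> f s = g s" for \<epsilon>
      using ev eventually_at_right_real[OF that(1)] by eventually_elim (use that M in auto)
    show "((\<lambda>t. g t - f 0) \<longlongrightarrow> g 0 - f 0) (at_right 0)" "((\<lambda>t. f t - g 0) \<longlongrightarrow> f 0 - g 0) (at_right 0)"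
      by (intro tendsto_intros cr(1) cont)+
  qed (use M k reg ends ca cb in auto)
  moreover have "\<i> * pi * of_int kM = cb - ca - \<i> * pi * of_real (sgn (Im (g M - f M)))"
  proof (rule index[of M kM "at_left M" "\<lambda>s. (s, M)" "{0<..<M}" "\<lambda>s. g M - f s" "\<lambda>s. f M - g s"])
    have ev: "\<forall>\<^sub>F x in at_left M. x \<in> {0<..<M}" using M by (rule eventually_at_left_real)
    then show "\<forall>\<^sub>F x in at_left M. x \<in> {0<..<M}" .
    show "filterlim (\<lambda>t. (t, M)) (at (M, M) within T) (at_left M)"
      unfolding filterlim_at
    proof
      show "\<forall>\<^sub>F x in at_left M. (x, M) \<in> T \<and> (x, M) \<noteq> (M, M)"
        using ev by eventually_elim (auto simp: T_def)
    qed (auto intro!: tendsto_eq_intros)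
    show "\<forall>\<^sub>F x in at_left M. g M - f x = f M - g x"
      if "0 < \<epsilon>" "\<forall>s\<in>{0..M}. \<bar>s - M\<bar> < \<epsilon> \<longrightarrow> f s = g s" for \<epsilon>
    proof -
      have "\<forall>\<^sub>F x in at_left M. x \<in> {M - \<epsilon><..<M}" using that(1) by (intro eventually_at_left_real) auto
      with ev show ?thesis by eventually_elim (use that M in auto)
    qed
    show "((\<lambda>s. g M - f s) \<longlongrightarrow> g M - f M) (at_left M)" "((\<lambda>s. f M - g s) \<longlongrightarrow> f M - g M) (at_left M)"
      by (intro tendsto_intros cr(2) cont)+
  qed (use M k reg ends ca cb in auto)
  ultimately have "\<i> * pi * of_int kM - \<i> * pi * of_int k0 =
      \<i> * pi * of_real (sgn (Im (g 0 - f 0))) - \<i> * pi * of_real (sgn (Im (g M - f M)))"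
    by (simp only:) simp
  then have "\<i> * pi * of_real (of_int (kM - k0)) = \<i> * pi * of_real (sgn (Im (g 0 - f 0)) - sgn (Im (g M - f M)))"
    by (simp add: algebra_simps)
  then have "complex_of_real (of_int (kM - k0)) = of_real (sgn (Im (g 0 - f 0)) - sgn (Im (g M - f M)))"
    by simp
  then show ?thesis by (simp only: of_real_eq_iff)
qed

end

section \<open>Crossings with the cut\<close>

lemma floor_near_integer:
  fixes x y :: real
  assumes "x \<in> \<int>" "\<bar>y - x\<bar> < 1"
  shows "\<lfloor>y\<rfloor> = (if y < x then \<lfloor>x\<rfloor> - 1 else \<lfloor>x\<rfloor>)" "y \<noteq> x \<Longrightarrow> y \<notin> \<int>"
proof -
  obtain n :: int where n: "x = of_int n" using assms(1) by (auto elim: Ints_cases)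
  have "\<lfloor>y\<rfloor> = n - 1" if "y < x" using that assms(2) n by (intro floor_unique) auto
  moreover have "\<lfloor>y\<rfloor> = n" if "\<not> y < x" using that assms(2) n by (intro floor_unique) auto
  ultimately show "\<lfloor>y\<rfloor> = (if y < x then \<lfloor>x\<rfloor> - 1 else \<lfloor>x\<rfloor>)" using n by auto
  show "y \<notin> \<int>" if "y \<noteq> x"
  proof
    assume "y \<in> \<int>"
    then obtain m :: int where "y = of_int m" by (auto elim: Ints_cases)
    with that assms(2) n show False by auto
  qed
qed

text \<open>\<open>U\<close> and \<open>D\<close> are the upward and downward passages through
  integers, and the floor changes only there. So the floor corrected by the passages counted so far
  is locally constant.\<close>

lemma crossing_count:
  fixes h :: "real \<Rightarrow> real"
  assumes cont: "continuous_on {0..1} h" and ends: "h 0 \<notin> \<int>" "h 1 \<notin> \<int>"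
  defines "U \<equiv> {t \<in> {0<..<1}. h t \<in> \<int> \<and> (\<forall>\<^sub>F s in at_left t. h s < h t) \<and> (\<forall>\<^sub>F s in at_right t. h t < h s)}"
  defines "D \<equiv> {t \<in> {0<..<1}. h t \<in> \<int> \<and> (\<forall>\<^sub>F s in at_left t. h t < h s) \<and> (\<forall>\<^sub>F s in at_right t. h s < h t)}"
  assumes UD: "\<And>t. 0 < t \<Longrightarrow> t < 1 \<Longrightarrow> h t \<in> \<int> \<Longrightarrow> t \<in> U \<union> D"
  shows "\<lfloor>h 1\<rfloor> - \<lfloor>h 0\<rfloor> = int (card U) - int (card D)"
proof -
  have local: "\<exists>d>0. \<forall>s\<in>{0..1}. \<bar>s - t\<bar> < d \<longrightarrow> s \<noteq> t \<longrightarrow> h s \<notin> \<int> \<and>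
      \<lfloor>h s\<rfloor> = \<lfloor>h t\<rfloor> - (if s < t \<and> t \<in> U then 1 else 0) - (if t < s \<and> t \<in> D then 1 else 0)"
    if t: "t \<in> {0..1}" for t
  proof (cases "h t \<in> \<int>")
    case False
    define e where "e = min (h t - of_int \<lfloor>h t\<rfloor>) (of_int \<lfloor>h t\<rfloor> + 1 - h t)"
    have "of_int \<lfloor>h t\<rfloor> \<noteq> h t" using False by (metis Ints_of_int)
    then have "of_int \<lfloor>h t\<rfloor> < h t" using of_int_floor_le[of "h t"] by linarith
    then have "0 < e" unfolding e_def using floor_correct[of "h t"] by simp
    then obtain d where d: "0 < d" "\<And>s. s \<in> {0..1} \<Longrightarrow> dist s t < d \<Longrightarrow> dist (h s) (h t) < e"
      using cont t unfolding continuous_on_iff by metis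
    have "h s \<notin> \<int> \<and> \<lfloor>h s\<rfloor> = \<lfloor>h t\<rfloor>" if "s \<in> {0..1}" "\<bar>s - t\<bar> < d" for s
    proof -
      have "\<bar>h s - h t\<bar> < e" using d(2)[OF that(1)] that(2) by (simp add: dist_real_def)
      then have b: "of_int \<lfloor>h t\<rfloor> < h s" "h s < of_int \<lfloor>h t\<rfloor> + 1" by (auto simp: e_def)
      then have "\<lfloor>h s\<rfloor> = \<lfloor>h t\<rfloor>" by (intro floor_unique) auto
      moreover have "h s \<notin> \<int>"
      proof
        assume "h s \<in> \<int>"
        then have "of_int \<lfloor>h s\<rfloor> = h s" by (auto elim: Ints_cases)
        with b calculation show False by simp
      qed
      ultimately show ?thesis by simp
    qed
    moreover have "t \<notin> U" "t \<notin> D" using False by (auto simp: U_def D_def)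
    ultimately show ?thesis using d(1) by (intro exI[of _ d]) auto
  next
    case True
    then have t1: "0 < t" "t < 1" using ends t by (cases "t = 0"; cases "t = 1"; auto)+
    obtain d where d: "0 < d" "\<And>s. s \<in> {0..1} \<Longrightarrow> dist s t < d \<Longrightarrow> dist (h s) (h t) < 1"
      using cont t unfolding continuous_on_iff by (metis zero_less_one)
    from UD[OF t1 True] consider "t \<in> U" "t \<notin> D" | "t \<in> D" "t \<notin> U"
    proof -
      have "\<not> (t \<in> U \<and> t \<in> D)"
      proof
        assume "t \<in> U \<and> t \<in> D"
        then have "\<forall>\<^sub>F s in at_left t. h s < h t" "\<forall>\<^sub>F s in at_left t. h t < h s" by (auto simp: U_def D_def)
        then have "\<forall>\<^sub>F s in at_left t. False" by eventually_elim simp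
        then show False by simp
      qed
      then show ?thesis using UD[OF t1 True] that by blast
    qed
    then show ?thesis
    proof cases
      case 1
      then have "\<forall>\<^sub>F s in at_left t. h s < h t" "\<forall>\<^sub>F s in at_right t. h t < h s" by (auto simp: U_def)
      then obtain b1 b2 where b: "b1 < t" "\<And>s. b1 < s \<Longrightarrow> s < t \<Longrightarrow> h s < h t"
        "t < b2" "\<And>s. t < s \<Longrightarrow> s < b2 \<Longrightarrow> h t < h s"
        unfolding eventually_at_left_field eventually_at_right_field by blast
      show ?thesis
      proof (intro exI[of _ "min d (min (t - b1) (b2 - t))"] conjI ballI impI)
        fix s assume s: "s \<in> {0..1}" "\<bar>s - t\<bar> < min d (min (t - b1) (b2 - t))" "s \<noteq> t"
        have near: "\<bar>h s - h t\<bar> < 1" using d(2)[OF s(1)] s(2) by (simp add: dist_real_def)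
        have "s < t \<Longrightarrow> h s < h t" "t < s \<Longrightarrow> h t < h s" using s b by auto
        with s(3) have "h s \<noteq> h t" by (cases "s < t") auto
        then show "h s \<notin> \<int>" using floor_near_integer(2)[OF True near] by simp
        show "\<lfloor>h s\<rfloor> = \<lfloor>h t\<rfloor> - (if s < t \<and> t \<in> U then 1 else 0) - (if t < s \<and> t \<in> D then 1 else 0)"
          using floor_near_integer(1)[OF True near] \<open>s < t \<Longrightarrow> h s < h t\<close> \<open>t < s \<Longrightarrow> h t < h s\<close> s(3) 1 by auto
      qed (use d b in auto)
    next
      case 2
      then have "\<forall>\<^sub>F s in at_left t. h t < h s" "\<forall>\<^sub>F s in at_right t. h s < h t" by (auto simp: D_def)
      then obtain b1 b2 where b: "b1 < t" "\<And>s. b1 < s \<Longrightarrow> s < t \<Longrightarrow> h t < h s"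
        "t < b2" "\<And>s. t < s \<Longrightarrow> s < b2 \<Longrightarrow> h s < h t"
        unfolding eventually_at_left_field eventually_at_right_field by blast
      show ?thesis
      proof (intro exI[of _ "min d (min (t - b1) (b2 - t))"] conjI ballI impI)
        fix s assume s: "s \<in> {0..1}" "\<bar>s - t\<bar> < min d (min (t - b1) (b2 - t))" "s \<noteq> t"
        have near: "\<bar>h s - h t\<bar> < 1" using d(2)[OF s(1)] s(2) by (simp add: dist_real_def)
        have "s < t \<Longrightarrow> h t < h s" "t < s \<Longrightarrow> h s < h t" using s b by auto
        with s(3) have "h s \<noteq> h t" by (cases "s < t") auto
        then show "h s \<notin> \<int>" using floor_near_integer(2)[OF True near] by simp
        show "\<lfloor>h s\<rfloor> = \<lfloor>h t\<rfloor> - (if s < t \<and> t \<in> U then 1 else 0) - (if t < s \<and> t \<in> D then 1 else 0)"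
          using floor_near_integer(1)[OF True near] \<open>s < t \<Longrightarrow> h t < h s\<close> \<open>t < s \<Longrightarrow> h s < h t\<close> s(3) 2 by auto
      qed (use d b in auto)
    qed
  qed
  \<comment> \<open>Times with integer values are isolated, and the interval is compact.\<close>
  have "finite ({0..1} \<inter> {t \<in> {0..1}. h t \<in> \<int>})"
  proof (rule finite_not_islimpt_in_compact)
    fix t :: real assume "t \<in> {0..1}"
    then obtain d where "0 < d" "\<And>s. s \<in> {0..1} \<Longrightarrow> \<bar>s - t\<bar> < d \<Longrightarrow> s \<noteq> t \<Longrightarrow> h s \<notin> \<int>"
      using local by blast
    then show "\<not> t islimpt {t \<in> {0..1}. h t \<in> \<int>}"
      unfolding islimpt_approachable by (force simp: dist_real_def)
  qed simp
  then have fin: "finite U" "finite D"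
    by (auto elim!: rev_finite_subset simp: U_def D_def)
  \<comment> \<open>The floor has its new value already at an upward passage but still its old one
    at a downward passage; hence the closed ray for \<open>U\<close> and the open one for
    \<open>D\<close>.\<close>
  define Q where "Q t = \<lfloor>h t\<rfloor> - int (card (U \<inter> {..t})) + int (card (D \<inter> {..<t}))" for t
  have "Q 0 = Q 1"
  proof (rule connected_local_const[of "{0..1::real}"])
    show "\<forall>t\<in>{0..1}. \<forall>\<^sub>F s in at t within {0..1}. Q t = Q s"
    proof
      fix t :: real assume "t \<in> {0..1}"
      then obtain d where d: "0 < d" "\<And>s. s \<in> {0..1} \<Longrightarrow> \<bar>s - t\<bar> < d \<Longrightarrow> s \<noteq> t \<Longrightarrow> h s \<notin> \<int>"
        "\<And>s. s \<in> {0..1} \<Longrightarrow> \<bar>s - t\<bar> < d \<Longrightarrow> s \<noteq> t \<Longrightarrow>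
          \<lfloor>h s\<rfloor> = \<lfloor>h t\<rfloor> - (if s < t \<and> t \<in> U then 1 else 0) - (if t < s \<and> t \<in> D then 1 else 0)"
        using local by blast
      have no: "u = t" if "u \<in> U \<union> D" "\<bar>u - t\<bar> < d" for u
        using that d(2)[of u] unfolding U_def D_def by (cases "u = t") auto
      have "Q t = Q s" if s: "s \<in> {0..1}" "\<bar>s - t\<bar> < d" "s \<noteq> t" for s
      proof (cases "s < t")
        case True
        have "U \<inter> {..t} = U \<inter> {..s} \<union> (if t \<in> U then {t} else {})" "D \<inter> {..<t} = D \<inter> {..<s}"
          using True no s(2) by (auto simp: not_le not_less) (force+)
        moreover have "t \<notin> U \<inter> {..s}" using True by simp
        ultimately show ?thesis unfolding Q_def d(3)[OF s] using True fin by simp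
      next
        case False
        have "U \<inter> {..s} = U \<inter> {..t}" "D \<inter> {..<s} = D \<inter> {..<t} \<union> (if t \<in> D then {t} else {})"
          using False s no by (auto simp: not_le not_less) (force+)
        moreover have "t \<notin> D \<inter> {..<t}" by simp
        ultimately show ?thesis unfolding Q_def d(3)[OF s] using False s fin by simp
      qed
      then show "\<forall>\<^sub>F s in at t within {0..1}. Q t = Q s"
        unfolding eventually_at using d(1) by (intro exI[of _ d]) (auto simp: dist_real_def)
    qed
  qed auto
  moreover have "U \<inter> {..0} = {}" "D \<inter> {..<0} = {}" "U \<inter> {..1} = U" "D \<inter> {..<1} = D"
    by (auto simp: U_def D_def)
  ultimately show ?thesis by (simp add: Q_def)
qed

section \<open>Lifting walks to the universal cover\<close>

lemma eventually_sin_sign: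
  fixes h :: "real \<Rightarrow> real"
  assumes "isCont h t" "h t \<in> \<int>"
  shows "\<forall>\<^sub>F s in at t. (0 < sin (2 * pi * h s) \<longleftrightarrow> h t < h s) \<and> (sin (2 * pi * h s) < 0 \<longleftrightarrow> h s < h t)"
proof -
  obtain m :: int where m: "h t = of_int m" using assms(2) by (auto elim: Ints_cases)
  have "\<forall>\<^sub>F s in at t. dist (h s) (h t) < 1 / 2"
    using assms(1) by (intro tendstoD) (auto simp: isCont_def)
  then show ?thesis
  proof eventually_elim
    case (elim s)
    define x where "x = h s - h t"
    have x: "\<bar>x\<bar> < 1 / 2" using elim by (simp add: x_def dist_real_def)
    have "sin (2 * pi * h s) = sin (2 * pi * x + 2 * pi * of_int m)"
      by (simp add: x_def m algebra_simps)
    also have "\<dots> = sin (2 * pi * x)"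
      using sin_cos_eq_iff[of "2 * pi * x + 2 * pi * of_int m" "2 * pi * x"] by auto
    finally have e: "sin (2 * pi * h s) = sin (2 * pi * x)" .
    have pos: "0 < sin (2 * pi * y)" if "0 < y" "y < 1 / 2" for y
      using that by (intro sin_gt_zero) (auto simp: field_simps)
    have "0 < x \<Longrightarrow> 0 < sin (2 * pi * x)" "x < 0 \<Longrightarrow> sin (2 * pi * x) < 0"
      using pos[of x] pos[of "- x"] x by auto
    then have "(0 < sin (2 * pi * x) \<longleftrightarrow> 0 < x) \<and> (sin (2 * pi * x) < 0 \<longleftrightarrow> x < 0)"
      by (cases "x = 0"; cases "0 < x") auto
    then show ?case unfolding e x_def by auto
  qed
qed

section \<open>Heights of vertices and lifts of arcs and walks\<close>

locale acyclic_cylinder = perfect_cylindrical_network \<Gamma> for \<Gamma> :: "('v, 'e) cyl_network" +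
  assumes acyclic: "acyclic_network \<Gamma>"
begin

sublocale fin_digraph "digraph_of \<Gamma>" by (rule fin_digraph)

abbreviation "G \<equiv> digraph_of \<Gamma>"

lemma closed_walk_empty: "awalk x p x \<Longrightarrow> p = []"
  using closed_w_imp_cycle acyclic unfolding acyclic_network_def closed_w_def by blast

lemma no_loop: "e \<in> arcs G \<Longrightarrow> tail G e \<noteq> head G e"
  using closed_walk_empty[of "tail G e" "[e]"] by (auto simp: awalk_simps)

lemma tail_not_sink: "e \<in> arcs G \<Longrightarrow> tail G e \<notin> sinks \<Gamma>"
  using sink_degree[of "tail G e"] finite_out_arcs[of "tail G e"] in_out_arcs_conv[of e G "tail G e"]
  by (fastforce simp: out_degree_def)

lemma head_not_source: "e \<in> arcs G \<Longrightarrow> head G e \<notin> sources \<Gamma>"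
  using source_degree[of "head G e"] finite_in_arcs[of "head G e"] in_in_arcs_conv[of e G "head G e"]
  by (fastforce simp: in_degree_def)

definition ancestors :: "'v \<Rightarrow> 'v set" where
  "ancestors v = {x \<in> verts G. \<exists>p. awalk x p v \<and> p \<noteq> []}"

text \<open>The time at which a directed path passes a vertex; it does not depend on the path.\<close>

definition height :: "'v \<Rightarrow> nat" where
  "height v = (if v \<in> sinks \<Gamma> then card (verts G) else card (ancestors v))"

lemma ancestors_strict: "v \<in> verts G \<Longrightarrow> ancestors v \<subset> verts G"
proof -
  assume "v \<in> verts G"
  moreover have "v \<notin> ancestors v" using closed_walk_empty unfolding ancestors_def by blast
  moreover have "ancestors v \<subseteq> verts G" by (auto simp: ancestors_def)
  ultimately show ?thesis by blast
qed

lemma height_le: "v \<in> verts G \<Longrightarrow> height v \<le> card (verts G)"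
  using psubset_card_mono[OF finite_verts ancestors_strict[of v]] by (auto simp: height_def)

text \<open>Passing to the head keeps all ancestors and adds the tail, which by acyclicity is not
  its own ancestor. Sinks share one value, larger than any number of ancestors, so that all strands
  end at the same time.\<close>

lemma height_tail_less:
  assumes "e \<in> arcs G"
  shows "height (tail G e) < height (head G e)"
proof -
  have v: "tail G e \<in> verts G" "head G e \<in> verts G" using assms by auto
  have t: "height (tail G e) = card (ancestors (tail G e))" using tail_not_sink[OF assms] by (simp add: height_def)
  show ?thesis
  proof (cases "head G e \<in> sinks \<Gamma>")
    case True
    then show ?thesis using t psubset_card_mono[OF finite_verts ancestors_strict[OF v(1)]] by (simp add: height_def)
  next
    case False
    have e: "awalk (tail G e) [e] (head G e)" using assms by (rule arc_implies_awalk)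
    have "x \<in> ancestors (head G e)" if x: "x \<in> ancestors (tail G e)" for x
    proof -
      obtain p where "awalk x p (tail G e)" "x \<in> verts G" using x unfolding ancestors_def by blast
      then have "awalk x (p @ [e]) (head G e)" using e by (intro awalk_appendI)
      then show ?thesis using \<open>x \<in> verts G\<close> by (auto simp: ancestors_def simp del: awalk_append_iff)
    qed
    moreover have "tail G e \<in> ancestors (head G e)" using e v by (auto simp: ancestors_def)
    moreover have "tail G e \<notin> ancestors (tail G e)" using closed_walk_empty by (auto simp: ancestors_def)
    ultimately have "ancestors (tail G e) \<subset> ancestors (head G e)" by auto
    then have "card (ancestors (tail G e)) < card (ancestors (head G e))"
      by (intro psubset_card_mono) (auto simp: ancestors_def)
    then show ?thesis using t False by (simp add: height_def)
  qed
qed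

lemma height_source: "v \<in> sources \<Gamma> \<Longrightarrow> height v = 0"
proof -
  assume v: "v \<in> sources \<Gamma>"
  have "ancestors v = {}"
  proof (rule equals0I)
    fix x assume "x \<in> ancestors v"
    then obtain p where p: "awalk x p v" "p \<noteq> []" by (auto simp: ancestors_def)
    then obtain q e where "p = q @ [e]" by (metis append_butlast_last_id)
    then have "e \<in> arcs G" "head G e = v" using p by (auto simp: awalk_simps)
    then show False using head_not_source v by auto
  qed
  then show ?thesis using v sources_sinks_disjoint by (auto simp: height_def)
qed

lemma height_sink: "v \<in> sinks \<Gamma> \<Longrightarrow> height v = card (verts G)"
  by (simp add: height_def)

lemma internalD:
  assumes "v \<in> internal \<Gamma>"
  shows "v \<in> verts G" "\<exists>e\<in>arcs G. head G e = v" "\<exists>e\<in>arcs G. tail G e = v" "v \<notin> sources \<Gamma>" "v \<notin> sinks \<Gamma>"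
proof -
  show "v \<in> verts G" "v \<notin> sources \<Gamma>" "v \<notin> sinks \<Gamma>" using assms by (auto simp: internal_def)
  have "in_arcs G v \<noteq> {}" "out_arcs G v \<noteq> {}"
    using internal_degree[OF assms] by (auto simp: in_degree_def out_degree_def)
  then show "\<exists>e\<in>arcs G. head G e = v" "\<exists>e\<in>arcs G. tail G e = v" by auto
qed

lemma height_internal: "v \<in> internal \<Gamma> \<Longrightarrow> 0 < height v \<and> height v < card (verts G)"
  using internalD(2,3)[of v] height_tail_less height_le by (metis gr_zeroI less_le_trans not_less_zero head_in_verts)

lemma norm_point: "v \<in> verts G \<Longrightarrow> 1 \<le> cmod (point \<Gamma> v) \<and> cmod (point \<Gamma> v) \<le> 2"
  using source_on_boundary[of v] sink_on_boundary[of v] internal_in_interior[of v]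
  by (fastforce simp: internal_def)

lemma cut_iff: "z \<in> cut \<longleftrightarrow> Im z = 0 \<and> 1 \<le> Re z \<and> Re z \<le> 2"
proof
  assume "z \<in> cut"
  then obtain t where "0 \<le> t" "t \<le> 1" "z = (1 - t) *\<^sub>R 1 + t *\<^sub>R 2"
    unfolding cut_def closed_segment_def by auto
  then show "Im z = 0 \<and> 1 \<le> Re z \<and> Re z \<le> 2" by auto
next
  assume "Im z = 0 \<and> 1 \<le> Re z \<and> Re z \<le> 2"
  then show "z \<in> cut" unfolding cut_def closed_segment_def
    by (auto intro!: exI[of _ "Re z - 1"] simp: complex_eq_iff)
qed

text \<open>A vertex of argument 0 would lie on the cut, since its modulus is between 1 and
  2.\<close>

lemma Arg2pi_point: "v \<in> verts G \<Longrightarrow> 0 < Arg2pi (point \<Gamma> v) \<and> Arg2pi (point \<Gamma> v) < 2 * pi"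
proof -
  assume v: "v \<in> verts G"
  have "Arg2pi (point \<Gamma> v) \<noteq> 0"
  proof
    assume "Arg2pi (point \<Gamma> v) = 0"
    then have "Im (point \<Gamma> v) = 0" "0 \<le> Re (point \<Gamma> v)" by (auto simp: Arg2pi_eq_0 complex_is_Real_iff)
    moreover from this have "cmod (point \<Gamma> v) = Re (point \<Gamma> v)" by (simp add: cmod_eq_Re)
    ultimately show False using norm_point[OF v] cut_avoids_verts[OF v] by (auto simp: cut_iff)
  qed
  then show ?thesis using Arg2pi[of "point \<Gamma> v"] by auto
qed

text \<open>The lift of a vertex to the sheet whose imaginary parts lie between 0 and 2 pi.\<close>

definition base_log :: "'v \<Rightarrow> complex" where
  "base_log v = Complex (ln (cmod (point \<Gamma> v))) (Arg2pi (point \<Gamma> v))"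

lemma exp_base_log: "v \<in> verts G \<Longrightarrow> exp (base_log v) = point \<Gamma> v"
proof -
  assume v: "v \<in> verts G"
  then have "0 < cmod (point \<Gamma> v)" using norm_point[OF v] by linarith
  moreover have "base_log v = of_real (ln (cmod (point \<Gamma> v))) + \<i> * of_real (Arg2pi (point \<Gamma> v))"
    by (simp add: base_log_def complex_eq_iff)
  ultimately show ?thesis
    using Arg2pi_eq[of "point \<Gamma> v"] by (simp add: exp_add exp_of_real)
qed

lemma continuous_curve: "e \<in> arcs G \<Longrightarrow> continuous_on {0..1} (curve \<Gamma> e)"
  using curve_simple[of e] by (auto simp: simple_path_def path_def)

lemma curve_ends:
  "e \<in> arcs G \<Longrightarrow> curve \<Gamma> e 0 = point \<Gamma> (tail G e)" "e \<in> arcs G \<Longrightarrow> curve \<Gamma> e 1 = point \<Gamma> (head G e)"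
  using curve_start[of e] curve_finish[of e] by (auto simp: pathstart_def pathfinish_def)

lemma norm_curve: "e \<in> arcs G \<Longrightarrow> t \<in> {0..1} \<Longrightarrow> 1 \<le> cmod (curve \<Gamma> e t) \<and> cmod (curve \<Gamma> e t) \<le> 2"
  using curve_in_interior[of e t] curve_ends[of e] norm_point[of "tail G e"] norm_point[of "head G e"]
  by (cases "t = 0"; cases "t = 1") (auto simp: less_imp_le)

text \<open>Let \<open>h\<close> be the imaginary part of the lift in full turns. The arc is on the
  cut when \<open>h\<close> is an integer, and crossings are passages of \<open>h\<close> through
  integers. Both ends lie strictly between two sheets of the cut, so \<open>crossing_count\<close>
  identifies the final sheet \<open>m\<close> with the signed number of crossings.\<close>

lemma arc_log_exists:
  assumes e: "e \<in> arcs G"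
  shows "\<exists>l. continuous_on {0..1} l \<and> (\<forall>t\<in>{0..1}. exp (l t) = curve \<Gamma> e t) \<and> l 0 = base_log (tail G e) \<and>
    l 1 = base_log (head G e) + 2 * pi * \<i> * of_int (edge_crossings \<Gamma> e)"
proof -
  have vs: "tail G e \<in> verts G" "head G e \<in> verts G" using e by auto
  have nz: "curve \<Gamma> e t \<noteq> 0" if "t \<in> {0..1}" for t using norm_curve[OF e that] by auto
  have "\<exists>l. continuous_on {0..1} l \<and> (\<forall>t\<in>{0..1}. curve \<Gamma> e t = exp (l t))"
    using continuous_logarithm_on_contractible[OF continuous_curve[OF e] convex_imp_contractible nz]
    by (metis convex_real_interval(5))
  then obtain l0 where l0: "continuous_on {0..1} l0" "\<And>t. t \<in> {0..1} \<Longrightarrow> exp (l0 t) = curve \<Gamma> e t" by metis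
  define l where "l t = l0 t + (base_log (tail G e) - l0 0)" for t
  have cont: "continuous_on {0..1} l" unfolding l_def by (intro continuous_intros l0(1))
  have expl: "exp (l t) = curve \<Gamma> e t" if "t \<in> {0..1}" for t
  proof -
    have "exp (base_log (tail G e) - l0 0) = 1"
      using l0(2)[of 0] exp_base_log[OF vs(1)] curve_ends(1)[OF e] nz[of 0] by (simp add: exp_diff)
    then show ?thesis unfolding l_def exp_add using l0(2)[OF that] by simp
  qed
  have l_0: "l 0 = base_log (tail G e)" by (simp add: l_def)
  have "exp (l 1) = exp (base_log (head G e))"
    using expl[of 1] exp_base_log[OF vs(2)] curve_ends(2)[OF e] by simp
  then obtain m :: int where "l 1 = base_log (head G e) + of_int (2 * m) * pi * \<i>"
    unfolding exp_eq by blast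
  then have m: "l 1 = base_log (head G e) + 2 * pi * \<i> * of_int m" by simp
  define h where "h t = Im (l t) / (2 * pi)" for t
  have conth: "continuous_on {0..1} h" unfolding h_def by (intro continuous_intros cont) auto
  have base: "0 < Im (base_log v) / (2 * pi)" "Im (base_log v) / (2 * pi) < 1" if "v \<in> verts G" for v
    using Arg2pi_point[OF that] by (auto simp: base_log_def field_simps)
  have h0: "0 < h 0" "h 0 < 1" using base[OF vs(1)] by (auto simp: h_def l_0)
  have h1: "of_int m < h 1" "h 1 < of_int m + 1"
    using base[OF vs(2)] by (auto simp: h_def m add_divide_distrib)
  have Im_curve: "Im (curve \<Gamma> e t) = exp (Re (l t)) * sin (2 * pi * h t)"
    and Re_curve: "Re (curve \<Gamma> e t) = exp (Re (l t)) * cos (2 * pi * h t)" if "t \<in> {0..1}" for t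
    unfolding expl[OF that, symmetric] by (simp_all add: h_def Re_exp Im_exp)
  have in_cut: "curve \<Gamma> e t \<in> cut \<longleftrightarrow> h t \<in> \<int>" if t: "t \<in> {0<..<1}" for t
  proof
    assume "curve \<Gamma> e t \<in> cut"
    then have "Im (curve \<Gamma> e t) = 0" "0 < Re (curve \<Gamma> e t)" by (auto simp: cut_iff)
    then have "sin (2 * pi * h t) = 0" "0 < cos (2 * pi * h t)"
      using Im_curve[of t] Re_curve[of t] t by (auto simp: zero_less_mult_iff)
    then have "cos (2 * pi * h t) = 1" using sin_zero_abs_cos_one[of "2 * pi * h t"] by auto
    then obtain n :: int where "2 * pi * h t = of_int n * 2 * pi" by (auto simp: cos_one_2pi_int)
    then have "h t = of_int n" by simp
    then show "h t \<in> \<int>" by simp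
  next
    assume "h t \<in> \<int>"
    then obtain n :: int where n: "h t = of_int n" by (auto elim: Ints_cases)
    have "sin (2 * pi * h t) = 0" "cos (2 * pi * h t) = 1"
      unfolding n using sin_int_2pin cos_int_2pin by auto
    then have "Im (curve \<Gamma> e t) = 0" "0 < Re (curve \<Gamma> e t)" using Im_curve[of t] Re_curve[of t] t by auto
    moreover from this have "cmod (curve \<Gamma> e t) = Re (curve \<Gamma> e t)" by (simp add: cmod_eq_Re)
    ultimately show "curve \<Gamma> e t \<in> cut" using norm_curve[OF e, of t] t by (auto simp: cut_iff)
  qed
  \<comment> \<open>Near a crossing the sign of the imaginary part compares \<open>h s\<close> with
    the integer \<open>h t\<close>; this translates \<open>crosses_up\<close> and
    \<open>crosses_down\<close> into conditions on \<open>h\<close>.\<close>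
  have sign: "\<forall>\<^sub>F s in at t. (0 < Im (curve \<Gamma> e s) \<longleftrightarrow> h t < h s) \<and> (Im (curve \<Gamma> e s) < 0 \<longleftrightarrow> h s < h t)"
    if t: "t \<in> {0<..<1}" "h t \<in> \<int>" for t
  proof -
    have "isCont h t"
    proof (rule continuous_on_interior)
      show "continuous_on {0..1} h" by (rule conth)
      show "t \<in> interior {0..1}" using t by simp
    qed
    from eventually_sin_sign[OF this t(2)]
    have "\<forall>\<^sub>F s in at t. (0 < sin (2 * pi * h s) \<longleftrightarrow> h t < h s) \<and> (sin (2 * pi * h s) < 0 \<longleftrightarrow> h s < h t)" .
    moreover have "\<forall>\<^sub>F s in at t. s \<in> {0<..<1}"
      using t(1) by (intro eventually_at_in_open') auto
    ultimately show ?thesis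
    proof eventually_elim
      case (elim s)
      then have "s \<in> {0..1}" by auto
      from Im_curve[OF this] elim show ?case by (simp add: zero_less_mult_iff mult_less_0_iff)
    qed
  qed
  have split: "(\<forall>\<^sub>F s in at_left t. P s) \<and> (\<forall>\<^sub>F s in at_right t. Q s) \<longleftrightarrow> (\<forall>\<^sub>F s in at_left t. P' s) \<and> (\<forall>\<^sub>F s in at_right t. Q' s)"
    if "\<forall>\<^sub>F s in at t. (P s \<longleftrightarrow> P' s) \<and> (Q s \<longleftrightarrow> Q' s)" for t :: real and P Q P' Q'
  proof -
    have "\<forall>\<^sub>F s in at_left t. P s \<longleftrightarrow> P' s" "\<forall>\<^sub>F s in at_right t. Q s \<longleftrightarrow> Q' s"
      using that unfolding eventually_at_split by (auto elim: eventually_mono)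
    then show ?thesis using eventually_subst by blast
  qed
  have up: "{t \<in> {0<..<1}. crosses_up (curve \<Gamma> e) t} =
    {t \<in> {0<..<1}. h t \<in> \<int> \<and> (\<forall>\<^sub>F s in at_left t. h s < h t) \<and> (\<forall>\<^sub>F s in at_right t. h t < h s)}"
  proof -
    have "crosses_up (curve \<Gamma> e) t \<longleftrightarrow> h t \<in> \<int> \<and> (\<forall>\<^sub>F s in at_left t. h s < h t) \<and> (\<forall>\<^sub>F s in at_right t. h t < h s)"
      if t: "t \<in> {0<..<1}" for t
    proof (cases "h t \<in> \<int>")
      case True
      have "\<forall>\<^sub>F s in at t. (Im (curve \<Gamma> e s) < 0 \<longleftrightarrow> h s < h t) \<and> (0 < Im (curve \<Gamma> e s) \<longleftrightarrow> h t < h s)"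
        using sign[OF t True] by eventually_elim auto
      from split[OF this] show ?thesis using True in_cut[OF t] unfolding crosses_up_def by blast
    qed (use in_cut[OF t] in \<open>auto simp: crosses_up_def\<close>)
    then show ?thesis by blast
  qed
  have down: "{t \<in> {0<..<1}. crosses_down (curve \<Gamma> e) t} =
    {t \<in> {0<..<1}. h t \<in> \<int> \<and> (\<forall>\<^sub>F s in at_left t. h t < h s) \<and> (\<forall>\<^sub>F s in at_right t. h s < h t)}"
  proof -
    have "crosses_down (curve \<Gamma> e) t \<longleftrightarrow> h t \<in> \<int> \<and> (\<forall>\<^sub>F s in at_left t. h t < h s) \<and> (\<forall>\<^sub>F s in at_right t. h s < h t)"
      if t: "t \<in> {0<..<1}" for t
    proof (cases "h t \<in> \<int>")
      case True
      have "\<forall>\<^sub>F s in at t. (0 < Im (curve \<Gamma> e s) \<longleftrightarrow> h t < h s) \<and> (Im (curve \<Gamma> e s) < 0 \<longleftrightarrow> h s < h t)"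
        using sign[OF t True] by eventually_elim auto
      from split[OF this] show ?thesis using True in_cut[OF t] unfolding crosses_down_def by blast
    qed (use in_cut[OF t] in \<open>auto simp: crosses_down_def\<close>)
    then show ?thesis by blast
  qed
  have not_int: "x \<notin> \<int>" if "of_int k < x" "x < of_int k + 1" for x :: real and k
  proof
    assume "x \<in> \<int>"
    then obtain n :: int where "x = of_int n" by (auto elim: Ints_cases)
    with that have "k < n" "n < k + 1" by linarith+
    then show False by simp
  qed
  have "\<lfloor>h 1\<rfloor> - \<lfloor>h 0\<rfloor> = edge_crossings \<Gamma> e"
    unfolding edge_crossings_def up down
  proof (rule crossing_count[OF conth])
    show "h 0 \<notin> \<int>" "h 1 \<notin> \<int>" using not_int[of 0 "h 0"] not_int[OF h1] h0 by auto
    fix t assume t: "0 < t" "t < 1" "h t \<in> \<int>"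
    then have "curve \<Gamma> e t \<in> cut" using in_cut[of t] by simp
    from cut_transversal[OF e t(1,2) this]
    have "t \<in> {t \<in> {0<..<1}. crosses_up (curve \<Gamma> e) t} \<union> {t \<in> {0<..<1}. crosses_down (curve \<Gamma> e) t}"
      using t by auto
    then show "t \<in> {t \<in> {0<..<1}. h t \<in> \<int> \<and> (\<forall>\<^sub>F s in at_left t. h s < h t) \<and> (\<forall>\<^sub>F s in at_right t. h t < h s)} \<union>
      {t \<in> {0<..<1}. h t \<in> \<int> \<and> (\<forall>\<^sub>F s in at_left t. h t < h s) \<and> (\<forall>\<^sub>F s in at_right t. h s < h t)}"
      unfolding up down .
  qed
  moreover have "\<lfloor>h 0\<rfloor> = 0" using h0 by (intro floor_unique) auto
  moreover have "\<lfloor>h 1\<rfloor> = m" using h1 by (intro floor_unique) auto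
  ultimately have "m = edge_crossings \<Gamma> e" by simp
  then show ?thesis using cont expl l_0 m by blast
qed

definition arc_log :: "'e \<Rightarrow> real \<Rightarrow> complex" where
  "arc_log e = (SOME l. continuous_on {0..1} l \<and> (\<forall>t\<in>{0..1}. exp (l t) = curve \<Gamma> e t) \<and>
    l 0 = base_log (tail G e) \<and> l 1 = base_log (head G e) + 2 * pi * \<i> * of_int (edge_crossings \<Gamma> e))"

lemma arc_log:
  assumes "e \<in> arcs G"
  shows "continuous_on {0..1} (arc_log e)" "t \<in> {0..1} \<Longrightarrow> exp (arc_log e t) = curve \<Gamma> e t"
    "arc_log e 0 = base_log (tail G e)"
    "arc_log e 1 = base_log (head G e) + 2 * pi * \<i> * of_int (edge_crossings \<Gamma> e)"
  using someI_ex[OF arc_log_exists[OF assms], folded arc_log_def] by auto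

text \<open>Affine change of time by which an arc fills the interval between the heights of its
  ends, whatever walk it belongs to.\<close>

definition arc_time :: "'e \<Rightarrow> real \<Rightarrow> real" where
  "arc_time e \<tau> = (\<tau> - real (height (tail G e))) / (real (height (head G e)) - real (height (tail G e)))"

definition arc_span :: "'e \<Rightarrow> real set" where
  "arc_span e = {real (height (tail G e))..real (height (head G e))}"

lemma arc_time_range:
  fixes \<tau> :: real
  assumes "e \<in> arcs G" "\<tau> \<in> arc_span e"
  shows "arc_time e \<tau> \<in> {0..1}" "arc_time e \<tau> = 0 \<longleftrightarrow> \<tau> = height (tail G e)" "arc_time e \<tau> = 1 \<longleftrightarrow> \<tau> = height (head G e)"
    "\<tau> = height (tail G e) + arc_time e \<tau> * (real (height (head G e)) - real (height (tail G e)))"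
  using assms height_tail_less[OF assms(1)] by (auto simp: arc_time_def arc_span_def field_simps)

text \<open>The lift of the first arc is continued by the lift of the remaining walk, shifted by the
  number of sheets that the first arc climbs.\<close>

lemma walk_log_exists:
  assumes "awalk x p y"
  shows "\<exists>\<phi>. continuous_on {real (height x)..real (height y)} \<phi> \<and> \<phi> (height x) = base_log x \<and>
    \<phi> (height y) = base_log y + 2 * pi * \<i> * of_int (crossings \<Gamma> p) \<and>
    (\<forall>i<length p. \<forall>\<tau>\<in>arc_span (p ! i). \<phi> \<tau> = arc_log (p ! i) (arc_time (p ! i) \<tau>) + 2 * pi * \<i> * of_int (crossings \<Gamma> (take i p))) \<and>
    height x \<le> height y"
  using assms
proof (induction p arbitrary: x)
  case Nil
  then have "x = y" by (simp add: awalk_Nil_iff)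
  then show ?case by (intro exI[of _ "\<lambda>_. base_log x"]) (auto simp: crossings_def)
next
  case (Cons e p)
  have e: "e \<in> arcs G" "x = tail G e" and p: "awalk (head G e) p y" using Cons.prems by (auto simp: awalk_Cons_iff)
  obtain \<phi> where \<phi>: "continuous_on {real (height (head G e))..real (height y)} \<phi>" "\<phi> (height (head G e)) = base_log (head G e)"
    "\<phi> (height y) = base_log y + 2 * pi * \<i> * of_int (crossings \<Gamma> p)"
    "\<And>i \<tau>. i < length p \<Longrightarrow> \<tau> \<in> arc_span (p ! i) \<Longrightarrow> \<phi> \<tau> = arc_log (p ! i) (arc_time (p ! i) \<tau>) + 2 * pi * \<i> * of_int (crossings \<Gamma> (take i p))"
    "height (head G e) \<le> height y"
    using Cons.IH[OF p] by blast
  let ?c = "2 * pi * \<i> * of_int (edge_crossings \<Gamma> e)"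
  let ?h = "real (height (head G e))"
  have less: "height (tail G e) < height (head G e)" by (rule height_tail_less[OF e(1)])
  define \<psi> where "\<psi> \<tau> = (if \<tau> \<le> ?h then arc_log e (arc_time e \<tau>) else \<phi> \<tau> + ?c)" for \<tau>
  have at_h: "arc_log e (arc_time e ?h) = \<phi> ?h + ?c"
    using arc_time_range(3)[OF e(1), of ?h] less by (simp add: arc_span_def \<phi>(2) arc_log(4)[OF e(1)])
  have "continuous_on {real (height x)..real (height y)} \<psi>"
  proof -
    have "continuous_on (arc_span e) (\<lambda>\<tau>. arc_log e (arc_time e \<tau>))"
      by (rule continuous_on_compose2[OF arc_log(1)[OF e(1)]])
        (use arc_time_range(1)[OF e(1)] less in \<open>auto intro!: continuous_intros simp: arc_time_def\<close>)
    moreover have "continuous_on {?h..real (height y)} (\<lambda>\<tau>. \<phi> \<tau> + ?c)" by (intro continuous_intros \<phi>(1))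
    ultimately have "continuous_on (arc_span e \<union> {?h..real (height y)}) \<psi>"
      unfolding \<psi>_def
      by (intro continuous_on_cases) (use at_h in \<open>auto simp: arc_span_def\<close>)
    moreover have "arc_span e \<union> {?h..real (height y)} = {real (height x)..real (height y)}"
      using less \<phi>(5) e(2) by (auto simp: arc_span_def)
    ultimately show ?thesis by simp
  qed
  moreover have "\<psi> (height x) = base_log x"
    using arc_time_range(2)[OF e(1), of "height x"] less arc_log(3)[OF e(1)] e(2) by (simp add: \<psi>_def arc_span_def)
  moreover have after: "\<psi> \<tau> = \<phi> \<tau> + ?c" if "?h \<le> \<tau>" for \<tau>
    using at_h that by (cases "\<tau> = ?h") (auto simp: \<psi>_def)
  have "\<psi> (height y) = base_log y + 2 * pi * \<i> * of_int (crossings \<Gamma> (e # p))"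
    using after[of "height y"] \<phi>(3,5) by (simp add: crossings_def algebra_simps)
  moreover have "\<psi> \<tau> = arc_log ((e # p) ! i) (arc_time ((e # p) ! i) \<tau>) + 2 * pi * \<i> * of_int (crossings \<Gamma> (take i (e # p)))"
    if i: "i < length (e # p)" and \<tau>: "\<tau> \<in> arc_span ((e # p) ! i)" for i \<tau>
  proof (cases i)
    case 0
    then show ?thesis using \<tau> by (auto simp: \<psi>_def arc_span_def crossings_def)
  next
    case (Suc k)
    have "awalk (head G e) (take k p @ drop k p) y" using p by simp
    then have w: "awalk (head G e) (take k p) (awlast (head G e) (take k p))"
      and d: "awalk (awlast (head G e) (take k p)) (drop k p) y" by (simp_all only: awalk_append_iff)
    have "tail G (p ! k) = awlast (head G e) (take k p)"
      using d i Suc Cons_nth_drop_Suc[of k p] by (metis Suc_less_eq awalk_Cons_iff length_Cons)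
    moreover have "height (head G e) \<le> height (awlast (head G e) (take k p))"
    proof -
      have mono: "height a \<le> height b" if "awalk a q b" for a q b
        using that
      proof (induction q arbitrary: a)
        case (Cons f q)
        then show ?case using height_tail_less[of f] by (fastforce simp: awalk_Cons_iff)
      qed (simp add: awalk_Nil_iff)
      show ?thesis by (rule mono[OF w])
    qed
    ultimately have "?h \<le> \<tau>" using \<tau> Suc by (simp add: arc_span_def)
    then show ?thesis using after \<phi>(4)[of k \<tau>] i \<tau> Suc by (simp add: crossings_def algebra_simps)
  qed
  moreover have "height x \<le> height y" using less \<phi>(5) e(2) by simp
  ultimately show ?case by blast
qed

text \<open>Here the embedding enters: interiors of edges avoid each other and the vertices, and
  vertices have distinct positions.\<close>

lemma curve_meet:
  assumes e: "e \<in> arcs G" "x \<in> {0..1}" and f: "f \<in> arcs G" "y \<in> {0..1}" and eq: "curve \<Gamma> e x = curve \<Gamma> f y"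
  obtains "e = f" "x = y" "0 < x" "x < 1"
  | "x = 0" "y = 0" "tail G e = tail G f" | "x = 0" "y = 1" "tail G e = head G f"
  | "x = 1" "y = 0" "head G e = tail G f" | "x = 1" "y = 1" "head G e = head G f"
proof -
  have vs: "tail G e \<in> verts G" "head G e \<in> verts G" "tail G f \<in> verts G" "head G f \<in> verts G" using e f by auto
  note ends = curve_ends[OF e(1)] curve_ends[OF f(1)]
  have inj: "v = w" if "point \<Gamma> v = point \<Gamma> w" "v \<in> verts G" "w \<in> verts G" for v w
    using inj_point that by (auto dest: inj_onD)
  consider "0 < x" "x < 1" "0 < y" "y < 1" | "0 < x" "x < 1" "y = 0 \<or> y = 1" | "x = 0 \<or> x = 1" "0 < y" "y < 1"
    | "x = 0 \<or> x = 1" "y = 0 \<or> y = 1" using e(2) f(2) by fastforce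
  then show thesis
  proof cases
    case 1
    then have "e = f" using curves_disjoint[OF e(1) f(1)] eq by blast
    moreover have "x = y"
    proof -
      have "x = y \<or> x = 0 \<and> y = 1 \<or> x = 1 \<and> y = 0"
        using curve_simple[OF e(1)] eq e(2) f(2) \<open>e = f\<close> unfolding simple_path_def loop_free_def by blast
      then show ?thesis using 1 by auto
    qed
    ultimately show thesis using 1 that(1) by blast
  next
    case 2
    then show thesis using curve_avoids_verts[OF e(1), of x] eq ends vs by metis
  next
    case 3
    then show thesis using curve_avoids_verts[OF f(1), of y] eq ends vs by metis
  next
    case 4
    then show thesis using that inj vs eq ends by metis
  qed
qed

end

lemma continuous_log_exists:
  fixes h :: "'a::real_normed_vector \<Rightarrow> complex"
  assumes "continuous_on S h" "contractible S" "\<And>z. z \<in> S \<Longrightarrow> h z \<noteq> 0"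
  shows "\<exists>L. continuous_on S L \<and> (\<forall>z\<in>S. exp (L z) = h z)"
proof (rule continuous_logarithm_on_contractible[OF assms])
  fix L assume "continuous_on S L" "\<And>z. z \<in> S \<Longrightarrow> h z = exp (L z)"
  then show ?thesis by (intro exI[of _ L]) simp
qed

section \<open>Position of a walk at a given time, and signs of pairs of edges\<close>

context acyclic_cylinder begin

lemma walk_step: "awalk x p y \<Longrightarrow> Suc i < length p \<Longrightarrow> head G (p ! i) = tail G (p ! Suc i)"
proof (induction p arbitrary: x i)
  case (Cons e p)
  then show ?case by (cases i; cases p) (auto simp: awalk_Cons_iff)
qed simp

lemma walk_first: "awalk x p y \<Longrightarrow> p \<noteq> [] \<Longrightarrow> tail G (p ! 0) = x"
  by (cases p) (auto simp: awalk_Cons_iff)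

lemma walk_last: "awalk x p y \<Longrightarrow> p \<noteq> [] \<Longrightarrow> head G (p ! (length p - 1)) = y"
proof (induction p arbitrary: x)
  case (Cons e p)
  then show ?case by (cases p) (auto simp: awalk_Cons_iff awalk_Nil_iff)
qed simp

lemma walk_arc: "awalk x p y \<Longrightarrow> i < length p \<Longrightarrow> p ! i \<in> arcs G"
  using nth_mem by (fastforce simp: awalk_def)

lemma walk_ordered:
  assumes "awalk x p y" "i < k" "k < length p"
  shows "height (head G (p ! i)) \<le> height (tail G (p ! k))"
  using assms(2,3)
proof (induction k)
  case (Suc k)
  show ?case
  proof (cases "i = k")
    case True
    then show ?thesis using walk_step[OF assms(1) Suc.prems(2)] by simp
  next
    case False
    then have "height (head G (p ! i)) \<le> height (tail G (p ! k))" using Suc by simp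
    also have "\<dots> \<le> height (head G (p ! k))"
      using height_tail_less[OF walk_arc[OF assms(1)], of k] Suc.prems(2) by simp
    finally show ?thesis using walk_step[OF assms(1) Suc.prems(2)] by simp
  qed
qed simp

lemma walk_unit_interval:
  assumes "awalk x p y" "height x \<le> j" "j < height y"
  shows "\<exists>i<length p. height (tail G (p ! i)) \<le> j \<and> j < height (head G (p ! i))"
  using assms
proof (induction p arbitrary: x)
  case (Cons e p)
  show ?case
  proof (cases "j < height (head G e)")
    case True
    then show ?thesis using Cons.prems by (intro exI[of _ 0]) (auto simp: awalk_Cons_iff)
  next
    case False
    moreover have "awalk (head G e) p y" using Cons.prems(1) by (simp add: awalk_Cons_iff)
    ultimately obtain i where "i < length p" "height (tail G (p ! i)) \<le> j" "j < height (head G (p ! i))"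
      using Cons.IH[of "head G e"] Cons.prems(3) by auto
    then show ?thesis by (intro exI[of _ "Suc i"]) auto
  qed
qed (auto simp: awalk_Nil_iff)

lemma walk_span:
  fixes \<tau> :: real
  assumes "awalk x p y" "p \<noteq> []" "height x \<le> \<tau>" "\<tau> \<le> height y"
  shows "\<exists>i<length p. \<tau> \<in> arc_span (p ! i)"
  using assms
proof (induction p arbitrary: x)
  case (Cons e p)
  show ?case
  proof (cases "\<tau> \<le> height (head G e)")
    case True
    then show ?thesis using Cons.prems by (intro exI[of _ 0]) (auto simp: awalk_Cons_iff arc_span_def)
  next
    case False
    have p: "awalk (head G e) p y" using Cons.prems(1) by (simp add: awalk_Cons_iff)
    moreover have "p \<noteq> []"
    proof
      assume "p = []"
      with p False Cons.prems(4) show False by (simp add: awalk_Nil_iff)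
    qed
    ultimately obtain i where "i < length p" "\<tau> \<in> arc_span (p ! i)"
      using Cons.IH[of "head G e"] Cons.prems(4) False by auto
    then show ?thesis by (intro exI[of _ "Suc i"]) auto
  qed
qed simp

text \<open>The properties provided by \<open>walk_log_exists\<close>; the quantified one records on
  which sheet each arc of the walk runs.\<close>

definition is_walk_log :: "'v \<Rightarrow> 'e list \<Rightarrow> 'v \<Rightarrow> (real \<Rightarrow> complex) \<Rightarrow> bool" where
  "is_walk_log x p y \<phi> \<longleftrightarrow> continuous_on {real (height x)..real (height y)} \<phi> \<and> \<phi> (height x) = base_log x \<and>
    \<phi> (height y) = base_log y + 2 * pi * \<i> * of_int (crossings \<Gamma> p) \<and>
    (\<forall>i<length p. \<forall>\<tau>\<in>arc_span (p ! i). \<phi> \<tau> = arc_log (p ! i) (arc_time (p ! i) \<tau>) + 2 * pi * \<i> * of_int (crossings \<Gamma> (take i p))) \<and>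
    height x \<le> height y"

lemma exp_walk_log:
  assumes "awalk x p y" "is_walk_log x p y \<phi>" "i < length p" "\<tau> \<in> arc_span (p ! i)"
  shows "exp (\<phi> \<tau>) = curve \<Gamma> (p ! i) (arc_time (p ! i) \<tau>)"
proof -
  have e: "p ! i \<in> arcs G" using walk_arc assms by blast
  have "exp (2 * pi * \<i> * of_int k) = 1" for k :: int
    using exp_integer_2pi[of "of_int k"] by (simp add: mult.commute mult.left_commute)
  then show ?thesis
    using assms arc_log(2)[OF e arc_time_range(1)[OF e assms(4)]] by (auto simp: is_walk_log_def exp_add)
qed

text \<open>The pair takes the places x1, x2 at a white vertex, with the incoming edge as x3;
  \<open>merge_turn\<close> does the same with y1, y2 at a black vertex.\<close>

definition split_turn :: "'e \<Rightarrow> 'e \<Rightarrow> bool" where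
  "split_turn e f \<longleftrightarrow> white \<Gamma> (tail G e) \<and> tail G f = tail G e \<and>
    (\<exists>g\<in>in_arcs G (tail G e). ccw_at \<Gamma> (tail G e) e f g)"

definition merge_turn :: "'e \<Rightarrow> 'e \<Rightarrow> bool" where
  "merge_turn e f \<longleftrightarrow> black \<Gamma> (head G e) \<and> head G f = head G e \<and>
    (\<exists>g\<in>out_arcs G (head G e). ccw_at \<Gamma> (head G e) e f g)"

text \<open>Half of it is the coefficient with which a white vertex enters
  \<open>edge_bracket\<close>; for a black vertex it is minus half of
  \<open>merge_sign\<close>.\<close>

definition split_sign :: "'e \<Rightarrow> 'e \<Rightarrow> int" where
  "split_sign e f = of_bool (split_turn e f) - of_bool (split_turn f e)"

definition merge_sign :: "'e \<Rightarrow> 'e \<Rightarrow> int" where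
  "merge_sign e f = of_bool (merge_turn e f) - of_bool (merge_turn f e)"

lemma ccw_at_iff: "ccw_at \<Gamma> v e f g \<longleftrightarrow> (\<forall>\<^sub>F r in at_right 0. ccw_triple
   (first_exit (half_edge \<Gamma> v e) r - point \<Gamma> v) (first_exit (half_edge \<Gamma> v f) r - point \<Gamma> v)
   (first_exit (half_edge \<Gamma> v g) r - point \<Gamma> v))"
  by (simp add: ccw_at_def ccw_triple_def Let_def)

text \<open>The first order puts w behind v and before the return to u; the second demands that u
  comes before w when starting from v.\<close>

lemma ccw_triple_asym:
  assumes "ccw_triple u v w" shows "\<not> ccw_triple v u w"
proof
  assume "ccw_triple v u w"
  with assms have a: "0 < Arg2pi (v / u)" "Arg2pi (v / u) < Arg2pi (w / u)"
    and b: "0 < Arg2pi (u / v)" "Arg2pi (u / v) < Arg2pi (w / v)" by (auto simp: ccw_triple_def)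
  have nz: "u \<noteq> 0" "v \<noteq> 0" "w \<noteq> 0" using a b by auto
  have "w / v = (w / u) / (v / u)" using nz by auto
  then have "Arg2pi (w / v) = Arg2pi (w / u) - Arg2pi (v / u)"
    using a nz by (simp add: Arg2pi_divide del: divide_divide_eq_left divide_divide_eq_right)
  moreover have "Arg2pi (u / v) = 2 * pi - Arg2pi (v / u)"
  proof (cases "v / u \<in> \<real>")
    case True
    then have "Arg2pi (v / u) = pi" using a(1) by (auto simp: Arg2pi_real split: if_splits)
    then show ?thesis using Arg2pi_inverse[of "v / u"] True by simp
  qed (use Arg2pi_inverse[of "v / u"] in simp)
  ultimately show False using b Arg2pi[of "w / u"] by linarith
qed

lemma ccw_at_asym: "ccw_at \<Gamma> v e f g \<Longrightarrow> \<not> ccw_at \<Gamma> v f e g"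
proof
  assume "ccw_at \<Gamma> v e f g" "ccw_at \<Gamma> v f e g"
  then have "\<forall>\<^sub>F r in at_right (0::real). False"
    unfolding ccw_at_iff by eventually_elim (use ccw_triple_asym in blast)
  then show False by simp
qed

lemma same_sign [simp]: "split_sign e e = 0" "merge_sign e e = 0"
  by (simp_all add: split_sign_def merge_sign_def)

end

section \<open>Two walks lifted to a pair of strands\<close>

text \<open>A pair of positions at which the walks share a vertex is a meeting of the strands for
  exactly one translation \<open>n\<close>.\<close>

locale strands = acyclic_cylinder \<Gamma> for \<Gamma> :: "('v, 'e) cyl_network" +
  fixes u w :: "'e list" and x y x' y' :: 'v and n :: int and \<phi> \<psi> :: "real \<Rightarrow> complex"
  assumes u: "awalk x u y" "x \<in> sources \<Gamma>" "y \<in> sinks \<Gamma>"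
    and w: "awalk x' w y'" "x' \<in> sources \<Gamma>" "y' \<in> sinks \<Gamma>"
    and \<phi>: "is_walk_log x u y \<phi>" and \<psi>: "is_walk_log x' w y' \<psi>"
begin

abbreviation "M \<equiv> card (verts G)"
abbreviation "f \<equiv> \<phi>"
definition "g \<tau> = \<psi> \<tau> + 2 * pi * \<i> * of_int n"
abbreviation "U a \<equiv> crossings \<Gamma> (take a u)"
abbreviation "W b \<equiv> crossings \<Gamma> (take b w)"

lemma nonempty: "u \<noteq> []" "w \<noteq> []"
  using u w sources_sinks_disjoint by (auto simp: awalk_Nil_iff)

lemma heights: "height x = 0" "height x' = 0" "height y = M" "height y' = M"
  using u w height_source height_sink by auto

lemma M_pos: "0 < M"
  using u(1) by (auto simp: card_gt_0_iff)

lemma unit_interval: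
  assumes "j < M"
  obtains a b where "a < length u" "b < length w" "height (tail G (u ! a)) \<le> j" "j < height (head G (u ! a))"
    "height (tail G (w ! b)) \<le> j" "j < height (head G (w ! b))"
    "{real j..real j + 1} \<subseteq> arc_span (u ! a)" "{real j..real j + 1} \<subseteq> arc_span (w ! b)"
proof -
  obtain a where a: "a < length u" "height (tail G (u ! a)) \<le> j" "j < height (head G (u ! a))"
    using walk_unit_interval[OF u(1), of j] assms heights by auto
  obtain b where b: "b < length w" "height (tail G (w ! b)) \<le> j" "j < height (head G (w ! b))"
    using walk_unit_interval[OF w(1), of j] assms heights by auto
  have "{real j..real j + 1} \<subseteq> arc_span (u ! a)" "{real j..real j + 1} \<subseteq> arc_span (w ! b)"
    using a b by (auto simp: arc_span_def)
  from that[OF a(1) b(1) a(2,3) b(2,3) this] show thesis .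
qed

lemma time_in_span:
  assumes "\<tau> \<in> {0..real M}"
  obtains a b where "a < length u" "b < length w" "\<tau> \<in> arc_span (u ! a)" "\<tau> \<in> arc_span (w ! b)"
proof -
  have "\<exists>a<length u. \<tau> \<in> arc_span (u ! a)"
    by (rule walk_span[OF u(1) nonempty(1)]) (use assms heights in simp_all)
  then obtain a where a: "a < length u" "\<tau> \<in> arc_span (u ! a)" by blast
  have "\<exists>b<length w. \<tau> \<in> arc_span (w ! b)"
    by (rule walk_span[OF w(1) nonempty(2)]) (use assms heights in simp_all)
  then obtain b where b: "b < length w" "\<tau> \<in> arc_span (w ! b)" by blast
  from that[OF a(1) b(1) a(2) b(2)] show thesis .
qed

lemma log_eqs:
  assumes "a < length u" "\<tau> \<in> arc_span (u ! a)"
  shows "f \<tau> = arc_log (u ! a) (arc_time (u ! a) \<tau>) + 2 * pi * \<i> * of_int (U a)"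
    "exp (f \<tau>) = curve \<Gamma> (u ! a) (arc_time (u ! a) \<tau>)"
  using \<phi> assms exp_walk_log[OF u(1) \<phi>] unfolding is_walk_log_def by blast+

lemma log_eqs':
  assumes "b < length w" "\<tau> \<in> arc_span (w ! b)"
  shows "g \<tau> = arc_log (w ! b) (arc_time (w ! b) \<tau>) + 2 * pi * \<i> * of_int (W b + n)"
    "exp (g \<tau>) = curve \<Gamma> (w ! b) (arc_time (w ! b) \<tau>)"
proof -
  show "g \<tau> = arc_log (w ! b) (arc_time (w ! b) \<tau>) + 2 * pi * \<i> * of_int (W b + n)"
  proof -
    have "\<psi> \<tau> = arc_log (w ! b) (arc_time (w ! b) \<tau>) + 2 * pi * \<i> * of_int (W b)"
      using \<psi> assms unfolding is_walk_log_def by blast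
    then show ?thesis by (simp add: g_def algebra_simps)
  qed
  have "exp (2 * pi * \<i> * of_int n) = 1"
    using exp_integer_2pi[of "of_int n"] by (simp add: mult.commute mult.left_commute)
  then show "exp (g \<tau>) = curve \<Gamma> (w ! b) (arc_time (w ! b) \<tau>)"
    using exp_walk_log[OF w(1) \<psi> assms] by (simp add: g_def exp_add)
qed

lemma arcs_uw: "a < length u \<Longrightarrow> u ! a \<in> arcs G" "b < length w \<Longrightarrow> w ! b \<in> arcs G"
  using walk_arc u w by auto

lemma meet_cases:
  fixes s t :: real
  assumes a: "a < length u" "s \<in> arc_span (u ! a)" and b: "b < length w" "t \<in> arc_span (w ! b)" and eq: "f s = g t"
  obtains "u ! a = w ! b" "s = t" "height (tail G (u ! a)) < s" "s < height (head G (u ! a))"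
  | "s = height (tail G (u ! a))" "t = height (tail G (w ! b))" "tail G (u ! a) = tail G (w ! b)"
  | "s = height (tail G (u ! a))" "t = height (head G (w ! b))" "tail G (u ! a) = head G (w ! b)"
  | "s = height (head G (u ! a))" "t = height (tail G (w ! b))" "head G (u ! a) = tail G (w ! b)"
  | "s = height (head G (u ! a))" "t = height (head G (w ! b))" "head G (u ! a) = head G (w ! b)"
proof -
  note ra = arc_time_range[OF arcs_uw(1)[OF a(1)] a(2)] and rb = arc_time_range[OF arcs_uw(2)[OF b(1)] b(2)]
  have "curve \<Gamma> (u ! a) (arc_time (u ! a) s) = curve \<Gamma> (w ! b) (arc_time (w ! b) t)"
    using log_eqs(2)[OF a] log_eqs'(2)[OF b] eq by simp
  from curve_meet[OF arcs_uw(1)[OF a(1)] ra(1) arcs_uw(2)[OF b(1)] rb(1) this]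
  show thesis
  proof cases
    case 1
    have "s = t" using ra(4) rb(4) 1(1,2) by simp
    moreover have "height (tail G (u ! a)) < s" "s < height (head G (u ! a))"
      using 1(3,4) ra(2,3) a(2) unfolding arc_span_def by (auto simp: less_le)
    ultimately show thesis using 1(1) that(1) by blast
  next
    case 2
    then show thesis using ra(2) rb(2) by (intro that(2)) simp_all
  next
    case 3
    then show thesis using ra(2) rb(3) by (intro that(3)) simp_all
  next
    case 4
    then show thesis using ra(3) rb(2) by (intro that(4)) simp_all
  next
    case 5
    then show thesis using ra(3) rb(3) by (intro that(5)) simp_all
  qed
qed

text \<open>A vertex fixes its time by its height, and an arc is run through in the same way by both
  walks, so a point of the network is passed at one time only.\<close>

lemma off_diagonal_strands:
  assumes "s \<in> {0..real M}" "t \<in> {0..real M}" "s \<noteq> t"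
  shows "g t \<noteq> f s"
proof
  assume eq: "g t = f s"
  obtain a where a: "a < length u" "s \<in> arc_span (u ! a)" using time_in_span[OF assms(1)] by metis
  obtain b where b: "b < length w" "t \<in> arc_span (w ! b)" using time_in_span[OF assms(2)] by metis
  from meet_cases[OF a b eq[symmetric]] show False using assms(3) by cases auto
qed

lemma continuous_strands: "continuous_on {0..real M} f" "continuous_on {0..real M} g"
  using \<phi> \<psi> heights unfolding g_def by (auto simp: is_walk_log_def intro!: continuous_intros)

lemma level_eq: "2 * pi * \<i> * of_int k = 2 * pi * \<i> * of_int l \<longleftrightarrow> k = l" for k l :: int
  by simp

lemma meet_inside:
  fixes \<tau> :: real
  assumes a: "a < length u" "\<tau> \<in> arc_span (u ! a)" and b: "b < length w" "\<tau> \<in> arc_span (w ! b)" and eq: "f \<tau> = g \<tau>"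
    and inside: "height (tail G (u ! a)) < \<tau>" "\<tau> < height (head G (u ! a))"
  shows "u ! a = w ! b" "U a = W b + n"
proof -
  from meet_cases[OF a b eq] show e: "u ! a = w ! b" using inside by cases auto
  have "2 * pi * \<i> * of_int (U a) = 2 * pi * \<i> * of_int (W b + n)"
    using log_eqs(1)[OF a] log_eqs'(1)[OF b] eq unfolding e by (simp only: add_left_cancel)
  then show "U a = W b + n" unfolding level_eq .
qed

lemma common_on_arc:
  assumes "a < length u" "b < length w" "u ! a = w ! b" "U a = W b + n" "\<tau> \<in> arc_span (u ! a)"
  shows "f \<tau> = g \<tau>"
  using log_eqs(1)[OF assms(1,5)] log_eqs'(1)[OF assms(2), of \<tau>] assms(3-5) by simp

text \<open>The triangle is convex, hence contractible, and the chords do not vanish on it.\<close>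

lemma logs_exist:
  "\<exists>A B. strand_pair (real M) f g A B"
proof -
  let ?T = "{(s, t). 0 \<le> s \<and> s < t \<and> t \<le> real M}"
  have T: "?T = ({0..} \<times> {..real M}) \<inter> {x. inner (1, -1) x < 0}"
    by (auto simp: inner_prod_def)
  have cv: "contractible ?T"
    unfolding T by (intro convex_imp_contractible convex_Int convex_Times convex_halfspace_lt) auto
  have c: "continuous_on ?T (\<lambda>x. f (fst x))" "continuous_on ?T (\<lambda>x. f (snd x))"
    "continuous_on ?T (\<lambda>x. g (fst x))" "continuous_on ?T (\<lambda>x. g (snd x))"
    by (auto intro!: continuous_on_compose2[OF continuous_strands(1)] continuous_on_compose2[OF continuous_strands(2)] continuous_intros)
  have "g (snd z) - f (fst z) \<noteq> 0" "f (snd z) - g (fst z) \<noteq> 0" if "z \<in> ?T" for z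
    using that off_diagonal_strands[of "fst z" "snd z"] off_diagonal_strands[of "snd z" "fst z"] by auto
  note nz = this
  have "\<exists>A. continuous_on ?T A \<and> (\<forall>z\<in>?T. exp (A z) = g (snd z) - f (fst z))"
    by (rule continuous_log_exists[OF continuous_on_diff[OF c(4,1)] cv]) (rule nz)
  then obtain A where A: "continuous_on ?T A" "\<forall>z\<in>?T. exp (A z) = g (snd z) - f (fst z)" by (elim exE conjE)
  have "\<exists>B. continuous_on ?T B \<and> (\<forall>z\<in>?T. exp (B z) = f (snd z) - g (fst z))"
    by (rule continuous_log_exists[OF continuous_on_diff[OF c(2,3)] cv]) (rule nz)
  then obtain B where B: "continuous_on ?T B" "\<forall>z\<in>?T. exp (B z) = f (snd z) - g (fst z)" by (elim exE conjE)
  have "strand_pair (real M) f g A B"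
  proof
    show "exp (A (s, t)) = g t - f s" "exp (B (s, t)) = f t - g s" if "0 \<le> s" "s < t" "t \<le> real M" for s t
      using bspec[OF A(2), of "(s, t)"] bspec[OF B(2), of "(s, t)"] that by auto
  qed (use A(1) B(1) M_pos continuous_strands off_diagonal_strands in auto)
  then show ?thesis by blast
qed

text \<open>Heights are integers, so each walk follows a single arc during a unit of time. The
  strands coincide if it is the same arc on the same sheet and are otherwise apart.\<close>

lemma interval_cases:
  assumes "j < M"
  shows "(\<forall>\<tau>\<in>{real j..real j + 1}. f \<tau> = g \<tau>) \<or> (\<forall>\<tau>\<in>{real j<..<real j + 1}. f \<tau> \<noteq> g \<tau>)"
proof -
  obtain a b where ab: "a < length u" "b < length w" "height (tail G (u ! a)) \<le> j" "j < height (head G (u ! a))"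
    "height (tail G (w ! b)) \<le> j" "j < height (head G (w ! b))"
    "{real j..real j + 1} \<subseteq> arc_span (u ! a)" "{real j..real j + 1} \<subseteq> arc_span (w ! b)"
    using unit_interval[OF assms] by blast
  show ?thesis
  proof (cases "u ! a = w ! b \<and> U a = W b + n")
    case True
    then show ?thesis using common_on_arc[OF ab(1,2)] ab(7) by blast
  next
    case False
    have "f \<tau> \<noteq> g \<tau>" if \<tau>: "\<tau> \<in> {real j<..<real j + 1}" for \<tau>
    proof
      assume eq: "f \<tau> = g \<tau>"
      have "\<tau> \<in> {real j..real j + 1}" using \<tau> by auto
      then have s: "\<tau> \<in> arc_span (u ! a)" "\<tau> \<in> arc_span (w ! b)" using ab(7,8) by auto
      have "height (tail G (u ! a)) < \<tau>" "\<tau> < height (head G (u ! a))" using ab(3,4) \<tau> by auto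
      from meet_inside[OF ab(1) s(1) ab(2) s(2) eq this] show False using False by blast
    qed
    then show ?thesis by blast
  qed
qed

text \<open>Positions count the arc that leaves the vertex, so the arcs numbered a - 1 and b - 1
  arrive there. Vertices that the strands pass together are included; their sign is zero.\<close>

definition meeting_points :: "(nat \<times> nat) set" where
  "meeting_points = {(a, b). 0 < a \<and> a < length u \<and> 0 < b \<and> b < length w \<and> tail G (u ! a) = tail G (w ! b) \<and> U a = W b + n}"

definition meeting_time :: "nat \<times> nat \<Rightarrow> nat" where
  "meeting_time = (\<lambda>(a, b). height (tail G (u ! a)))"

lemma crossings_take_Suc: "a < length p \<Longrightarrow> crossings \<Gamma> (take (Suc a) p) = crossings \<Gamma> (take a p) + edge_crossings \<Gamma> (p ! a)"
  by (simp add: take_Suc_conv_app_nth crossings_def)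

lemma tail_internal:
  assumes "awalk s p t" "t \<in> sinks \<Gamma>" "0 < a" "a < length p"
  shows "tail G (p ! a) \<in> internal \<Gamma>" "head G (p ! (a - 1)) = tail G (p ! a)"
proof -
  show "head G (p ! (a - 1)) = tail G (p ! a)" using walk_step[OF assms(1), of "a - 1"] assms by simp
  then have "tail G (p ! a) \<notin> sources \<Gamma>"
    using head_not_source[OF walk_arc[OF assms(1), of "a - 1"]] assms by auto
  moreover have "tail G (p ! a) \<notin> sinks \<Gamma>" "tail G (p ! a) \<in> verts G"
    using tail_not_sink walk_arc[OF assms(1,4)] by auto
  ultimately show "tail G (p ! a) \<in> internal \<Gamma>" by (simp add: internal_def)
qed

lemma meeting_pointD:
  assumes "(a, b) \<in> meeting_points"
  shows "0 < a" "a < length u" "0 < b" "b < length w" "tail G (u ! a) = tail G (w ! b)" "U a = W b + n"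
    "head G (u ! (a - 1)) = tail G (u ! a)" "head G (w ! (b - 1)) = tail G (u ! a)"
    "tail G (u ! a) \<in> internal \<Gamma>" "0 < meeting_time (a, b)" "meeting_time (a, b) < M"
proof -
  show m: "0 < a" "a < length u" "0 < b" "b < length w" "tail G (u ! a) = tail G (w ! b)" "U a = W b + n"
    using assms by (auto simp: meeting_points_def)
  show "head G (u ! (a - 1)) = tail G (u ! a)" using tail_internal(2)[OF u(1,3) m(1,2)] .
  show "head G (w ! (b - 1)) = tail G (u ! a)" using tail_internal(2)[OF w(1,3) m(3,4)] m(5) by simp
  show i: "tail G (u ! a) \<in> internal \<Gamma>" using tail_internal(1)[OF u(1,3) m(1,2)] .
  show "0 < meeting_time (a, b)" "meeting_time (a, b) < M"
    using height_internal[OF i] by (auto simp: meeting_time_def)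
qed

lemma position_unique:
  assumes "awalk s p t" "a < length p" "b < length p" "height (tail G (p ! a)) = height (tail G (p ! b))"
  shows "a = b"
proof -
  have "False" if "i < k" "k < length p" "height (tail G (p ! i)) = height (tail G (p ! k))" for i k
    using walk_ordered[OF assms(1) that(1,2)] height_tail_less[OF walk_arc[OF assms(1), of i]] that by simp
  then show ?thesis using assms by (metis linorder_neqE_nat)
qed

lemma inj_meeting_time: "inj_on meeting_time meeting_points"
proof (rule inj_onI, clarify)
  fix a b c d assume ab: "(a, b) \<in> meeting_points" and cd: "(c, d) \<in> meeting_points"
    and eq: "meeting_time (a, b) = meeting_time (c, d)"
  then show "a = c \<and> b = d"
    using meeting_pointD[OF ab] meeting_pointD[OF cd] position_unique[OF u(1), of a c] position_unique[OF w(1), of b d]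
    by (auto simp: meeting_time_def)
qed

end

section \<open>Half-edges and signs at a trivalent vertex\<close>

context acyclic_cylinder begin

text \<open>Relates \<open>half_edge\<close>, parametrised by [0, 1], to time measured from the
  vertex, the form expected by \<open>total_turn_orientation\<close>.\<close>

lemma half_edge_out:
  assumes "e \<in> arcs G" "tail G e = v" "0 \<le> s" "s \<le> 1"
  shows "half_edge \<Gamma> v e (s / (real (height (head G e)) - real (height (tail G e)))) =
    curve \<Gamma> e (arc_time e (real (height v) + s))"
  using assms by (simp add: half_edge_def arc_time_def)

lemma half_edge_in:
  assumes "e \<in> arcs G" "head G e = v" "0 \<le> s" "s \<le> 1"
  shows "half_edge \<Gamma> v e (s / (real (height (head G e)) - real (height (tail G e)))) =
    curve \<Gamma> e (arc_time e (real (height v) - s))"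
proof -
  have "tail G e \<noteq> v" using no_loop assms by auto
  moreover have "real (height (head G e)) - real (height (tail G e)) \<noteq> 0"
    using height_tail_less[OF assms(1)] by simp
  then have "arc_time e (real (height v) - s) = 1 - s / (real (height (head G e)) - real (height (tail G e)))"
    using assms(2) by (simp add: arc_time_def divide_simps)
  ultimately show ?thesis by (simp add: half_edge_def reversepath_def)
qed

lemma continuous_half_edge: "e \<in> arcs G \<Longrightarrow> continuous_on {0..1} (half_edge \<Gamma> v e)"
  using curve_simple[of e] simple_path_imp_path path_reversepath unfolding half_edge_def by (auto simp flip: path_def)

lemma arc_span_length: "e \<in> arcs G \<Longrightarrow> 1 \<le> real (height (head G e)) - real (height (tail G e))"
  using height_tail_less[of e] by simp

lemma merge_sign_eqs:
  assumes "black \<Gamma> v" "head G e = v" "head G f = v" "out_arcs G v = {g}"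
  shows "ccw_at \<Gamma> v e f g \<Longrightarrow> merge_sign e f = 1" "ccw_at \<Gamma> v f e g \<Longrightarrow> merge_sign e f = -1"
  using assms ccw_at_asym[of v e f g] ccw_at_asym[of v f e g] by (auto simp: merge_sign_def merge_turn_def)

lemma split_sign_eqs:
  assumes "white \<Gamma> v" "tail G e = v" "tail G f = v" "in_arcs G v = {g}"
  shows "ccw_at \<Gamma> v e f g \<Longrightarrow> split_sign e f = 1" "ccw_at \<Gamma> v f e g \<Longrightarrow> split_sign e f = -1"
  using assms ccw_at_asym[of v e f g] ccw_at_asym[of v f e g] by (auto simp: split_sign_def split_turn_def)

text \<open>Three edges leave no room for two walks to merge and to separate at the same
  vertex.\<close>

lemma trivalent_cases:
  assumes "v \<in> internal \<Gamma>" "e \<in> arcs G" "e' \<in> arcs G" "f \<in> arcs G" "f' \<in> arcs G"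
    "head G e = v" "head G e' = v" "tail G f = v" "tail G f' = v"
  obtains "e = e'" "f = f'" | "e \<noteq> e'" "f = f'" "black \<Gamma> v" "out_arcs G v = {f}"
    | "e = e'" "f \<noteq> f'" "white \<Gamma> v" "in_arcs G v = {e}"
proof -
  have deg: "card (in_arcs G v) + card (out_arcs G v) = 3" "card (in_arcs G v) \<noteq> 0" "card (out_arcs G v) \<noteq> 0"
    using internal_degree[OF assms(1)] by (auto simp: in_degree_def out_degree_def)
  have ein: "{e, e'} \<subseteq> in_arcs G v" "{f, f'} \<subseteq> out_arcs G v" using assms by auto
  have le: "card {e, e'} \<le> card (in_arcs G v)" "card {f, f'} \<le> card (out_arcs G v)"
    using card_mono[OF _ ein(1)] card_mono[OF _ ein(2)] by auto
  have single: "A = {z}" if "card A = 1" "z \<in> A" for A and z :: 'e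
    using that by (auto simp: card_1_singleton_iff)
  show thesis
  proof (cases "e = e'"; cases "f = f'")
    assume ne: "e \<noteq> e'" "f = f'"
    then have "card (out_arcs G v) = 1" using le deg by auto
    then show thesis using that(2) ne single[of "out_arcs G v" f] ein assms(1) by (auto simp: black_def out_degree_def)
  next
    assume ne: "e = e'" "f \<noteq> f'"
    then have "card (in_arcs G v) = 1" using le deg by auto
    then show thesis using that(3) ne single[of "in_arcs G v" e] ein assms(1) by (auto simp: white_def in_degree_def)
  next
    assume "e \<noteq> e'" "f \<noteq> f'"
    then show thesis using le deg by auto
  qed (use that in blast)
qed

end

section \<open>Jumps of the index at the meeting points\<close>

context strands begin

definition corner_sign :: "nat \<times> nat \<Rightarrow> int" where
  "corner_sign = (\<lambda>(a, b). split_sign (u ! a) (w ! b) + merge_sign (u ! (a - 1)) (w ! (b - 1)))"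

context
  fixes A B
  assumes S: "strand_pair (real M) f g A B"
begin

interpretation S: strand_pair "real M" f g A B by (rule S)

lemma regular_inside:
  assumes "j < M" "\<tau> \<in> {real j<..<real j + 1}"
  shows "S.regular \<tau>"
  using interval_cases[OF assms(1)]
proof
  assume c: "\<forall>\<tau>\<in>{real j..real j + 1}. f \<tau> = g \<tau>"
  show ?thesis unfolding S.regular_def
    by (intro disjI2 exI[of _ "min (\<tau> - real j) (real j + 1 - \<tau>)"]) (use c assms(2) in \<open>auto simp: abs_less_iff\<close>)
qed (use assms(2) in \<open>auto simp: S.regular_def\<close>)

text \<open>The index is taken at the midpoint and spread over the unit interval, on which all times
  are regular.\<close>

lemma interval_index_exists: "\<exists>K. \<forall>j<M. \<forall>\<tau>\<in>{real j<..<real j + 1}. S.has_index \<tau> (K j)"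
proof -
  have "\<exists>k. \<forall>\<tau>\<in>{real j<..<real j + 1}. S.has_index \<tau> k" if j: "j < M" for j
  proof -
    let ?m = "real j + 1 / 2"
    have sub: "{real j<..<real j + 1} \<subseteq> {0..real M}" using j by auto
    have m: "?m \<in> {real j<..<real j + 1}" by simp
    have mem: "?m \<in> {0..real M}" using sub m by blast
    obtain k d where kd: "0 < d" "\<forall>\<tau>'\<in>{0..real M}. \<bar>\<tau>' - ?m\<bar> < d \<longrightarrow> S.has_index \<tau>' k"
      using S.regular_index[OF mem regular_inside[OF j m]] by blast
    have "S.has_index ?m k" using kd(2)[rule_format, OF mem] kd(1) by simp
    then show ?thesis
      using S.index_constant[OF _ sub regular_inside[OF j] _ m] by (intro exI[of _ k]) auto
  qed
  then show ?thesis by metis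
qed

lemma regular_at_common:
  assumes "0 < \<epsilon>" "\<And>s. s \<in> {0..real M} \<Longrightarrow> \<bar>s - \<tau>\<bar> < \<epsilon> \<Longrightarrow> f s = g s"
  shows "S.regular \<tau>"
  using assms unfolding S.regular_def by blast

text \<open>Strands that touch do so inside an arc, which they then share, or at a vertex on the
  same sheet. The latter would be a meeting point, because j > 0 excludes the sources.\<close>

lemma regular_off_meeting_points:
  assumes j: "0 < j" "j < M" and off: "\<And>z. z \<in> meeting_points \<Longrightarrow> meeting_time z \<noteq> j"
  shows "S.regular (real j)"
proof (cases "f (real j) = g (real j)")
  case True
  obtain a b where ab: "a < length u" "b < length w" "height (tail G (u ! a)) \<le> j" "j < height (head G (u ! a))"
    "height (tail G (w ! b)) \<le> j" "j < height (head G (w ! b))"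
    "{real j..real j + 1} \<subseteq> arc_span (u ! a)" "{real j..real j + 1} \<subseteq> arc_span (w ! b)"
    using unit_interval[OF j(2)] .
  have s: "real j \<in> arc_span (u ! a)" "real j \<in> arc_span (w ! b)" using ab(7,8) by auto
  show ?thesis
  proof (cases "height (tail G (u ! a)) < j")
    case inside: True
    have "u ! a = w ! b" "U a = W b + n"
      using meet_inside[OF ab(1) s(1) ab(2) s(2) True] inside ab(4) by auto
    note common = common_on_arc[OF ab(1,2) this]
    show ?thesis
      by (rule regular_at_common[of 1], simp, rule common) (use inside ab(4) in \<open>auto simp: arc_span_def abs_less_iff\<close>)
  next
    case False
    then have ja: "height (tail G (u ! a)) = j" using ab(3) by simp
    from meet_cases[OF ab(1) s(1) ab(2) s(2) True]
    have tails: "tail G (u ! a) = tail G (w ! b)"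
      using ab(4,6) ja by cases auto
    have jb: "height (tail G (w ! b)) = j" using tails ja by simp
    have "a \<noteq> 0"
    proof
      assume "a = 0"
      then show False using walk_first[OF u(1) nonempty(1)] heights ja j by simp
    qed
    moreover have "b \<noteq> 0"
    proof
      assume "b = 0"
      then show False using walk_first[OF w(1) nonempty(2)] heights jb j by simp
    qed
    moreover have "U a = W b + n"
    proof -
      note ra = arc_time_range[OF arcs_uw(1)[OF ab(1)] s(1)] and rb = arc_time_range[OF arcs_uw(2)[OF ab(2)] s(2)]
      have "arc_log (u ! a) 0 = arc_log (w ! b) 0"
        using arc_log(3)[OF arcs_uw(1)[OF ab(1)]] arc_log(3)[OF arcs_uw(2)[OF ab(2)]] tails by simp
      moreover have "arc_time (u ! a) (real j) = 0" "arc_time (w ! b) (real j) = 0" using ra(2) rb(2) ja jb by auto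
      ultimately have "2 * pi * \<i> * of_int (U a) = 2 * pi * \<i> * of_int (W b + n)"
        using log_eqs(1)[OF ab(1) s(1)] log_eqs'(1)[OF ab(2) s(2)] True by (simp only: add_left_cancel)
      then show ?thesis unfolding level_eq .
    qed
    ultimately have "(a, b) \<in> meeting_points" using ab(1,2) tails by (simp add: meeting_points_def)
    from off[OF this] ja show ?thesis by (simp add: meeting_time_def)
  qed
qed (simp add: S.regular_def)

lemma index_across_regular:
  assumes K: "\<forall>j<M. \<forall>\<tau>\<in>{real j<..<real j + 1}. S.has_index \<tau> (K j)"
    and j: "0 < j" "j < M" and reg: "S.regular (real j)"
  shows "K (j - 1) = K j"
proof -
  have rj: "real (j - 1) = real j - 1" using j by (simp add: of_nat_diff)
  let ?I = "{real j - 1<..<real j + 1}"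
  have r: "S.regular \<tau>" if "\<tau> \<in> ?I" for \<tau>
  proof -
    consider "\<tau> < real j" | "\<tau> = real j" | "real j < \<tau>" by linarith
    then show ?thesis
    proof cases
      case 1
      then show ?thesis using that regular_inside[of "j - 1" \<tau>] j rj by auto
    next
      case 3
      then show ?thesis using that regular_inside[of j \<tau>] j by auto
    qed (use reg in simp)
  qed
  have h: "S.has_index (real j - 1 / 2) (K (j - 1))"
    using K[rule_format, of "j - 1" "real j - 1 / 2"] j rj by simp
  have sub: "?I \<subseteq> {0..real M}"
  proof
    fix t assume "t \<in> ?I"
    moreover have "1 \<le> real j" "real j + 1 \<le> real M" using j by simp_all
    ultimately show "t \<in> {0..real M}" by simp
  qed
  have "S.has_index (real j + 1 / 2) (K (j - 1))"
    by (rule S.index_constant[OF _ sub r h]) simp_all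
  moreover have "S.has_index (real j + 1 / 2) (K j)"
    using K[rule_format, of j "real j + 1 / 2"] j by simp
  ultimately show ?thesis using j by (intro S.index_unique) auto
qed

text \<open>Strands that pass a vertex together make the time regular. If they merge or separate,
  the jump is the total turn of a tripod, whose sign is opposite to the cyclic order recorded by
  \<open>merge_sign\<close> and \<open>split_sign\<close>.\<close>

lemma index_jump:
  assumes K: "\<forall>j<M. \<forall>\<tau>\<in>{real j<..<real j + 1}. S.has_index \<tau> (K j)" and ab: "(a, b) \<in> meeting_points"
  defines "j \<equiv> meeting_time (a, b)"
  shows "K j - K (j - 1) = - corner_sign (a, b)"
proof -
  note m = meeting_pointD[OF ab, folded j_def]
  define v where "v = tail G (u ! a)"
  have hv: "height v = j" by (simp add: v_def j_def meeting_time_def)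
  have v: "v \<in> internal \<Gamma>" "v \<in> verts G" using m(9) by (auto simp: v_def internal_def)
  let ?eu = "u ! (a - 1)" and ?ew = "w ! (b - 1)" and ?fu = "u ! a" and ?fw = "w ! b"
  have len: "a - 1 < length u" "b - 1 < length w" using m by auto
  have arcs: "?eu \<in> arcs G" "?ew \<in> arcs G" "?fu \<in> arcs G" "?fw \<in> arcs G" using arcs_uw m len by auto
  have ends: "head G ?eu = v" "head G ?ew = v" "tail G ?fu = v" "tail G ?fw = v"
    using m by (auto simp: v_def)
  have span_in: "real j - s \<in> arc_span ?eu" "real j - s \<in> arc_span ?ew" if "0 \<le> s" "s \<le> 1" for s
    using arc_span_length[OF arcs(1)] arc_span_length[OF arcs(2)] that ends hv by (auto simp: arc_span_def)
  have span_out: "real j + s \<in> arc_span ?fu" "real j + s \<in> arc_span ?fw" if "0 \<le> s" "s \<le> 1" for s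
    using arc_span_length[OF arcs(3)] arc_span_length[OF arcs(4)] that ends hv by (auto simp: arc_span_def)
  have level_in: "U (a - 1) + edge_crossings \<Gamma> ?eu = W (b - 1) + edge_crossings \<Gamma> ?ew + n"
    using crossings_take_Suc[of "a - 1" u] crossings_take_Suc[of "b - 1" w] m by simp
  have common_in: "f (real j - s) = g (real j - s)" if "?eu = ?ew" "0 \<le> s" "s \<le> 1" for s
    using common_on_arc[OF len that(1) _ span_in(1)[OF that(2,3)]] level_in that(1) by simp
  have common_out: "f (real j + s) = g (real j + s)" if "?fu = ?fw" "0 \<le> s" "s \<le> 1" for s
    using common_on_arc[OF m(2,4) that(1) m(6) span_out(1)[OF that(2,3)]] .
  have apart_in: "f (real j - s) \<noteq> g (real j - s)" if ne: "?eu \<noteq> ?ew" and s: "0 < s" "s < 1" for s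
  proof
    have s': "0 \<le> s" "s \<le> 1" using s by auto
    assume "f (real j - s) = g (real j - s)"
    from meet_inside(1)[OF len(1) span_in(1)[OF s'] len(2) span_in(2)[OF s'] this] ne s
    show False using arc_span_length[OF arcs(1)] ends hv by auto
  qed
  have apart_out: "f (real j + s) \<noteq> g (real j + s)" if ne: "?fu \<noteq> ?fw" and s: "0 < s" "s < 1" for s
  proof
    have s': "0 \<le> s" "s \<le> 1" using s by auto
    assume "f (real j + s) = g (real j + s)"
    from meet_inside(1)[OF m(2) span_out(1)[OF s'] m(4) span_out(2)[OF s'] this] ne s
    show False using arc_span_length[OF arcs(3)] ends hv by auto
  qed
  have exp_u_in: "exp (f (real j - s)) = half_edge \<Gamma> v ?eu (s / (real (height (head G ?eu)) - real (height (tail G ?eu))))"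
    if "0 \<le> s" "s \<le> 1" for s
    using half_edge_in[OF arcs(1) ends(1) that] log_eqs(2)[OF len(1) span_in(1)[OF that]] hv by simp
  have exp_w_in: "exp (g (real j - s)) = half_edge \<Gamma> v ?ew (s / (real (height (head G ?ew)) - real (height (tail G ?ew))))"
    if "0 \<le> s" "s \<le> 1" for s
    using half_edge_in[OF arcs(2) ends(2) that] log_eqs'(2)[OF len(2) span_in(2)[OF that]] hv by simp
  have exp_u_out: "exp (f (real j + s)) = half_edge \<Gamma> v ?fu (s / (real (height (head G ?fu)) - real (height (tail G ?fu))))"
    if "0 \<le> s" "s \<le> 1" for s
    using half_edge_out[OF arcs(3) ends(3) that] log_eqs(2)[OF m(2) span_out(1)[OF that]] hv by simp
  have exp_w_out: "exp (g (real j + s)) = half_edge \<Gamma> v ?fw (s / (real (height (head G ?fw)) - real (height (tail G ?fw))))"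
    if "0 \<le> s" "s \<le> 1" for s
    using half_edge_out[OF arcs(4) ends(4) that] log_eqs'(2)[OF m(4) span_out(2)[OF that]] hv by simp
  have exp_v: "exp (f (real j)) = point \<Gamma> v"
    using exp_u_out[of 0] ends(3) curve_ends(1)[OF arcs(3)] by (simp add: half_edge_def)
  have rj: "real (j - 1) = real j - 1" using m by (simp add: of_nat_diff)
  \<comment> \<open>The tripods have length 1/2, and the indices before and after are read at
    distance 1/4, inside the adjacent unit intervals.\<close>
  have bounds: "0 \<le> real j - 1 / 2" "real j + 1 / 2 \<le> real M" "0 \<le> real j - 1" "real j + 1 \<le> real M" using m by auto
  have idx: "S.has_index (real j - 1 / 4) (K (j - 1))" "S.has_index (real j + 1 / 4) (K j)"
    using K[rule_format, of "j - 1" "real j - 1 / 4"] K[rule_format, of j "real j + 1 / 4"] m rj by auto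
  have cont_minus: "continuous_on {0..1/2} (\<lambda>s. f (real j - s))" "continuous_on {0..1/2} (\<lambda>s. g (real j - s))"
    and cont_plus: "continuous_on {0..1/2} (\<lambda>s. f (real j + s))" "continuous_on {0..1/2} (\<lambda>s. g (real j + s))"
    using bounds by (auto intro!: continuous_on_compose2[OF continuous_strands(1)] continuous_on_compose2[OF continuous_strands(2)] continuous_intros)
  have scale: "1 / 2 \<le> real (height (head G e)) - real (height (tail G e))" if "e \<in> arcs G" for e
    using arc_span_length[OF that] by simp
  \<comment> \<open>Common end of both cases: \<open>P\<close> stands for counterclockwise order,
    with turn -i pi and sign 1, and \<open>Q\<close> for the opposite.\<close>
  have from_turn: "K j - K (j - 1) = - c"
    if turn: "\<And>x y z. x \<in> {0<..1/2} \<Longrightarrow> y \<in> {0<..1/2} \<Longrightarrow> z \<in> {0<..1/2} \<Longrightarrow> t x y z = \<i> * pi * of_int (K j - K (j - 1))"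
    and "((\<forall>x\<in>{0<..1/2}. \<forall>y\<in>{0<..1/2}. \<forall>z\<in>{0<..1/2}. t x y z = - \<i> * pi) \<and> P) \<or>
      ((\<forall>x\<in>{0<..1/2}. \<forall>y\<in>{0<..1/2}. \<forall>z\<in>{0<..1/2}. t x y z = \<i> * pi) \<and> Q)"
    and "P \<Longrightarrow> c = 1" "Q \<Longrightarrow> c = -1" for t :: "real \<Rightarrow> real \<Rightarrow> real \<Rightarrow> complex" and P Q and c :: int
  proof -
    have h: "(1/2 :: real) \<in> {0<..1/2}" by simp
    have inj: "k = l" if "\<i> * pi * of_int k = \<i> * pi * of_int l" for k l :: int using that by simp
    from that(2) show ?thesis
    proof (elim disjE conjE)
      assume "\<forall>x\<in>{0<..1/2}. \<forall>y\<in>{0<..1/2}. \<forall>z\<in>{0<..1/2}. t x y z = - \<i> * pi" P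
      then have "\<i> * pi * of_int (K j - K (j - 1)) = \<i> * pi * of_int (-1)" using turn[OF h h h] h by simp
      from inj[OF this] that(3)[OF \<open>P\<close>] show ?thesis by simp
    next
      assume "\<forall>x\<in>{0<..1/2}. \<forall>y\<in>{0<..1/2}. \<forall>z\<in>{0<..1/2}. t x y z = \<i> * pi" Q
      then have "\<i> * pi * of_int (K j - K (j - 1)) = \<i> * pi * of_int 1" using turn[OF h h h] h by simp
      from inj[OF this] that(4)[OF \<open>Q\<close>] show ?thesis by simp
    qed
  qed
  from trivalent_cases[OF v(1) arcs ends]
  show ?thesis
  proof cases
    case 1
    have "f s = g s" if "\<bar>s - real j\<bar> < 1" for s
    proof (cases "s \<le> real j")
      case True
      then show ?thesis using common_in[OF 1(1), of "real j - s"] that by simp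
    next
      case False
      then show ?thesis using common_out[OF 1(2), of "s - real j"] that by simp
    qed
    then have "S.regular (real j)" by (intro regular_at_common[of 1]) auto
    from index_across_regular[OF K m(10,11) this] show ?thesis
      using 1 by (simp add: corner_sign_def)
  next
    case 2
    have "\<exists>L1 L2 L3. tripod (1/2) (\<lambda>x. f (real j - x)) (\<lambda>x. g (real j - x)) (\<lambda>x. f (real j + x)) (f (real j)) L1 L2 L3 \<and>
      (\<forall>x\<in>{0<..1/2}. \<forall>y\<in>{0<..1/2}. \<forall>z\<in>{0<..1/2}. tripod.total_turn L1 L2 L3 x y z = \<i> * pi * of_int (K j - K (j - 1)))"
    proof (rule S.merging_index_jump[OF _ bounds(1,2) _ _ _ _ idx(1) _ _ idx(2)])
      show "f s = g s" if "s \<in> {real j..real j + 1 / 2}" for s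
        using common_out[OF 2(2), of "s - real j"] that by simp
      show "f s \<noteq> g s" if "s \<in> {real j - 1 / 2..<real j}" for s
        using apart_in[OF 2(1), of "real j - s"] that by simp
    qed simp_all
    then obtain L1 L2 L3 where L: "tripod (1/2) (\<lambda>x. f (real j - x)) (\<lambda>x. g (real j - x)) (\<lambda>x. f (real j + x)) (f (real j)) L1 L2 L3"
      "\<And>x y z. x \<in> {0<..1/2} \<Longrightarrow> y \<in> {0<..1/2} \<Longrightarrow> z \<in> {0<..1/2} \<Longrightarrow> tripod.total_turn L1 L2 L3 x y z = \<i> * pi * of_int (K j - K (j - 1))"
      by (elim exE conjE) simp
    have "K j - K (j - 1) = - merge_sign ?eu ?ew"
    proof (rule from_turn[OF L(2)])
      show "((\<forall>x\<in>{0<..1/2}. \<forall>y\<in>{0<..1/2}. \<forall>z\<in>{0<..1/2}. tripod.total_turn L1 L2 L3 x y z = - \<i> * pi) \<and> ccw_at \<Gamma> v ?eu ?ew ?fu) \<or>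
        ((\<forall>x\<in>{0<..1/2}. \<forall>y\<in>{0<..1/2}. \<forall>z\<in>{0<..1/2}. tripod.total_turn L1 L2 L3 x y z = \<i> * pi) \<and> ccw_at \<Gamma> v ?ew ?eu ?fu)"
        unfolding ccw_at_iff exp_v[symmetric]
        by (rule tripod.total_turn_orientation[OF L(1) cont_minus cont_plus(1)
              continuous_half_edge[OF arcs(1)] scale[OF arcs(1)] exp_u_in[symmetric]
              continuous_half_edge[OF arcs(2)] scale[OF arcs(2)] exp_w_in[symmetric]
              continuous_half_edge[OF arcs(3)] scale[OF arcs(3)] exp_u_out[symmetric]]) auto
    qed (use merge_sign_eqs[OF 2(3) ends(1,2) 2(4)] in auto)
    moreover have "split_sign ?fu ?fw = 0" using 2(2) by simp
    ultimately show ?thesis by (simp add: corner_sign_def)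
  next
    case 3
    have "\<exists>L1 L2 L3. tripod (1/2) (\<lambda>x. f (real j + x)) (\<lambda>x. g (real j + x)) (\<lambda>x. f (real j - x)) (f (real j)) L1 L2 L3 \<and>
      (\<forall>x\<in>{0<..1/2}. \<forall>y\<in>{0<..1/2}. \<forall>z\<in>{0<..1/2}. tripod.total_turn L1 L2 L3 x y z = \<i> * pi * of_int (K j - K (j - 1)))"
    proof (rule S.splitting_index_jump[OF _ bounds(1,2) _ _ _ _ idx(1) _ _ idx(2)])
      show "f s = g s" if "s \<in> {real j - 1 / 2..real j}" for s
        using common_in[OF 3(1), of "real j - s"] that by simp
      show "f s \<noteq> g s" if "s \<in> {real j<..real j + 1 / 2}" for s
        using apart_out[OF 3(2), of "s - real j"] that by simp
    qed simp_all
    then obtain L1 L2 L3 where L: "tripod (1/2) (\<lambda>x. f (real j + x)) (\<lambda>x. g (real j + x)) (\<lambda>x. f (real j - x)) (f (real j)) L1 L2 L3"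
      "\<And>x y z. x \<in> {0<..1/2} \<Longrightarrow> y \<in> {0<..1/2} \<Longrightarrow> z \<in> {0<..1/2} \<Longrightarrow> tripod.total_turn L1 L2 L3 x y z = \<i> * pi * of_int (K j - K (j - 1))"
      by (elim exE conjE) simp
    have "K j - K (j - 1) = - split_sign ?fu ?fw"
    proof (rule from_turn[OF L(2)])
      show "((\<forall>x\<in>{0<..1/2}. \<forall>y\<in>{0<..1/2}. \<forall>z\<in>{0<..1/2}. tripod.total_turn L1 L2 L3 x y z = - \<i> * pi) \<and> ccw_at \<Gamma> v ?fu ?fw ?eu) \<or>
        ((\<forall>x\<in>{0<..1/2}. \<forall>y\<in>{0<..1/2}. \<forall>z\<in>{0<..1/2}. tripod.total_turn L1 L2 L3 x y z = \<i> * pi) \<and> ccw_at \<Gamma> v ?fw ?fu ?eu)"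
        unfolding ccw_at_iff exp_v[symmetric]
        by (rule tripod.total_turn_orientation[OF L(1) cont_plus cont_minus(1)
              continuous_half_edge[OF arcs(3)] scale[OF arcs(3)] exp_u_out[symmetric]
              continuous_half_edge[OF arcs(4)] scale[OF arcs(4)] exp_w_out[symmetric]
              continuous_half_edge[OF arcs(1)] scale[OF arcs(1)] exp_u_in[symmetric]]) auto
    qed (use split_sign_eqs[OF 3(3) ends(3,4) 3(4)] in auto)
    moreover have "merge_sign ?eu ?ew = 0" using 3(1) by simp
    ultimately show ?thesis by (simp add: corner_sign_def)
  qed
qed

end

end

section \<open>Behaviour at the two boundary circles and the count of signs on one sheet\<close>

context acyclic_cylinder begin

text \<open>Sources have height 0 and sinks the maximal height, so at intermediate times a walk is
  inside an arc or at an internal vertex.\<close>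

lemma norm_exp_walk_log:
  fixes \<tau> :: real
  assumes p: "awalk x p y" "x \<in> sources \<Gamma>" "y \<in> sinks \<Gamma>" and \<phi>: "is_walk_log x p y \<phi>"
    and \<tau>: "0 < \<tau>" "\<tau> < card (verts G)"
  shows "1 < cmod (exp (\<phi> \<tau>)) \<and> cmod (exp (\<phi> \<tau>)) < 2"
proof -
  have "p \<noteq> []" using p sources_sinks_disjoint by (auto simp: awalk_Nil_iff)
  then have "\<exists>i<length p. \<tau> \<in> arc_span (p ! i)"
    using \<tau> by (intro walk_span[OF p(1)]) (simp_all add: height_source[OF p(2)] height_sink[OF p(3)])
  then obtain i where i: "i < length p" "\<tau> \<in> arc_span (p ! i)" by blast
  let ?e = "p ! i"
  have e: "?e \<in> arcs G" using walk_arc[OF p(1) i(1)] .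
  have v: "1 < cmod (point \<Gamma> v) \<and> cmod (point \<Gamma> v) < 2" if "v \<in> verts G" "\<tau> = height v" for v
  proof -
    have "v \<notin> sources \<Gamma>" "v \<notin> sinks \<Gamma>" using that \<tau> height_source[of v] height_sink[of v] by auto
    then show ?thesis using that by (intro internal_in_interior) (simp add: internal_def)
  qed
  note r = arc_time_range[OF e i(2)]
  consider "arc_time ?e \<tau> = 0" | "arc_time ?e \<tau> = 1" | "0 < arc_time ?e \<tau>" "arc_time ?e \<tau> < 1"
    using r(1) by fastforce
  then show ?thesis
  proof cases
    case 1
    then show ?thesis using exp_walk_log[OF p(1) \<phi> i] curve_ends(1)[OF e] r(2) v[of "tail G ?e"] e by simp
  next
    case 2
    then show ?thesis using exp_walk_log[OF p(1) \<phi> i] curve_ends(2)[OF e] r(3) v[of "head G ?e"] e by simp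
  next
    case 3
    then show ?thesis using exp_walk_log[OF p(1) \<phi> i] curve_in_interior[OF e 3] by simp
  qed
qed

text \<open>The strands run in the strip between 0 and ln 2 and touch its sides only at their ends.
  Hence chords from a start or to an end point rightwards, as \<open>index_difference\<close>
  requires.\<close>

lemma Re_walk_log:
  fixes \<tau> :: real
  assumes p: "awalk x p y" "x \<in> sources \<Gamma>" "y \<in> sinks \<Gamma>" and \<phi>: "is_walk_log x p y \<phi>"
  shows "Re (\<phi> 0) = 0" "Re (\<phi> (card (verts G))) = ln 2"
    "0 < \<tau> \<Longrightarrow> \<tau> \<le> card (verts G) \<Longrightarrow> 0 < Re (\<phi> \<tau>)" "0 \<le> \<tau> \<Longrightarrow> \<tau> < card (verts G) \<Longrightarrow> Re (\<phi> \<tau>) < ln 2"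
proof -
  have ends: "\<phi> 0 = base_log x" "\<phi> (card (verts G)) = base_log y + 2 * pi * \<i> * of_int (crossings \<Gamma> p)"
    using \<phi> height_source[OF p(2)] height_sink[OF p(3)] unfolding is_walk_log_def by simp_all
  show 0: "Re (\<phi> 0) = 0" unfolding ends using source_on_boundary[OF p(2)] by (simp add: base_log_def)
  show M: "Re (\<phi> (card (verts G))) = ln 2" unfolding ends using sink_on_boundary[OF p(3)] by (simp add: base_log_def)
  have mid: "0 < Re (\<phi> \<tau>) \<and> Re (\<phi> \<tau>) < ln 2" if "0 < \<tau>" "\<tau> < card (verts G)"
  proof -
    have "1 < exp (Re (\<phi> \<tau>))" "exp (Re (\<phi> \<tau>)) < 2" using norm_exp_walk_log[OF p \<phi> that] by simp_all
    then show ?thesis by (metis exp_gt_one exp_less_cancel_iff exp_ln exp_zero zero_less_numeral)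
  qed
  show "0 < Re (\<phi> \<tau>)" if "0 < \<tau>" "\<tau> \<le> card (verts G)"
    using mid M that by (cases "\<tau> = card (verts G)") auto
  show "Re (\<phi> \<tau>) < ln 2" if "0 \<le> \<tau>" "\<tau> < card (verts G)"
    using mid 0 that by (cases "\<tau> = 0") auto
qed

end

context strands begin

lemma end_values:
  "f 0 = base_log x" "f (real M) = base_log y + 2 * pi * \<i> * of_int (crossings \<Gamma> u)"
  "g 0 = base_log x' + 2 * pi * \<i> * of_int n" "g (real M) = base_log y' + 2 * pi * \<i> * of_int (crossings \<Gamma> w + n)"
proof -
  show "f 0 = base_log x" "f (real M) = base_log y + 2 * pi * \<i> * of_int (crossings \<Gamma> u)"
    using \<phi> heights unfolding is_walk_log_def by simp_all
  have "\<psi> 0 = base_log x'" "\<psi> (real M) = base_log y' + 2 * pi * \<i> * of_int (crossings \<Gamma> w)"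
    using \<psi> heights unfolding is_walk_log_def by simp_all
  then show "g 0 = base_log x' + 2 * pi * \<i> * of_int n" "g (real M) = base_log y' + 2 * pi * \<i> * of_int (crossings \<Gamma> w + n)"
    by (simp_all add: g_def algebra_simps)
qed

lemma exp_level: "exp (2 * pi * \<i> * of_int k) = 1"
  using exp_integer_2pi[of "of_int k"] by (simp add: mult.commute mult.left_commute)

lemma base_log_eq:
  assumes "v \<in> verts G" "v' \<in> verts G"
    "base_log v + 2 * pi * \<i> * of_int k = base_log v' + 2 * pi * \<i> * of_int l"
  shows "v = v'" "k = l"
proof -
  have "exp (base_log v + 2 * pi * \<i> * of_int k) = exp (base_log v' + 2 * pi * \<i> * of_int l)" using assms(3) by simp
  then have "point \<Gamma> v = point \<Gamma> v'"
    unfolding exp_add exp_level using exp_base_log assms(1,2) by simp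
  then show v: "v = v'" using inj_point assms(1,2) by (auto dest: inj_onD)
  have "2 * pi * \<i> * of_int k = 2 * pi * \<i> * of_int l" using assms(3) unfolding v by (simp only: add_left_cancel)
  then show "k = l" unfolding level_eq .
qed

lemma end_verts: "x \<in> verts G" "x' \<in> verts G" "y \<in> verts G" "y' \<in> verts G"
  using boundary_verts u w by auto

text \<open>Equal starting points mean the same source on the same sheet, and a source has a single
  outgoing edge. So time 0 is regular even if the strands start together.\<close>

lemma common_at_start:
  assumes "f 0 = g 0" "0 \<le> s" "s \<le> 1"
  shows "f s = g s"
proof -
  have eq: "base_log x + 2 * pi * \<i> * of_int 0 = base_log x' + 2 * pi * \<i> * of_int n"
    using assms(1) unfolding end_values by simp
  have xx: "x = x'" "n = 0" using base_log_eq[OF end_verts(1,2) eq] by auto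
  have e: "u ! 0 \<in> out_arcs G x" "w ! 0 \<in> out_arcs G x"
    using walk_first[OF u(1) nonempty(1)] walk_first[OF w(1) nonempty(2)] arcs_uw(1)[of 0] arcs_uw(2)[of 0] nonempty xx
    by auto
  have "card (out_arcs G x) = 1" using source_degree[OF u(2)] by (simp add: out_degree_def)
  then obtain e where "out_arcs G x = {e}" by (auto simp: card_1_singleton_iff)
  with e have same: "u ! 0 = w ! 0" by simp
  have "s \<in> arc_span (u ! 0)"
    using arc_span_length[of "u ! 0"] arcs_uw(1)[of 0] nonempty walk_first[OF u(1) nonempty(1)] heights assms(2,3)
    by (simp add: arc_span_def)
  then show ?thesis using common_on_arc[of 0 0 s] nonempty same xx by (simp add: crossings_def)
qed

lemma common_at_end:
  assumes "f (real M) = g (real M)" "real M - 1 \<le> s" "s \<le> real M"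
  shows "f s = g s"
proof -
  let ?a = "length u - 1" and ?b = "length w - 1"
  have len: "?a < length u" "?b < length w" using nonempty by auto
  have yy: "y = y'" "crossings \<Gamma> u = crossings \<Gamma> w + n"
    using base_log_eq[OF end_verts(3,4)] assms(1) unfolding end_values by blast+
  have h: "head G (u ! ?a) = y" "head G (w ! ?b) = y"
    using walk_last[OF u(1) nonempty(1)] walk_last[OF w(1) nonempty(2)] yy by auto
  then have e: "u ! ?a \<in> in_arcs G y" "w ! ?b \<in> in_arcs G y"
    using arcs_uw(1)[OF len(1)] arcs_uw(2)[OF len(2)] by auto
  have "card (in_arcs G y) = 1" using sink_degree[OF u(3)] by (simp add: in_degree_def)
  then obtain e where "in_arcs G y = {e}" by (auto simp: card_1_singleton_iff)
  with e have same: "u ! ?a = w ! ?b" by simp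
  have lev: "U ?a = W ?b + n"
    using crossings_take_Suc[OF len(1)] crossings_take_Suc[OF len(2)] nonempty yy(2) same by simp
  have "s \<in> arc_span (u ! ?a)"
    using arc_span_length[OF arcs_uw(1)[OF len(1)]] h(1) heights assms(2,3) by (simp add: arc_span_def)
  then show ?thesis using common_on_arc[OF len same lev] by blast
qed

text \<open>The jumps telescope to the difference of the indices at the two ends, which
  \<open>index_difference\<close> evaluates. The imaginary parts there are arguments plus whole
  sheets, whence the terms with 2 pi.\<close>

lemma meeting_points_sum:
  "of_int (\<Sum>(a, b)\<in>meeting_points. split_sign (u ! a) (w ! b) + merge_sign (u ! (a - 1)) (w ! (b - 1))) =
    sgn (Arg2pi (point \<Gamma> y') - Arg2pi (point \<Gamma> y) + 2 * pi * (real_of_int (crossings \<Gamma> w) + n - crossings \<Gamma> u)) -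
    sgn (Arg2pi (point \<Gamma> x') - Arg2pi (point \<Gamma> x) + 2 * pi * n)"
proof -
  obtain A B where S: "strand_pair (real M) f g A B" using logs_exist by blast
  interpret S: strand_pair "real M" f g A B by (rule S)
  obtain K where K: "\<forall>j<M. \<forall>\<tau>\<in>{real j<..<real j + 1}. S.has_index \<tau> (K j)"
    using interval_index_exists[OF S] by blast
  have off: "K j - K (j - 1) = 0" if "0 < j" "j < M" "j \<notin> meeting_time ` meeting_points" for j
  proof -
    have "S.regular (real j)" by (rule regular_off_meeting_points[OF S that(1,2)]) (use that(3) in blast)
    from index_across_regular[OF S K that(1,2) this] show ?thesis by simp
  qed
  have tele: "(\<Sum>j\<in>{1..<m}. K j - K (j - 1)) = K (m - 1) - K 0" if "0 < m" for m
    using that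
  proof (induction m)
    case (Suc m)
    then show ?case by (cases "m = 0") (auto simp: sum.atLeastLessThan_Suc)
  qed simp
  have "K (M - 1) - K 0 = (\<Sum>j\<in>{1..<M}. K j - K (j - 1))" using tele[OF M_pos] by simp
  also have "\<dots> = (\<Sum>j\<in>meeting_time ` meeting_points. K j - K (j - 1))"
    using off meeting_pointD(10,11) by (intro sum.mono_neutral_right) (fastforce simp: Suc_le_eq)+
  also have "\<dots> = (\<Sum>z\<in>meeting_points. K (meeting_time z) - K (meeting_time z - 1))"
    by (rule sum.reindex_cong[OF inj_meeting_time]) auto
  also have "\<dots> = (\<Sum>z\<in>meeting_points. - corner_sign z)"
    using index_jump[OF S K] by (intro sum.cong) auto
  finally have jumps: "(\<Sum>z\<in>meeting_points. corner_sign z) = - (K (M - 1) - K 0)" by (simp add: sum_negf)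
  have reg0: "S.regular 0"
    using regular_at_common[OF S, of 1 0] common_at_start by (cases "f 0 = g 0") (auto simp: S.regular_def)
  have regM: "S.regular (real M)"
    using regular_at_common[OF S, of 1 "real M"] common_at_end by (cases "f (real M) = g (real M)") (auto simp: S.regular_def)
  have rM: "real (M - 1) = real M - 1" "1 \<le> real M" using M_pos by (simp_all add: of_nat_diff Suc_le_eq)
  have "S.has_index 0 (K 0)"
  proof (rule S.index_constant)
    show "{0..<1} \<subseteq> {0..real M}" using rM by auto
    show "S.regular \<tau>" if "\<tau> \<in> {0..<1}" for \<tau>
      using that reg0 regular_inside[OF S M_pos, of \<tau>] by (cases "\<tau> = 0") auto
    show "S.has_index (1 / 2) (K 0)" using K M_pos by auto
  qed auto
  moreover have "S.has_index (real M) (K (M - 1))"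
  proof (rule S.index_constant)
    show "{real M - 1<..real M} \<subseteq> {0..real M}" using rM by auto
    show "S.regular \<tau>" if "\<tau> \<in> {real M - 1<..real M}" for \<tau>
      using that regM regular_inside[OF S, of "M - 1" \<tau>] rM M_pos by (cases "\<tau> = real M") auto
    show "S.has_index (real M - 1 / 2) (K (M - 1))" using K[rule_format, of "M - 1"] M_pos rM by auto
  qed auto
  moreover have Reg: "Re (g s) = Re (\<psi> s)" for s by (simp add: g_def)
  note Re_f = Re_walk_log[OF u \<phi>] and Re_g = Re_walk_log[OF w \<psi>]
  ultimately have "of_int (K (M - 1) - K 0) = sgn (Im (g 0 - f 0)) - sgn (Im (g (real M) - f (real M)))"
    using reg0 regM Re_f Re_g Reg by (intro S.index_difference) simp_all
  moreover have "Im (g 0 - f 0) = Arg2pi (point \<Gamma> x') - Arg2pi (point \<Gamma> x) + 2 * pi * n"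
    "Im (g (real M) - f (real M)) = Arg2pi (point \<Gamma> y') - Arg2pi (point \<Gamma> y) + 2 * pi * (real_of_int (crossings \<Gamma> w) + n - crossings \<Gamma> u)"
    unfolding end_values by (simp_all add: base_log_def algebra_simps)
  ultimately have "of_int (\<Sum>z\<in>meeting_points. corner_sign z) =
    sgn (Arg2pi (point \<Gamma> y') - Arg2pi (point \<Gamma> y) + 2 * pi * (real_of_int (crossings \<Gamma> w) + n - crossings \<Gamma> u)) -
    sgn (Arg2pi (point \<Gamma> x') - Arg2pi (point \<Gamma> x) + 2 * pi * n)"
    unfolding jumps by simp
  then show ?thesis unfolding corner_sign_def .
qed

end

section \<open>Linear combinations of paths and the Lax equation\<close>

lemma keys_scal: "Poly_Mapping.keys (scal c f) \<subseteq> Poly_Mapping.keys f"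
  by (auto simp: in_keys_iff lookup_scal)

lemma scal_simps [simp]: "scal c 0 = 0" "scal 0 f = 0" "scal 1 f = f" "scal c (scal d f) = scal (c * d) f"
  "scal c (- f) = - scal c f"
  by (simp_all add: poly_mapping_eq_iff fun_eq_iff lookup_scal)

lemma scal_add: "scal c (f + g) = scal c f + scal c g"
  by (rule pm.scale_right_distrib)

lemma scal_diff: "scal c (f - g) = scal c f - scal c g"
  by (rule pm.scale_right_diff_distrib)

lemma scal_sum: "scal c (sum f A) = (\<Sum>x\<in>A. scal c (f x))"
  by (rule pm.scale_sum_right)

lemma sum_scal: "scal (sum c A) f = (\<Sum>x\<in>A. scal (c x) f)"
  by (rule pm.scale_sum_left)

lemma extend_linear_superset:
  assumes "finite S" "Poly_Mapping.keys f \<subseteq> S"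
  shows "extend_linear F f = (\<Sum>x\<in>S. scal (Poly_Mapping.lookup f x) (F x))"
  unfolding extend_linear_def
  by (rule sum.mono_neutral_left) (use assms in \<open>auto simp: in_keys_iff\<close>)

lemma extend_linear_add: "extend_linear F (f + g) = extend_linear F f + extend_linear F g"
proof -
  let ?S = "Poly_Mapping.keys f \<union> Poly_Mapping.keys g"
  have "extend_linear F (f + g) = (\<Sum>x\<in>?S. scal (Poly_Mapping.lookup (f + g) x) (F x))"
    by (rule extend_linear_superset) (simp_all add: Poly_Mapping.keys_add)
  also have "\<dots> = (\<Sum>x\<in>?S. scal (Poly_Mapping.lookup f x) (F x)) + (\<Sum>x\<in>?S. scal (Poly_Mapping.lookup g x) (F x))"
    by (simp add: lookup_add pm.scale_left_distrib sum.distrib)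
  finally show ?thesis by (simp add: extend_linear_superset[of ?S])
qed

lemma extend_linear_scal: "extend_linear F (scal c f) = scal c (extend_linear F f)"
  using extend_linear_superset[OF _ keys_scal[of c f], of F]
  by (simp add: extend_linear_superset[of "Poly_Mapping.keys f"] lookup_scal scal_sum)

lemma extend_linear_zero [simp]: "extend_linear F 0 = 0"
  by (simp add: extend_linear_def)

lemma extend_linear_minus: "extend_linear F (- f) = - extend_linear F f"
proof -
  have "- f = scal (- 1) f" by (simp add: poly_mapping_eq_iff fun_eq_iff lookup_scal)
  moreover have "scal (- 1) (extend_linear F f) = - extend_linear F f"
    by (simp add: poly_mapping_eq_iff fun_eq_iff lookup_scal)
  ultimately show ?thesis using extend_linear_scal by metis
qed

lemma extend_linear_diff: "extend_linear F (f - g) = extend_linear F f - extend_linear F g"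
  using extend_linear_add[of F f "- g"] by (simp add: extend_linear_minus)

lemma extend_linear_sum: "extend_linear F (sum f A) = (\<Sum>x\<in>A. extend_linear F (f x))"
  by (induction A rule: infinite_finite_induct) (simp_all add: extend_linear_add)

lemma extend_linear_basis [simp]: "extend_linear F (basis x) = F x"
  by (simp add: extend_linear_def)

lemma extend_linear_cong:
  "(\<And>x. x \<in> Poly_Mapping.keys f \<Longrightarrow> F x = G x) \<Longrightarrow> extend_linear F f = extend_linear G f"
  by (simp add: extend_linear_def)

lemma extend_linear_image:
  fixes F :: "'a \<Rightarrow> ('b \<Rightarrow>\<^sub>0 scalar)"
  assumes "\<And>f g. L (f + g) = L f + L g" "\<And>c f. L (scal c f) = scal c (L f)"
  shows "L (extend_linear F f) = extend_linear (\<lambda>x. L (F x)) f"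
proof -
  have "L 0 = 0" using assms(2)[of 0 0] by simp
  then have "L (sum h A) = (\<Sum>x\<in>A. L (h x))" for h and A :: "'a set"
    by (induction A rule: infinite_finite_induct) (simp_all add: assms(1))
  then show ?thesis by (simp add: extend_linear_def assms(2))
qed

lemma extend_linear_id: "extend_linear basis f = f"
proof (rule poly_mapping_eqI)
  fix x
  have "Poly_Mapping.lookup (extend_linear basis f) x =
      (\<Sum>y\<in>Poly_Mapping.keys f. Poly_Mapping.lookup f y * (1 when y = x))"
    by (simp add: extend_linear_def lookup_sum lookup_scal lookup_single)
  also have "\<dots> = Poly_Mapping.lookup f x"
    by (simp add: when_def if_distrib in_keys_iff cong: if_cong)
  finally show "Poly_Mapping.lookup (extend_linear basis f) x = Poly_Mapping.lookup f x" .
qed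

lemma linear_expand:
  assumes "\<And>f g. L (f + g) = L f + L g" "\<And>c f. L (scal c f) = scal c (L f)"
  shows "L f = extend_linear (\<lambda>x. L (basis x)) f"
  using extend_linear_image[of L basis f, OF assms] by (simp add: extend_linear_id)

lemma linear_eqI:
  assumes "\<And>f g. L (f + g) = L f + L g" "\<And>c f. L (scal c f) = scal c (L f)"
    and "\<And>f g. L' (f + g) = L' f + L' g" "\<And>c f. L' (scal c f) = scal c (L' f)"
    and "\<And>x. x \<in> Poly_Mapping.keys f \<Longrightarrow> L (basis x) = L' (basis x)"
  shows "L f = L' f"
proof -
  have "L f = extend_linear (\<lambda>x. L (basis x)) f" by (rule linear_expand[of L, OF assms(1,2)])
  also have "\<dots> = extend_linear (\<lambda>x. L' (basis x)) f" by (rule extend_linear_cong) (rule assms(5))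
  also have "\<dots> = L' f" by (rule linear_expand[of L', OF assms(3,4), symmetric])
  finally show ?thesis .
qed

lemma extend_linear_function_add: "extend_linear (\<lambda>x. F x + G x) f = extend_linear F f + extend_linear G f"
  by (simp add: extend_linear_def scal_add sum.distrib)

lemma extend_linear_function_scal: "extend_linear (\<lambda>x. scal c (F x)) f = scal c (extend_linear F f)"
  by (simp add: extend_linear_def scal_sum mult.commute)

lemma extend_linear_function_zero [simp]: "extend_linear (\<lambda>x. 0) f = 0"
  by (simp add: extend_linear_def)

lemma extend_bilinear_add_left: "extend_bilinear F (f + f') g = extend_bilinear F f g + extend_bilinear F f' g"
  and extend_bilinear_scal_left: "extend_bilinear F (scal c f) g = scal c (extend_bilinear F f g)"
  and extend_bilinear_diff_left: "extend_bilinear F (f - f') g = extend_bilinear F f g - extend_bilinear F f' g"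
  and extend_bilinear_sum_left: "extend_bilinear F (sum h A) g = (\<Sum>x\<in>A. extend_bilinear F (h x) g)"
  and extend_bilinear_zero_left [simp]: "extend_bilinear F 0 g = 0"
  by (simp_all add: extend_bilinear_def extend_linear_add extend_linear_scal extend_linear_diff extend_linear_sum)

lemma extend_bilinear_add_right: "extend_bilinear F f (g + g') = extend_bilinear F f g + extend_bilinear F f g'"
  and extend_bilinear_scal_right: "extend_bilinear F f (scal c g) = scal c (extend_bilinear F f g)"
  and extend_bilinear_zero_right [simp]: "extend_bilinear F f 0 = 0"
  by (simp_all add: extend_bilinear_def extend_linear_add extend_linear_scal extend_linear_function_add
      extend_linear_function_scal)

lemma extend_bilinear_sum_right: "extend_bilinear F f (sum h A) = (\<Sum>x\<in>A. extend_bilinear F f (h x))"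
  by (induction A rule: infinite_finite_induct) (simp_all add: extend_bilinear_add_right)

lemma extend_bilinear_basis [simp]: "extend_bilinear F (basis x) (basis y) = F x y"
  by (simp add: extend_bilinear_def)

lemmas bilinear_simps = extend_bilinear_add_left extend_bilinear_scal_left extend_bilinear_sum_left
  extend_bilinear_add_right extend_bilinear_scal_right extend_bilinear_sum_right

lemmas mor_mult_simps = bilinear_simps[of path_mult, folded mor_mult_def]

lemma mor_mult_zero [simp]: "mor_mult 0 g = 0" "mor_mult f 0 = 0"
  by (simp_all add: mor_mult_def)

lemma mor_mult_basis: "mor_mult (basis p) (basis q) = path_mult p q"
  by (simp add: mor_mult_def)

lemma psrc_concat [simp]: "psrc (concat_path p q) = psrc p" "ptgt (concat_path p q) = ptgt q"
  by (simp_all add: concat_path_def psrc_def ptgt_def)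

lemma concat_path_assoc: "concat_path (concat_path p q) r = concat_path p (concat_path q r)"
  by (simp add: concat_path_def psrc_def ptgt_def)

lemma mor_mult_assoc_basis:
  "mor_mult (mor_mult (basis p) (basis q)) (basis r) = mor_mult (basis p) (mor_mult (basis q) (basis r))"
  by (simp add: mor_mult_basis path_mult_def concat_path_assoc)

lemma mor_mult_assoc: "mor_mult (mor_mult f g) h = mor_mult f (mor_mult g h)"
proof (rule linear_eqI[of "\<lambda>f. mor_mult (mor_mult f g) h" "\<lambda>f. mor_mult f (mor_mult g h)"])
  fix p
  show "mor_mult (mor_mult (basis p) g) h = mor_mult (basis p) (mor_mult g h)"
  proof (rule linear_eqI[of "\<lambda>g. mor_mult (mor_mult (basis p) g) h" "\<lambda>g. mor_mult (basis p) (mor_mult g h)"])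
    fix q
    show "mor_mult (mor_mult (basis p) (basis q)) h = mor_mult (basis p) (mor_mult (basis q) h)"
      by (rule linear_eqI[of "\<lambda>h. mor_mult (mor_mult (basis p) (basis q)) h" "\<lambda>h. mor_mult (basis p) (mor_mult (basis q) h)"])
        (simp_all add: mor_mult_simps mor_mult_assoc_basis)
  qed (simp_all add: mor_mult_simps)
qed (simp_all add: mor_mult_simps)

lemma keys_mor_mult:
  assumes "\<And>p q. p \<in> Poly_Mapping.keys f \<Longrightarrow> q \<in> Poly_Mapping.keys g \<Longrightarrow> ptgt p = psrc q \<Longrightarrow> concat_path p q \<in> S"
  shows "Poly_Mapping.keys (mor_mult f g) \<subseteq> S"
proof -
  have 1: "Poly_Mapping.keys (scal c (path_mult p q)) \<subseteq> S" if "p \<in> Poly_Mapping.keys f" "q \<in> Poly_Mapping.keys g" for p q c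
    using assms[OF that] keys_scal[of c "path_mult p q"] by (auto simp: path_mult_def split: if_splits)
  have 2: "Poly_Mapping.keys (\<Sum>q\<in>Poly_Mapping.keys g. scal (Poly_Mapping.lookup g q) (path_mult p q)) \<subseteq> S"
    if "p \<in> Poly_Mapping.keys f" for p
    by (rule order.trans[OF keys_sum], rule UN_least, rule 1[OF that])
  show ?thesis
    unfolding mor_mult_def extend_bilinear_def extend_linear_def
    by (rule order.trans[OF keys_sum], rule UN_least, rule order.trans[OF keys_scal], rule 2)
qed

lemma mor_mult_id_left:
  assumes "\<And>p. p \<in> Poly_Mapping.keys f \<Longrightarrow> psrc p = v"
  shows "mor_mult (basis (id_path v)) f = f"
  by (rule linear_eqI[of "\<lambda>f. mor_mult (basis (id_path v)) f" "\<lambda>f. f"])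
    (use assms in \<open>auto simp: mor_mult_simps mor_mult_basis path_mult_def concat_path_def id_path_def psrc_def ptgt_def\<close>)

lemma mor_mult_id_right:
  assumes "\<And>p. p \<in> Poly_Mapping.keys f \<Longrightarrow> ptgt p = v"
  shows "mor_mult f (basis (id_path v)) = f"
  by (rule linear_eqI[of "\<lambda>f. mor_mult f (basis (id_path v))" "\<lambda>f. f"])
    (use assms in \<open>auto simp: mor_mult_simps mor_mult_basis path_mult_def concat_path_def id_path_def psrc_def ptgt_def\<close>)

text \<open>Sends p \<otimes> q to p m q. With the other factors of a cyclic word kept in the middle
  slot, the Leibniz rule can move them around.\<close>

definition insert_mult :: "('v, 'e) mor \<Rightarrow> ('v, 'e) tensor \<Rightarrow> ('v, 'e) mor" where
  "insert_mult m = extend_linear (\<lambda>(p, q). mor_mult (mor_mult (basis p) m) (basis q))"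

lemma insert_mult_simps:
  "insert_mult m (s + t) = insert_mult m s + insert_mult m t" "insert_mult m (scal c t) = scal c (insert_mult m t)"
  "insert_mult m (s - t) = insert_mult m s - insert_mult m t" "insert_mult m 0 = 0"
  "insert_mult m (sum h A) = (\<Sum>x\<in>A. insert_mult m (h x))"
  "insert_mult (m + m') t = insert_mult m t + insert_mult m' t" "insert_mult (scal c m) t = scal c (insert_mult m t)"
  by (simp_all add: insert_mult_def extend_linear_add extend_linear_scal extend_linear_diff extend_linear_sum
      mor_mult_simps case_prod_unfold extend_linear_function_add extend_linear_function_scal)

lemma insert_mult_zero [simp]: "insert_mult 0 t = 0"
  by (simp add: insert_mult_def case_prod_unfold)

lemma insert_mult_sum: "insert_mult (sum h A) t = (\<Sum>x\<in>A. insert_mult (h x) t)"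
  by (induction A rule: infinite_finite_induct) (simp_all add: insert_mult_simps)

definition mor_tensor :: "('v, 'e) mor \<Rightarrow> ('v, 'e) mor \<Rightarrow> ('v, 'e) tensor" where
  "mor_tensor = extend_bilinear tens"

lemma insert_mult_mor_tensor: "insert_mult m (mor_tensor f g) = mor_mult (mor_mult f m) g"
proof (rule linear_eqI[of "\<lambda>f. insert_mult m (mor_tensor f g)" "\<lambda>f. mor_mult (mor_mult f m) g"])
  fix p
  show "insert_mult m (mor_tensor (basis p) g) = mor_mult (mor_mult (basis p) m) g"
    by (rule linear_eqI[of "\<lambda>g. insert_mult m (mor_tensor (basis p) g)" "\<lambda>g. mor_mult (mor_mult (basis p) m) g"])
      (simp_all add: mor_tensor_def bilinear_simps mor_mult_simps insert_mult_simps, simp add: insert_mult_def tens_def)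
qed (simp_all add: mor_tensor_def bilinear_simps mor_mult_simps insert_mult_simps)

lemma tens_mult_simps:
  "tens_mult (s + s') t = tens_mult s t + tens_mult s' t" "tens_mult (scal c s) t = scal c (tens_mult s t)"
  "tens_mult s (t + t') = tens_mult s t + tens_mult s t'" "tens_mult s (scal c t) = scal c (tens_mult s t)"
  "tens_mult s (sum h A) = (\<Sum>x\<in>A. tens_mult s (h x))" "tens_mult (sum h A) t = (\<Sum>x\<in>A. tens_mult (h x) t)"
  "tens_mult s 0 = 0" "tens_mult 0 t = 0"
  by (simp_all add: tens_mult_def bilinear_simps)

lemma tens_mult_tens:
  "tens_mult (tens p q) (tens p' q') =
    (if ptgt p = psrc p' \<and> ptgt q = psrc q' then tens (concat_path p p') (concat_path q q') else 0)"
  by (simp add: tens_mult_def tens_def)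

section \<open>The Leibniz rule on cyclic words\<close>

locale leibniz_bracket =
  fixes P :: "('v, 'e) dpath set" and br :: "('v, 'e) bracket" and h :: "('v, 'e) mor"
  assumes hom: "bracket_hom P br" and leibniz: "bracket_leibniz P br"
    and h: "Poly_Mapping.keys h \<subseteq> P"
begin

definition cyc :: "('v, 'e) mor \<Rightarrow> ('v, 'e) mor \<Rightarrow> ('v, 'e) mor" where
  "cyc f m = insert_mult m (extend_bilinear br f h)"

lemma cyc_simps:
  "cyc (f + g) m = cyc f m + cyc g m" "cyc (scal c f) m = scal c (cyc f m)" "cyc 0 m = 0"
  "cyc f (m + m') = cyc f m + cyc f m'" "cyc f (scal c m) = scal c (cyc f m)" "cyc f 0 = 0"
  "cyc (sum u A) m = (\<Sum>x\<in>A. cyc (u x) m)" "cyc f (sum u A) = (\<Sum>x\<in>A. cyc f (u x))"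
  by (simp_all add: cyc_def insert_mult_simps bilinear_simps insert_mult_sum)

lemma bracket_keys:
  assumes "p \<in> P" "r \<in> P" "(x, y) \<in> Poly_Mapping.keys (br p r)"
  shows "psrc x = psrc r" "ptgt x = ptgt p" "psrc y = psrc p" "ptgt y = ptgt r" "x \<in> P" "y \<in> P"
  using hom assms unfolding bracket_hom_def hom_paths_def by blast+

text \<open>In the Leibniz rule 1 \<otimes> p multiplies the second tensor factor from the left and
  q \<otimes> 1 the first from the right; in x m y this puts p behind m and q before it. If p and q
  are not composable, everything vanishes by the hom spaces of the bracket.\<close>

lemma cyc_mult_basis:
  assumes p: "p \<in> P" and q: "q \<in> P" and r: "r \<in> P"
  shows "insert_mult m (extend_linear (\<lambda>z. br z r) (path_mult p q)) =
    insert_mult (mor_mult m (basis p)) (br q r) + insert_mult (mor_mult (basis q) m) (br p r)"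
proof -
  have 1: "insert_mult (mor_mult m (basis p)) (br q r) =
      (if ptgt p = psrc q then insert_mult m (tens_mult (tens (id_path (psrc r)) p) (br q r)) else 0)"
    (is "?L (br q r) = ?R (br q r)")
  proof (rule linear_eqI[of ?L ?R])
    fix z assume z: "z \<in> Poly_Mapping.keys (br q r)"
    obtain x y where xy: "z = (x, y)" by (cases z)
    note k = bracket_keys[OF q r z[unfolded xy]]
    have x: "concat_path (id_path (psrc r)) x = x"
      using k(1) by (auto simp: concat_path_def id_path_def psrc_def ptgt_def prod_eq_iff)
    have L: "?L (basis z) = mor_mult (mor_mult (basis x) m) (path_mult p y)"
      by (simp add: xy insert_mult_def mor_mult_assoc mor_mult_basis)
    show "?L (basis z) = ?R (basis z)"
    proof (cases "ptgt p = psrc q")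
      case True
      have "?R (basis z) = insert_mult m (tens x (concat_path p y))"
        using True k x tens_mult_tens[of "id_path (psrc r)" p x y] by (simp add: xy tens_def id_path_def psrc_def ptgt_def)
      then show ?thesis unfolding L using True k by (simp add: insert_mult_def tens_def path_mult_def)
    next
      case False
      then show ?thesis unfolding L using k by (simp add: path_mult_def)
    qed
  qed (simp_all add: insert_mult_simps tens_mult_simps)
  have 2: "insert_mult (mor_mult (basis q) m) (br p r) =
      (if ptgt p = psrc q then insert_mult m (tens_mult (br p r) (tens q (id_path (ptgt r)))) else 0)"
    (is "?L (br p r) = ?R (br p r)")
  proof (rule linear_eqI[of ?L ?R])
    fix z assume z: "z \<in> Poly_Mapping.keys (br p r)"
    obtain x y where xy: "z = (x, y)" by (cases z)
    note k = bracket_keys[OF p r z[unfolded xy]]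
    have y: "concat_path y (id_path (ptgt r)) = y"
      using k(4) by (auto simp: concat_path_def id_path_def psrc_def ptgt_def prod_eq_iff)
    have L: "?L (basis z) = mor_mult (mor_mult (path_mult x q) m) (basis y)"
      by (simp add: xy insert_mult_def mor_mult_assoc flip: mor_mult_basis)
    show "?L (basis z) = ?R (basis z)"
    proof (cases "ptgt p = psrc q")
      case True
      have "?R (basis z) = insert_mult m (tens (concat_path x q) y)"
        using True k y tens_mult_tens[of x y q "id_path (ptgt r)"] by (simp add: xy tens_def id_path_def psrc_def ptgt_def)
      then show ?thesis unfolding L using True k by (simp add: insert_mult_def tens_def path_mult_def)
    next
      case False
      then show ?thesis unfolding L using k by (simp add: path_mult_def)
    qed
  qed (simp_all add: insert_mult_simps tens_mult_simps)
  show ?thesis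
  proof (cases "ptgt p = psrc q")
    case True
    then have "br (concat_path p q) r = tens_mult (tens (id_path (psrc r)) p) (br q r) + tens_mult (br p r) (tens q (id_path (ptgt r)))"
      using leibniz p q r unfolding bracket_leibniz_def by blast
    then show ?thesis unfolding 1 2 using True by (simp add: path_mult_def insert_mult_simps)
  qed (simp add: 1 2 path_mult_def insert_mult_simps)
qed

lemma cyc_mult:
  assumes f: "Poly_Mapping.keys f \<subseteq> P" and g: "Poly_Mapping.keys g \<subseteq> P"
  shows "cyc (mor_mult f g) m = cyc g (mor_mult m f) + cyc f (mor_mult g m)"
proof (rule linear_eqI[of "\<lambda>f. cyc (mor_mult f g) m" "\<lambda>f. cyc g (mor_mult m f) + cyc f (mor_mult g m)"])
  fix p assume p: "p \<in> Poly_Mapping.keys f"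
  show "cyc (mor_mult (basis p) g) m = cyc g (mor_mult m (basis p)) + cyc (basis p) (mor_mult g m)"
  proof (rule linear_eqI[of "\<lambda>g. cyc (mor_mult (basis p) g) m" "\<lambda>g. cyc g (mor_mult m (basis p)) + cyc (basis p) (mor_mult g m)"])
    fix q assume q: "q \<in> Poly_Mapping.keys g"
    let ?L = "\<lambda>h. insert_mult m (extend_bilinear br (path_mult p q) h)"
    let ?R = "\<lambda>h. insert_mult (mor_mult m (basis p)) (extend_bilinear br (basis q) h) +
      insert_mult (mor_mult (basis q) m) (extend_bilinear br (basis p) h)"
    have "?L h = ?R h"
    proof (rule linear_eqI[of ?L ?R])
      fix r assume "r \<in> Poly_Mapping.keys h"
      then have r: "r \<in> P" using h by blast
      have "extend_bilinear br (path_mult p q) (basis r) = extend_linear (\<lambda>z. br z r) (path_mult p q)"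
        by (simp add: extend_bilinear_def)
      then show "?L (basis r) = ?R (basis r)" using cyc_mult_basis[of p q r m] p q f g r by auto
    qed (simp_all add: bilinear_simps insert_mult_simps scal_add)
    then show "cyc (mor_mult (basis p) (basis q)) m = cyc (basis q) (mor_mult m (basis p)) + cyc (basis p) (mor_mult (basis q) m)"
      by (simp add: cyc_def mor_mult_basis)
  qed (simp_all add: cyc_simps mor_mult_simps scal_add)
qed (simp_all add: cyc_simps mor_mult_simps scal_add)

text \<open>The first tensor factor ends where the loop does, so inserting the identity of
  \<open>v\<close> changes nothing.\<close>

lemma tens_concat_bracket:
  assumes f: "Poly_Mapping.keys f \<subseteq> P" "\<And>p. p \<in> Poly_Mapping.keys f \<Longrightarrow> psrc p = v \<and> ptgt p = v"
  shows "tens_concat (extend_bilinear br f h) = cyc f (basis (id_path v))"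
  unfolding cyc_def
proof (rule linear_eqI[of "\<lambda>f. tens_concat (extend_bilinear br f h)" "\<lambda>f. insert_mult (basis (id_path v)) (extend_bilinear br f h)"])
  fix p assume p: "p \<in> Poly_Mapping.keys f"
  show "tens_concat (extend_bilinear br (basis p) h) = insert_mult (basis (id_path v)) (extend_bilinear br (basis p) h)"
  proof (rule linear_eqI[of "\<lambda>h. tens_concat (extend_bilinear br (basis p) h)" "\<lambda>h. insert_mult (basis (id_path v)) (extend_bilinear br (basis p) h)"])
    fix r assume "r \<in> Poly_Mapping.keys h"
    then have r: "r \<in> P" using h by blast
    have "tens_concat (br p r) = insert_mult (basis (id_path v)) (br p r)"
    proof (rule linear_eqI[of tens_concat "insert_mult (basis (id_path v))"])
      fix z assume z: "z \<in> Poly_Mapping.keys (br p r)"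
      obtain x y where xy: "z = (x, y)" by (cases z)
      have "ptgt x = v" using bracket_keys[OF _ r z[unfolded xy]] p f by auto
      then have "mor_mult (basis x) (basis (id_path v)) = basis x"
        by (intro mor_mult_id_right) simp
      then show "tens_concat (basis z) = insert_mult (basis (id_path v)) (basis z)"
        by (simp add: xy tens_concat_def insert_mult_def mor_mult_basis[of x y])
    qed (simp_all add: tens_concat_def extend_linear_add extend_linear_scal insert_mult_simps)
    then show "tens_concat (extend_bilinear br (basis p) (basis r)) = insert_mult (basis (id_path v)) (extend_bilinear br (basis p) (basis r))"
      by simp
  qed (simp_all add: tens_concat_def extend_linear_add extend_linear_scal insert_mult_simps bilinear_simps)
qed (simp_all add: tens_concat_def extend_linear_add extend_linear_scal insert_mult_simps bilinear_simps)

end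

lemma sum_rotate3:
  "(\<Sum>a\<in>A. \<Sum>b\<in>B. \<Sum>c\<in>C. F a b c) = (\<Sum>c\<in>C. \<Sum>a\<in>A. \<Sum>b\<in>B. F a b c)"
proof -
  have "(\<Sum>a\<in>A. \<Sum>b\<in>B. \<Sum>c\<in>C. F a b c) = (\<Sum>a\<in>A. \<Sum>c\<in>C. \<Sum>b\<in>B. F a b c)"
    by (rule sum.cong[OF refl], rule sum.swap)
  also have "\<dots> = (\<Sum>c\<in>C. \<Sum>a\<in>A. \<Sum>b\<in>B. F a b c)" by (rule sum.swap)
  finally show ?thesis .
qed

lemma mor_mult_sums: "mor_mult (sum h A) g = (\<Sum>x\<in>A. mor_mult (h x) g)" "mor_mult f (sum h A) = (\<Sum>x\<in>A. mor_mult f (h x))"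
  by (simp_all add: mor_mult_simps)

lemma mat_mult_assoc: "mat_mult \<Gamma> (mat_mult \<Gamma> X Y) Z a b = mat_mult \<Gamma> X (mat_mult \<Gamma> Y Z) a b"
proof -
  have "(\<Sum>c\<in>{1..width \<Gamma>}. \<Sum>d\<in>{1..width \<Gamma>}. mor_mult (mor_mult (X a d) (Y d c)) (Z c b)) =
    (\<Sum>d\<in>{1..width \<Gamma>}. \<Sum>c\<in>{1..width \<Gamma>}. mor_mult (X a d) (mor_mult (Y d c) (Z c b)))"
    by (subst sum.swap) (simp add: mor_mult_assoc)
  then show ?thesis by (simp add: mat_mult_def mor_mult_sums)
qed

lemma mat_mult_cong:
  assumes "\<And>c. c \<in> {1..width \<Gamma>} \<Longrightarrow> X a c = X' a c" "\<And>c. c \<in> {1..width \<Gamma>} \<Longrightarrow> Y c b = Y' c b"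
  shows "mat_mult \<Gamma> X Y a b = mat_mult \<Gamma> X' Y' a b"
  using assms by (simp add: mat_mult_def)

section \<open>Matrices of paths, their powers and the bracket with a trace\<close>

locale path_matrix =
  fixes \<Gamma> :: "('v, 'e) cyl_network" and X :: "('v, 'e) mor_matrix"
  assumes entries: "\<And>a b. a \<in> {1..width \<Gamma>} \<Longrightarrow> b \<in> {1..width \<Gamma>} \<Longrightarrow>
    X a b \<in> hom_space (torus_paths \<Gamma>) (source \<Gamma> a) (source \<Gamma> b)"
    and closed: "\<And>p q. p \<in> torus_paths \<Gamma> \<Longrightarrow> q \<in> torus_paths \<Gamma> \<Longrightarrow> ptgt p = psrc q \<Longrightarrow> concat_path p q \<in> torus_paths \<Gamma>"
    and ids: "\<And>a. a \<in> {1..width \<Gamma>} \<Longrightarrow> id_path (source \<Gamma> a) \<in> torus_paths \<Gamma>"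
begin

abbreviation "N \<equiv> {1..width \<Gamma>}"
abbreviation "P \<equiv> torus_paths \<Gamma>"
abbreviation "s \<equiv> source \<Gamma>"
abbreviation "pow \<equiv> mat_power \<Gamma> X"

lemma mult_hom: "f \<in> hom_space P u v \<Longrightarrow> g \<in> hom_space P v w \<Longrightarrow> mor_mult f g \<in> hom_space P u w"
proof -
  assume f: "f \<in> hom_space P u v" and g: "g \<in> hom_space P v w"
  have "Poly_Mapping.keys (mor_mult f g) \<subseteq> hom_paths P u w"
  proof (rule keys_mor_mult)
    fix p q assume "p \<in> Poly_Mapping.keys f" "q \<in> Poly_Mapping.keys g" "ptgt p = psrc q"
    moreover from this have "p \<in> hom_paths P u v" "q \<in> hom_paths P v w"
      using f g by (auto simp: hom_space_def)
    ultimately show "concat_path p q \<in> hom_paths P u w"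
      using closed by (simp add: hom_paths_def)
  qed
  then show ?thesis by (simp add: hom_space_def)
qed

lemma sum_hom: "(\<And>x. x \<in> A \<Longrightarrow> h x \<in> hom_space P u v) \<Longrightarrow> sum h A \<in> hom_space P u v"
  unfolding hom_space_def using keys_sum[of h A] by blast

lemma pow_0: "pow 0 = mat_one \<Gamma>" and pow_Suc: "pow (Suc k) = mat_mult \<Gamma> X (pow k)"
  by (simp_all add: mat_power_def)

lemma pow_entries: "a \<in> N \<Longrightarrow> b \<in> N \<Longrightarrow> pow k a b \<in> hom_space P (s a) (s b)"
proof (induction k arbitrary: a)
  case 0
  then show ?case using ids[of a]
    by (auto simp: pow_0 mat_one_def hom_space_def hom_paths_def id_path_def psrc_def ptgt_def)
next
  case (Suc k)
  show ?case unfolding pow_Suc mat_mult_def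
    by (rule sum_hom, rule mult_hom[OF entries[OF Suc.prems(1)] Suc.IH[OF _ Suc.prems(2)]])
qed

lemma homD: "f \<in> hom_space P u v \<Longrightarrow> Poly_Mapping.keys f \<subseteq> P"
  "f \<in> hom_space P u v \<Longrightarrow> p \<in> Poly_Mapping.keys f \<Longrightarrow> psrc p = u"
  "f \<in> hom_space P u v \<Longrightarrow> p \<in> Poly_Mapping.keys f \<Longrightarrow> ptgt p = v"
  by (auto simp: hom_space_def hom_paths_def)

lemma one_mult:
  assumes "a \<in> N" "Y a b \<in> hom_space P (s a) (s b)"
  shows "mat_mult \<Gamma> (mat_one \<Gamma>) Y a b = Y a b"
proof -
  have "mat_mult \<Gamma> (mat_one \<Gamma>) Y a b = (\<Sum>c\<in>N. if c = a then mor_mult (basis (id_path (s a))) (Y a b) else 0)"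
    unfolding mat_mult_def mat_one_def by (intro sum.cong) auto
  also have "\<dots> = mor_mult (basis (id_path (s a))) (Y a b)" using assms(1) by simp
  also have "\<dots> = Y a b" using homD(2)[OF assms(2)] by (intro mor_mult_id_left)
  finally show ?thesis .
qed

lemma mult_one:
  assumes "b \<in> N" "Y a b \<in> hom_space P (s a) (s b)"
  shows "mat_mult \<Gamma> Y (mat_one \<Gamma>) a b = Y a b"
proof -
  have "mat_mult \<Gamma> Y (mat_one \<Gamma>) a b = (\<Sum>c\<in>N. if c = b then mor_mult (Y a b) (basis (id_path (s b))) else 0)"
    unfolding mat_mult_def mat_one_def by (intro sum.cong) auto
  also have "\<dots> = mor_mult (Y a b) (basis (id_path (s b)))" using assms(1) by simp
  also have "\<dots> = Y a b" using homD(3)[OF assms(2)] by (intro mor_mult_id_right)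
  finally show ?thesis .
qed

lemma pow_1: "a \<in> N \<Longrightarrow> b \<in> N \<Longrightarrow> pow 1 a b = X a b"
  using mult_one[of b X a] entries[of a b] by (simp add: pow_Suc pow_0)

lemma pow_add: "a \<in> N \<Longrightarrow> b \<in> N \<Longrightarrow> mat_mult \<Gamma> (pow k) (pow m) a b = pow (k + m) a b"
proof (induction k arbitrary: a)
  case 0
  then show ?case using one_mult[of a "pow m" b] pow_entries[of a b m] by (simp add: pow_0)
next
  case (Suc k)
  have "mat_mult \<Gamma> (pow (Suc k)) (pow m) a b = mat_mult \<Gamma> X (mat_mult \<Gamma> (pow k) (pow m)) a b"
    unfolding pow_Suc by (rule mat_mult_assoc)
  also have "\<dots> = mat_mult \<Gamma> X (pow (k + m)) a b" using Suc by (intro mat_mult_cong) auto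
  finally show ?case by (simp add: pow_Suc)
qed

lemma pow_mult_right: "a \<in> N \<Longrightarrow> b \<in> N \<Longrightarrow> mat_mult \<Gamma> (pow k) X a b = pow (Suc k) a b"
  using pow_add[of a b k 1] mat_mult_cong[of \<Gamma> "pow k" a "pow k" X b "pow 1"] pow_1 by simp

end

locale path_matrix_bracket = path_matrix \<Gamma> X + leibniz_bracket "torus_paths \<Gamma>" br h
  for \<Gamma> :: "('v, 'e) cyl_network" and X and br h
begin

text \<open>The pattern of a trace: one entry is bracketed while the second matrix closes the
  cycle.\<close>

definition cyc_mat :: "('v, 'e) mor_matrix \<Rightarrow> ('v, 'e) mor_matrix \<Rightarrow> ('v, 'e) mor" where
  "cyc_mat Y Z = (\<Sum>a\<in>N. \<Sum>c\<in>N. cyc (Y a c) (Z c a))"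

lemma cyc_mat_cong:
  assumes "\<And>a c. a \<in> N \<Longrightarrow> c \<in> N \<Longrightarrow> Y a c = Y' a c" "\<And>a c. a \<in> N \<Longrightarrow> c \<in> N \<Longrightarrow> Z a c = Z' a c"
  shows "cyc_mat Y Z = cyc_mat Y' Z'"
  unfolding cyc_mat_def using assms by simp

lemma cyc_mat_mult:
  assumes Y: "\<And>a c. a \<in> N \<Longrightarrow> c \<in> N \<Longrightarrow> Y a c \<in> hom_space P (s a) (s c)"
    and Z: "\<And>a c. a \<in> N \<Longrightarrow> c \<in> N \<Longrightarrow> Z a c \<in> hom_space P (s a) (s c)"
  shows "cyc_mat (mat_mult \<Gamma> Y Z) W = cyc_mat Z (mat_mult \<Gamma> W Y) + cyc_mat Y (mat_mult \<Gamma> Z W)"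
proof -
  have "cyc_mat (mat_mult \<Gamma> Y Z) W = (\<Sum>a\<in>N. \<Sum>c\<in>N. \<Sum>d\<in>N. cyc (mor_mult (Y a d) (Z d c)) (W c a))"
    by (simp add: cyc_mat_def mat_mult_def cyc_simps)
  also have "\<dots> = (\<Sum>a\<in>N. \<Sum>c\<in>N. \<Sum>d\<in>N. cyc (Z d c) (mor_mult (W c a) (Y a d)) + cyc (Y a d) (mor_mult (Z d c) (W c a)))"
    using homD(1)[OF Y] homD(1)[OF Z] by (intro sum.cong refl cyc_mult) auto
  also have "\<dots> = (\<Sum>a\<in>N. \<Sum>c\<in>N. \<Sum>d\<in>N. cyc (Z d c) (mor_mult (W c a) (Y a d))) +
      (\<Sum>a\<in>N. \<Sum>c\<in>N. \<Sum>d\<in>N. cyc (Y a d) (mor_mult (Z d c) (W c a)))"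
    by (simp add: sum.distrib)
  also have "(\<Sum>a\<in>N. \<Sum>c\<in>N. \<Sum>d\<in>N. cyc (Z d c) (mor_mult (W c a) (Y a d))) = cyc_mat Z (mat_mult \<Gamma> W Y)"
  proof -
    have "(\<Sum>a\<in>N. \<Sum>c\<in>N. \<Sum>d\<in>N. cyc (Z d c) (mor_mult (W c a) (Y a d))) =
      (\<Sum>d\<in>N. \<Sum>a\<in>N. \<Sum>c\<in>N. cyc (Z d c) (mor_mult (W c a) (Y a d)))" by (rule sum_rotate3)
    also have "\<dots> = (\<Sum>d\<in>N. \<Sum>c\<in>N. \<Sum>a\<in>N. cyc (Z d c) (mor_mult (W c a) (Y a d)))"
      by (rule sum.cong[OF refl], rule sum.swap)
    finally show ?thesis by (simp add: cyc_mat_def mat_mult_def cyc_simps)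
  qed
  also have "(\<Sum>a\<in>N. \<Sum>c\<in>N. \<Sum>d\<in>N. cyc (Y a d) (mor_mult (Z d c) (W c a))) = cyc_mat Y (mat_mult \<Gamma> Z W)"
  proof -
    have "(\<Sum>a\<in>N. \<Sum>c\<in>N. \<Sum>d\<in>N. cyc (Y a d) (mor_mult (Z d c) (W c a))) =
      (\<Sum>a\<in>N. \<Sum>d\<in>N. \<Sum>c\<in>N. cyc (Y a d) (mor_mult (Z d c) (W c a)))"
      by (rule sum.cong[OF refl], rule sum.swap)
    then show ?thesis by (simp add: cyc_mat_def mat_mult_def cyc_simps)
  qed
  finally show ?thesis .
qed

text \<open>Splitting off one factor \<open>X\<close> moves the others to the second argument, where
  they join the power already present; each of the k + 1 factors contributes the same term.\<close>

lemma cyc_mat_pow: "cyc_mat (pow (Suc k)) (pow m) = scal (of_nat (Suc k)) (cyc_mat X (pow (k + m)))"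
proof (induction k arbitrary: m)
  case 0
  show ?case using cyc_mat_cong[of "pow 1" X "pow m" "pow m"] pow_1 by simp
next
  case (Suc k)
  have "cyc_mat (pow (Suc (Suc k))) (pow m) = cyc_mat (mat_mult \<Gamma> X (pow (Suc k))) (pow m)"
    unfolding pow_Suc[of "Suc k"] ..
  also have "\<dots> = cyc_mat (pow (Suc k)) (mat_mult \<Gamma> (pow m) X) + cyc_mat X (mat_mult \<Gamma> (pow (Suc k)) (pow m))"
    by (rule cyc_mat_mult) (auto intro: entries pow_entries)
  also have "cyc_mat (pow (Suc k)) (mat_mult \<Gamma> (pow m) X) = cyc_mat (pow (Suc k)) (pow (Suc m))"
    by (rule cyc_mat_cong) (auto simp: pow_mult_right)
  also have "cyc_mat X (mat_mult \<Gamma> (pow (Suc k)) (pow m)) = cyc_mat X (pow (Suc k + m))"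
    by (rule cyc_mat_cong) (auto simp: pow_add)
  also have "cyc_mat (pow (Suc k)) (pow (Suc m)) = scal (of_nat (Suc k)) (cyc_mat X (pow (Suc k + m)))"
    using Suc.IH[of "Suc m"] by simp
  also have "scal (of_nat (Suc k)) (cyc_mat X (pow (Suc k + m))) + cyc_mat X (pow (Suc k + m)) =
    scal (of_nat (Suc (Suc k))) (cyc_mat X (pow (Suc k + m)))"
    using pm.scale_left_distrib[of "of_nat (Suc k)" 1 "cyc_mat X (pow (Suc k + m))"] by (simp add: add.commute)
  finally show ?case .
qed

lemma tens_concat_trace:
  "tens_concat (extend_bilinear br (mat_trace \<Gamma> (pow k)) h) = cyc_mat (pow k) (pow 0)"
proof -
  have "tens_concat (extend_bilinear br (mat_trace \<Gamma> (pow k)) h) =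
    (\<Sum>a\<in>N. tens_concat (extend_bilinear br (pow k a a) h))"
    by (simp add: mat_trace_def bilinear_simps tens_concat_def extend_linear_sum)
  also have "\<dots> = (\<Sum>a\<in>N. cyc (pow k a a) (basis (id_path (s a))))"
  proof (intro sum.cong refl tens_concat_bracket)
    fix a assume a: "a \<in> N"
    show "Poly_Mapping.keys (pow k a a) \<subseteq> P" using homD(1)[OF pow_entries[OF a a]] .
    show "psrc p = s a \<and> ptgt p = s a" if "p \<in> Poly_Mapping.keys (pow k a a)" for p
      using homD(2,3)[OF pow_entries[OF a a] that] by simp
  qed
  also have "\<dots> = (\<Sum>a\<in>N. \<Sum>c\<in>N. if c = a then cyc (pow k a a) (basis (id_path (s a))) else 0)"
    by simp
  also have "\<dots> = cyc_mat (pow k) (pow 0)"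
    unfolding cyc_mat_def pow_0 mat_one_def by (intro sum.cong refl) (auto simp: cyc_simps)
  finally show ?thesis .
qed

text \<open>By \<open>cyc_mult\<close> the bracket with fg is \<open>cyc g f + cyc f g\<close>,
  symmetric in f and g. Hence the induced bracket does not depend on the representative.\<close>

lemma tens_concat_commutator:
  assumes "z \<in> commutator_space \<Gamma>"
  shows "tens_concat (extend_bilinear br z h) = 0"
  using assms unfolding commutator_space_def
proof (induction rule: pm.span_induct)
  case (step z)
  then obtain f g u v where z: "z = mor_mult f g - mor_mult g f" and uv: "u \<in> sources \<Gamma>" "v \<in> sources \<Gamma>"
    and f: "f \<in> hom_space P u v" and g: "g \<in> hom_space P v u" by blast
  have loop: "tens_concat (extend_bilinear br (mor_mult f g) h) = cyc g f + cyc f g"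
    if f: "f \<in> hom_space P u v" and g: "g \<in> hom_space P v u" for f g u v
  proof -
    have fg: "mor_mult f g \<in> hom_space P u u" using mult_hom[OF f g] .
    have "tens_concat (extend_bilinear br (mor_mult f g) h) = cyc (mor_mult f g) (basis (id_path u))"
      using homD[OF fg] by (intro tens_concat_bracket) auto
    also have "\<dots> = cyc g (mor_mult (basis (id_path u)) f) + cyc f (mor_mult g (basis (id_path u)))"
      by (rule cyc_mult[OF homD(1)[OF f] homD(1)[OF g]])
    also have "mor_mult (basis (id_path u)) f = f" using homD(2)[OF f] by (rule mor_mult_id_left)
    also have "mor_mult g (basis (id_path u)) = g" using homD(3)[OF g] by (rule mor_mult_id_right)
    finally show ?thesis .
  qed
  show ?case
    unfolding z extend_bilinear_diff_left using loop[OF f g] loop[OF g f]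
    by (simp add: tens_concat_def extend_linear_diff add.commute)
next
  case base
  show ?case unfolding pm.subspace_def
    by (auto simp: bilinear_simps tens_concat_def extend_linear_add extend_linear_scal)
qed

lemma loops_pow_trace: "mat_trace \<Gamma> (pow k) \<in> loops \<Gamma>"
proof -
  have "Poly_Mapping.keys (pow k a a) \<subseteq> (\<Union>v\<in>sources \<Gamma>. hom_paths P v v)" if "a \<in> N" for a
    using pow_entries[OF that that, of k] that unfolding hom_space_def sources_def by blast
  then have "Poly_Mapping.keys (\<Sum>a\<in>N. pow k a a) \<subseteq> (\<Union>v\<in>sources \<Gamma>. hom_paths P v v)"
    by (intro order.trans[OF keys_sum] UN_least)
  then show ?thesis unfolding mat_trace_def loops_def by blast
qed

lemma induced_bracket_trace:
  "induced_bracket br (cyclic_class \<Gamma> (mat_trace \<Gamma> (pow (Suc k)))) h = scal (of_nat (Suc k)) (cyc_mat X (pow k))"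
proof -
  let ?t = "mat_trace \<Gamma> (pow (Suc k))"
  have same: "tens_concat (extend_bilinear br f h) = tens_concat (extend_bilinear br ?t h)"
    if "f \<in> cyclic_class \<Gamma> ?t" for f
  proof -
    have "?t - f \<in> commutator_space \<Gamma>" using that by (auto simp: cyclic_class_def cyclic_rel_def)
    from tens_concat_commutator[OF this] show ?thesis
      by (simp add: extend_bilinear_diff_left tens_concat_def extend_linear_diff)
  qed
  \<comment> \<open>The class is nonempty, so the definite description in
    \<open>induced_bracket\<close> denotes a unique value.\<close>
  have mem: "?t \<in> cyclic_class \<Gamma> ?t"
    using loops_pow_trace by (auto simp: cyclic_class_def cyclic_rel_def commutator_space_def intro: pm.span_zero)
  have "induced_bracket br (cyclic_class \<Gamma> ?t) h = tens_concat (extend_bilinear br ?t h)"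
    unfolding induced_bracket_def
  proof (rule the_equality)
    show "\<forall>f\<in>cyclic_class \<Gamma> ?t. tens_concat (extend_bilinear br f h) = tens_concat (extend_bilinear br ?t h)"
      using same by (rule ballI)
    fix z assume "\<forall>f\<in>cyclic_class \<Gamma> ?t. tens_concat (extend_bilinear br f h) = z"
    from bspec[OF this mem] show "z = tens_concat (extend_bilinear br ?t h)" by (rule sym)
  qed
  also have "\<dots> = cyc_mat (pow (Suc k)) (pow 0)" by (rule tens_concat_trace)
  also have "\<dots> = scal (of_nat (Suc k)) (cyc_mat X (pow k))" using cyc_mat_pow[of k 0] by simp
  finally show ?thesis .
qed

text \<open>\<open>Y\<close> plays the role of \<open>B(\<mu>)\<close>, whose \<open>(a, b)\<close> entry is \<open>h\<close>.\<close>

lemma induced_bracket_lax: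
  assumes a: "a \<in> N" and b: "b \<in> N"
    and r: "\<And>i j. i \<in> N \<Longrightarrow> j \<in> N \<Longrightarrow> extend_bilinear br (X i j) h =
      scal (rho i a) (mor_tensor (X a j) (Y i b)) - scal (rho b j) (mor_tensor (Y a j) (X i b))"
  shows "induced_bracket br (cyclic_class \<Gamma> (mat_trace \<Gamma> (pow (Suc k)))) h =
    mat_mult \<Gamma> (\<lambda>a i. scal (of_nat (Suc k) * rho i a) (pow (Suc k) a i)) Y a b -
    mat_mult \<Gamma> Y (\<lambda>j b. scal (of_nat (Suc k) * rho b j) (pow (Suc k) j b)) a b"
proof -
  let ?c = "of_nat (Suc k) :: scalar"
  have "cyc_mat X (pow k) = (\<Sum>i\<in>N. \<Sum>j\<in>N. scal (rho i a) (mor_mult (mor_mult (X a j) (pow k j i)) (Y i b)) -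
      scal (rho b j) (mor_mult (mor_mult (Y a j) (pow k j i)) (X i b)))"
    unfolding cyc_mat_def cyc_def by (intro sum.cong refl) (simp add: r insert_mult_simps insert_mult_mor_tensor)
  also have "\<dots> = (\<Sum>i\<in>N. \<Sum>j\<in>N. scal (rho i a) (mor_mult (mor_mult (X a j) (pow k j i)) (Y i b))) -
      (\<Sum>j\<in>N. \<Sum>i\<in>N. scal (rho b j) (mor_mult (mor_mult (Y a j) (pow k j i)) (X i b)))"
    unfolding sum_subtractf by (subst (2) sum.swap) (rule refl)
  also have "(\<Sum>i\<in>N. \<Sum>j\<in>N. scal (rho i a) (mor_mult (mor_mult (X a j) (pow k j i)) (Y i b))) =
      (\<Sum>i\<in>N. scal (rho i a) (mor_mult (pow (Suc k) a i) (Y i b)))"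
    by (simp add: pow_Suc mat_mult_def mor_mult_sums scal_sum)
  also have "(\<Sum>j\<in>N. \<Sum>i\<in>N. scal (rho b j) (mor_mult (mor_mult (Y a j) (pow k j i)) (X i b))) =
      (\<Sum>j\<in>N. scal (rho b j) (mor_mult (Y a j) (pow (Suc k) j b)))"
  proof (rule sum.cong[OF refl])
    fix j assume "j \<in> N"
    then have "pow (Suc k) j b = (\<Sum>i\<in>N. mor_mult (pow k j i) (X i b))"
      using pow_mult_right[of j b k] b by (simp add: mat_mult_def)
    then show "(\<Sum>i\<in>N. scal (rho b j) (mor_mult (mor_mult (Y a j) (pow k j i)) (X i b))) =
        scal (rho b j) (mor_mult (Y a j) (pow (Suc k) j b))"
      by (simp add: mor_mult_sums scal_sum mor_mult_assoc)
  qed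
  finally have "scal ?c (cyc_mat X (pow k)) =
     (\<Sum>i\<in>N. scal (?c * rho i a) (mor_mult (pow (Suc k) a i) (Y i b))) -
     (\<Sum>j\<in>N. scal (?c * rho b j) (mor_mult (Y a j) (pow (Suc k) j b)))"
    by (simp only: scal_diff scal_sum scal_simps)
  then show ?thesis unfolding induced_bracket_trace mat_mult_def by (simp only: mor_mult_simps)
qed

end

section \<open>The bracket of two walks\<close>

lemma flip_tens: "flip (tens p q) = tens q p"
  by (simp add: flip_def tens_def)

lemma flip_simps: "flip (scal c t) = scal c (flip t)" "flip 0 = 0" "flip (s + t) = flip s + flip t"
  by (simp_all add: flip_def extend_linear_scal extend_linear_add)

lemma of_bool_sum_at: "finite A \<Longrightarrow> (\<Sum>v\<in>A. of_bool (v = w \<and> Q)) = (of_bool (w \<in> A \<and> Q) :: 'b :: comm_semiring_1)"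
proof -
  assume A: "finite A"
  have "(\<Sum>v\<in>A. of_bool (v = w \<and> Q)) = (\<Sum>v\<in>A. if v = w then (of_bool Q :: 'b) else 0)"
    by (intro sum.cong) auto
  also have "\<dots> = of_bool (w \<in> A \<and> Q)" using A by auto
  finally show ?thesis .
qed

context acyclic_cylinder begin

text \<open>There are no loops, so a vertex is not both tail and head of \<open>e\<close>; the two
  alternatives exclude each other and may be added.\<close>

lemma vertex_term_eq:
  assumes "e \<in> arcs G" "f \<in> arcs G"
  shows "vertex_term \<Gamma> v e f = scal (1/2 * of_bool (v = tail G e \<and> split_turn e f)) (tens (arc_path G e) (arc_path G f)) +
    scal (- 1/2 * of_bool (v = head G e \<and> merge_turn e f)) (tens (arc_path G f) (arc_path G e))"
proof -
  have 1: "(white \<Gamma> v \<and> e \<in> out_arcs G v \<and> f \<in> out_arcs G v \<and> (\<exists>g\<in>in_arcs G v. ccw_at \<Gamma> v e f g)) \<longleftrightarrow>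
      v = tail G e \<and> split_turn e f"
    using assms unfolding split_turn_def by auto
  have 2: "(black \<Gamma> v \<and> e \<in> in_arcs G v \<and> f \<in> in_arcs G v \<and> (\<exists>g\<in>out_arcs G v. ccw_at \<Gamma> v e f g)) \<longleftrightarrow>
      v = head G e \<and> merge_turn e f"
    using assms unfolding merge_turn_def by auto
  have 3: "\<not> ((v = tail G e \<and> split_turn e f) \<and> (v = head G e \<and> merge_turn e f))"
    using no_loop[OF assms(1)] by auto
  show ?thesis
    unfolding vertex_term_def Let_def 1 2 using 3 by auto
qed

text \<open>Only the tail of an edge can contribute as a white vertex and only its head as a black
  one; skew-symmetry turns the indicators into signs.\<close>

lemma edge_bracket_eq:
  assumes e: "e \<in> arcs G" and f: "f \<in> arcs G"
  shows "edge_bracket \<Gamma> e f = scal (of_int (split_sign e f) / 2) (tens (arc_path G e) (arc_path G f)) -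
    scal (of_int (merge_sign e f) / 2) (tens (arc_path G f) (arc_path G e))"
proof -
  let ?ef = "tens (arc_path G e) (arc_path G f)" and ?fe = "tens (arc_path G f) (arc_path G e)"
  have fin: "finite (internal \<Gamma>)" by (simp add: internal_def)
  have i: "split_turn e f \<Longrightarrow> tail G e \<in> internal \<Gamma>" "merge_turn e f \<Longrightarrow> head G e \<in> internal \<Gamma>" for e f
    by (auto simp: split_turn_def merge_turn_def white_def black_def)
  have "edge_bracket \<Gamma> e f = (\<Sum>v\<in>internal \<Gamma>.
      scal (1/2 * of_bool (v = tail G e \<and> split_turn e f) - 1/2 * of_bool (v = tail G f \<and> split_turn f e)) ?ef +
      scal (- 1/2 * of_bool (v = head G e \<and> merge_turn e f) + 1/2 * of_bool (v = head G f \<and> merge_turn f e)) ?fe)"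
    unfolding edge_bracket_def vertex_term_eq[OF e f] vertex_term_eq[OF f e] flip_simps flip_tens
    by (intro sum.cong refl) (simp add: pm.scale_left_distrib pm.scale_left_diff_distrib)
  also have "\<dots> = scal (1/2 * of_bool (split_turn e f) - 1/2 * of_bool (split_turn f e)) ?ef +
      scal (- 1/2 * of_bool (merge_turn e f) + 1/2 * of_bool (merge_turn f e)) ?fe"
  proof -
    have b: "of_bool (tail G e \<in> internal \<Gamma> \<and> split_turn e f) = (of_bool (split_turn e f) :: scalar)"
      "of_bool (head G e \<in> internal \<Gamma> \<and> merge_turn e f) = (of_bool (merge_turn e f) :: scalar)" for e f
      using i[of e f] by auto
    show ?thesis
      unfolding sum.distrib sum_scal[symmetric] sum_subtractf sum_distrib_left[symmetric] of_bool_sum_at[OF fin] b ..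
  qed
  also have "\<dots> = scal (of_int (split_sign e f) / 2) ?ef - scal (of_int (merge_sign e f) / 2) ?fe"
  proof -
    have "1/2 * of_bool (split_turn e f) - 1/2 * of_bool (split_turn f e) = (of_int (split_sign e f) / 2 :: scalar)"
      "- 1/2 * of_bool (merge_turn e f) + 1/2 * of_bool (merge_turn f e) = - (of_int (merge_sign e f) / 2 :: scalar)"
      by (simp_all add: split_sign_def merge_sign_def diff_divide_distrib)
    then show ?thesis by (simp only: pm.scale_minus_left add_uminus_conv_diff)
  qed
  finally show ?thesis .
qed

lemma sign_nonzero:
  "split_sign e f \<noteq> 0 \<Longrightarrow> tail G e = tail G f \<and> tail G e \<in> internal \<Gamma>"
  "merge_sign e f \<noteq> 0 \<Longrightarrow> head G e = head G f \<and> head G e \<in> internal \<Gamma>"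
proof -
  assume "split_sign e f \<noteq> 0"
  then have "split_turn e f \<or> split_turn f e" by (auto simp: split_sign_def)
  then show "tail G e = tail G f \<and> tail G e \<in> internal \<Gamma>" by (auto simp: split_turn_def white_def)
next
  assume "merge_sign e f \<noteq> 0"
  then have "merge_turn e f \<or> merge_turn f e" by (auto simp: merge_sign_def)
  then show "head G e = head G f \<and> head G e \<in> internal \<Gamma>" by (auto simp: merge_turn_def black_def)
qed

text \<open>Exchange of the parts behind two cuts. The results are genuine walks only if both cuts
  are at the same vertex; in \<open>corner_term\<close> the sign vanishes otherwise.\<close>

definition crossed_split :: "('v, 'e) dpath \<Rightarrow> ('v, 'e) dpath \<Rightarrow> nat \<Rightarrow> nat \<Rightarrow> ('v, 'e) tensor" where
  "crossed_split p q i j = tens (psrc q, take j (fst (snd q)) @ drop i (fst (snd p)), ptgt p)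
     (psrc p, take i (fst (snd p)) @ drop j (fst (snd q)), ptgt q)"

definition corner_term :: "('v, 'e) dpath \<Rightarrow> ('v, 'e) dpath \<Rightarrow> nat \<Rightarrow> nat \<Rightarrow> ('v, 'e) tensor" where
  "corner_term p q i j =
     scal (of_int (split_sign (fst (snd p) ! i) (fst (snd q) ! j)) / 2) (crossed_split p q i j) -
     scal (of_int (merge_sign (fst (snd p) ! i) (fst (snd q) ! j)) / 2) (crossed_split p q (Suc i) (Suc j))"

lemma psrc_triple [simp]: "psrc (x, p, y) = x" "ptgt (x, p, y) = y"
  by (simp_all add: psrc_def ptgt_def)

lemma tens_mult_diff_left: "tens_mult (s - t) r = tens_mult s r - tens_mult t r"
  by (simp add: tens_mult_def extend_bilinear_diff_left)

lemma tens_mult_diff_right: "tens_mult r (s - t) = tens_mult r s - tens_mult r t"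
proof -
  have "tens_mult r ((s - t) + t) = tens_mult r (s - t) + tens_mult r t" by (rule tens_mult_simps)
  then show ?thesis by simp
qed

context
  fixes br :: "('v, 'e) bracket"
  assumes standard: "standard_bracket \<Gamma> br"
begin

lemma br_hom: "bracket_hom (dpaths G) br" and br_skew: "bracket_skew (dpaths G) br"
  and br_leibniz: "bracket_leibniz (dpaths G) br"
  and br_arcs: "e \<in> arcs G \<Longrightarrow> f \<in> arcs G \<Longrightarrow> br (arc_path G e) (arc_path G f) = edge_bracket \<Gamma> e f"
  using standard by (auto simp: standard_bracket_def Let_def)

lemma in_dpaths: "(x, p, y) \<in> dpaths G \<longleftrightarrow> awalk x p y"
  by (simp add: dpaths_def)

text \<open>An identity is idempotent, so the Leibniz rule equates its bracket with twice
  itself.\<close>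

lemma br_id_left:
  assumes v: "v \<in> verts G" and h: "h \<in> dpaths G"
  shows "br (id_path v) h = 0"
proof -
  have i: "id_path v \<in> dpaths G" using v by (simp add: id_path_def in_dpaths awalk_Nil_iff)
  have sub: "Poly_Mapping.keys (br (id_path v) h) \<subseteq> hom_paths (dpaths G) (psrc h) v \<times> hom_paths (dpaths G) v (ptgt h)"
    using br_hom[unfolded bracket_hom_def, rule_format, OF i h] by (simp add: id_path_def)
  have "concat_path (id_path v) (id_path v) = id_path v" by (simp add: concat_path_def id_path_def)
  then have "br (id_path v) h = tens_mult (tens (id_path (psrc h)) (id_path v)) (br (id_path v) h) +
      tens_mult (br (id_path v) h) (tens (id_path v) (id_path (ptgt h)))"
    using br_leibniz i h unfolding bracket_leibniz_def by (metis id_path_def psrc_triple)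
  also have "tens_mult (tens (id_path (psrc h)) (id_path v)) (br (id_path v) h) = br (id_path v) h"
  proof (rule linear_eqI[of "tens_mult (tens (id_path (psrc h)) (id_path v))" "\<lambda>t. t"])
    fix z assume "z \<in> Poly_Mapping.keys (br (id_path v) h)"
    then have "z \<in> hom_paths (dpaths G) (psrc h) v \<times> hom_paths (dpaths G) v (ptgt h)"
      using sub by blast
    then show "tens_mult (tens (id_path (psrc h)) (id_path v)) (basis z) = basis z"
      using tens_mult_tens[of "id_path (psrc h)" "id_path v" "fst z" "snd z"]
      by (cases z) (auto simp: tens_def hom_paths_def id_path_def concat_path_def)
  qed (simp_all add: tens_mult_simps)
  also have "tens_mult (br (id_path v) h) (tens (id_path v) (id_path (ptgt h))) = br (id_path v) h"
  proof (rule linear_eqI[of "\<lambda>t. tens_mult t (tens (id_path v) (id_path (ptgt h)))" "\<lambda>t. t"])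
    fix z assume "z \<in> Poly_Mapping.keys (br (id_path v) h)"
    then have "z \<in> hom_paths (dpaths G) (psrc h) v \<times> hom_paths (dpaths G) v (ptgt h)"
      using sub by blast
    then show "tens_mult (basis z) (tens (id_path v) (id_path (ptgt h))) = basis z"
      using tens_mult_tens[of "fst z" "snd z" "id_path v" "id_path (ptgt h)"]
      by (cases z) (auto simp: tens_def hom_paths_def id_path_def concat_path_def)
  qed (simp_all add: tens_mult_simps)
  finally show ?thesis by simp
qed

lemma br_id_right:
  assumes "v \<in> verts G" "h \<in> dpaths G"
  shows "br h (id_path v) = 0"
proof -
  have "id_path v \<in> dpaths G" using assms(1) by (simp add: id_path_def in_dpaths awalk_Nil_iff)
  then have "br h (id_path v) = - flip (br (id_path v) h)"
    using br_skew assms(2) unfolding bracket_skew_def by blast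
  then show ?thesis using br_id_left[OF assms] by (simp add: flip_simps)
qed

text \<open>The end points in \<open>crossed_split\<close> are those of the arcs because a nonzero
  sign forces a common tail or a common head.\<close>

lemma br_arc_arc:
  assumes e: "e \<in> arcs G" and f: "f \<in> arcs G"
  shows "br (arc_path G e) (arc_path G f) = corner_term (arc_path G e) (arc_path G f) 0 0"
proof -
  have "scal (of_int (split_sign e f) / 2) (tens (arc_path G e) (arc_path G f)) =
      scal (of_int (split_sign e f) / 2) (crossed_split (arc_path G e) (arc_path G f) 0 0)"
    using sign_nonzero(1)[of e f] by (cases "split_sign e f = 0") (auto simp: crossed_split_def arc_path_def)
  moreover have "scal (of_int (merge_sign e f) / 2) (tens (arc_path G f) (arc_path G e)) =
      scal (of_int (merge_sign e f) / 2) (crossed_split (arc_path G e) (arc_path G f) 1 1)"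
    using sign_nonzero(2)[of e f] by (cases "merge_sign e f = 0") (auto simp: crossed_split_def arc_path_def)
  moreover have "corner_term (arc_path G e) (arc_path G f) 0 0 =
      scal (of_int (split_sign e f) / 2) (crossed_split (arc_path G e) (arc_path G f) 0 0) -
      scal (of_int (merge_sign e f) / 2) (crossed_split (arc_path G e) (arc_path G f) 1 1)"
    by (simp add: corner_term_def arc_path_def)
  ultimately show ?thesis
    unfolding br_arcs[OF e f] edge_bracket_eq[OF e f] by (simp only:)
qed

lemma br_arc_walk:
  assumes e: "e \<in> arcs G" and q: "awalk x' q y'"
  shows "br (arc_path G e) (x', q, y') = (\<Sum>j<length q. corner_term (arc_path G e) (x', q, y') 0 j)"
  using q
proof (induction q arbitrary: x')
  case Nil
  then have "x' \<in> verts G" "y' = x'" by (auto simp: awalk_Nil_iff)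
  then show ?case using br_id_right[of x' "arc_path G e"] e
    by (simp add: id_path_def arc_path_def in_dpaths arc_implies_awalk)
next
  case (Cons f q)
  have f: "f \<in> arcs G" "x' = tail G f" and q: "awalk (head G f) q y'" using Cons.prems by (auto simp: awalk_Cons_iff)
  let ?e = "arc_path G e" and ?f = "arc_path G f" and ?q = "(head G f, q, y')"
  have paths: "?e \<in> dpaths G" "?f \<in> dpaths G" "?q \<in> dpaths G"
    using e f(1) q by (auto simp: arc_path_def in_dpaths arc_implies_awalk)
  have c: "(x', f # q, y') = concat_path ?f ?q" by (simp add: concat_path_def arc_path_def f(2))
  have "br ?e (concat_path ?f ?q) = tens_mult (tens ?f (id_path (psrc ?e))) (br ?e ?q) +
      tens_mult (br ?e ?f) (tens (id_path (ptgt ?e)) ?q)"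
    using br_leibniz paths unfolding bracket_leibniz_def by (auto simp: arc_path_def)
  moreover have "tens_mult (tens ?f (id_path (psrc ?e))) (corner_term ?e ?q 0 j) = corner_term ?e (x', f # q, y') 0 (Suc j)" for j
    by (simp add: corner_term_def crossed_split_def tens_mult_diff_right tens_mult_simps tens_mult_tens
        concat_path_def id_path_def arc_path_def f(2))
  moreover have "tens_mult (br ?e ?f) (tens (id_path (ptgt ?e)) ?q) = corner_term ?e (x', f # q, y') 0 0"
    unfolding br_arc_arc[OF e f(1)]
    by (simp add: corner_term_def crossed_split_def tens_mult_diff_left tens_mult_simps tens_mult_tens
        concat_path_def id_path_def arc_path_def f(2))
  ultimately have "br ?e (x', f # q, y') = (\<Sum>j<length q. corner_term ?e (x', f # q, y') 0 (Suc j)) + corner_term ?e (x', f # q, y') 0 0"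
    unfolding c Cons.IH[OF q] tens_mult_simps by simp
  then show ?case by (simp only: length_Cons sum.lessThan_Suc_shift add.commute)
qed

text \<open>The Leibniz rules are applied along the second walk for a single first arc, then along
  the first walk. Multiplying an exchange by the rest of a walk yields the exchange at the same pair
  of edges of the longer walks.\<close>

lemma br_walks:
  assumes p: "awalk x p y" and q: "awalk x' q y'"
  shows "br (x, p, y) (x', q, y') = (\<Sum>i<length p. \<Sum>j<length q. corner_term (x, p, y) (x', q, y') i j)"
  using p
proof (induction p arbitrary: x)
  case Nil
  then have "x \<in> verts G" "y = x" by (auto simp: awalk_Nil_iff)
  then show ?case using br_id_left[of x "(x', q, y')"] q by (simp add: id_path_def in_dpaths)
next
  case (Cons e p)
  have e: "e \<in> arcs G" "x = tail G e" and p: "awalk (head G e) p y" using Cons.prems by (auto simp: awalk_Cons_iff)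
  let ?e = "arc_path G e" and ?p = "(head G e, p, y)" and ?q = "(x', q, y')"
  have paths: "?e \<in> dpaths G" "?p \<in> dpaths G" "?q \<in> dpaths G"
    using e(1) p q by (auto simp: arc_path_def in_dpaths arc_implies_awalk)
  have c: "(x, e # p, y) = concat_path ?e ?p" by (simp add: concat_path_def arc_path_def e(2))
  have "br (concat_path ?e ?p) ?q = tens_mult (tens (id_path (psrc ?q)) ?e) (br ?p ?q) +
      tens_mult (br ?e ?q) (tens ?p (id_path (ptgt ?q)))"
    using br_leibniz paths unfolding bracket_leibniz_def by (auto simp: arc_path_def)
  moreover have "tens_mult (tens (id_path (psrc ?q)) ?e) (corner_term ?p ?q i j) = corner_term (x, e # p, y) ?q (Suc i) j" for i j
    by (simp add: corner_term_def crossed_split_def tens_mult_diff_right tens_mult_simps tens_mult_tens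
        concat_path_def id_path_def arc_path_def e(2))
  moreover have "tens_mult (corner_term ?e ?q 0 j) (tens ?p (id_path (ptgt ?q))) = corner_term (x, e # p, y) ?q 0 j" for j
    by (simp add: corner_term_def crossed_split_def tens_mult_diff_left tens_mult_simps tens_mult_tens
        concat_path_def id_path_def arc_path_def e(2))
  ultimately have "br (x, e # p, y) ?q = (\<Sum>i<length p. \<Sum>j<length q. corner_term (x, e # p, y) ?q (Suc i) j) +
      (\<Sum>j<length q. corner_term (x, e # p, y) ?q 0 j)"
    unfolding c Cons.IH[OF p] br_arc_walk[OF e(1) q] tens_mult_simps by simp
  then show ?case by (simp only: length_Cons sum.lessThan_Suc_shift add.commute)
qed

end

end

section \<open>Step functions summed against powers of mu / lam\<close>

lemma scalar_facts: "lam \<noteq> 0" "mu \<noteq> 0" "lam \<noteq> mu" "(2 :: scalar) \<noteq> 0"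
proof -
  show "lam \<noteq> 0" "mu \<noteq> 0" "lam \<noteq> mu"
    by (simp_all add: lam_def mu_def Zero_fract_def eq_fract)
  have "(of_nat 2 :: scalar) = Fract (of_nat 2) 1" by (simp only: Fract_of_nat_eq)
  moreover have "Fract (of_nat 2) 1 \<noteq> (0 :: scalar)"
    by (simp add: Zero_fract_def eq_fract)
  ultimately show "(2 :: scalar) \<noteq> 0" by simp
qed

text \<open>Telescoping. The case a = b + 1, an empty sum, occurs when the step in
  \<open>stair_sum\<close> lies at an edge of the window.\<close>

lemma geometric_sum_powi:
  fixes x :: "'a::field"
  assumes "x \<noteq> 0" "a \<le> b + 1"
  shows "(1 - x) * (\<Sum>n\<in>{a..b}. x powi n) = x powi a - x powi (b + 1)"
proof -
  have "(1 - x) * (\<Sum>n\<in>{a..a - 1 + int m}. x powi n) = x powi a - x powi (a + int m)" for m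
  proof (induction m)
    case (Suc m)
    have "{a..a - 1 + int (Suc m)} = insert (a + int m) {a..a - 1 + int m}" by auto
    then have "(1 - x) * (\<Sum>n\<in>{a..a - 1 + int (Suc m)}. x powi n) =
      (1 - x) * x powi (a + int m) + (x powi a - x powi (a + int m))"
      using Suc by (simp add: distrib_left)
    also have "\<dots> = x powi a - x powi (a + int m + 1)"
      using assms(1) by (simp add: power_int_add algebra_simps)
    finally show ?case by (simp add: algebra_simps)
  qed simp
  from this[of "nat (b + 1 - a)"] assms(2) show ?thesis by simp
qed

text \<open>Sign function with adjustable value at the step, where the order of two boundary points
  on the same sheet decides.\<close>

definition stair :: "'a::field \<Rightarrow> int \<Rightarrow> 'a" where
  "stair s m = (if m = 0 then s else of_int (sgn m))"

text \<open>Two geometric series, left and right of the step. The terms at -K and K + 1 depend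
  neither on N nor on s, so they cancel between two steps.\<close>

lemma stair_sum:
  fixes x s :: "'a::field"
  assumes "x \<noteq> 0" "- K \<le> N" "N \<le> K"
  shows "(1 - x) * (\<Sum>n\<in>{- K..K}. x powi n * stair s (n - N)) =
    x powi N * (1 + x + s * (1 - x)) - x powi (- K) - x powi (K + 1)"
proof -
  have "{- K..K} = {- K..N - 1} \<union> ({N} \<union> {N + 1..K})" using assms(2,3) by auto
  then have "(\<Sum>n\<in>{- K..K}. x powi n * stair s (n - N)) =
    (\<Sum>n\<in>{- K..N - 1}. x powi n * stair s (n - N)) + (x powi N * stair s 0 + (\<Sum>n\<in>{N + 1..K}. x powi n * stair s (n - N)))"
    by (simp add: sum.union_disjoint)
  also have "(\<Sum>n\<in>{- K..N - 1}. x powi n * stair s (n - N)) = - (\<Sum>n\<in>{- K..N - 1}. x powi n)"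
    unfolding sum_negf[symmetric] by (intro sum.cong) (auto simp: stair_def)
  also have "(\<Sum>n\<in>{N + 1..K}. x powi n * stair s (n - N)) = (\<Sum>n\<in>{N + 1..K}. x powi n)"
    by (intro sum.cong) (auto simp: stair_def)
  finally have E: "(\<Sum>n\<in>{- K..K}. x powi n * stair s (n - N)) =
    - (\<Sum>n\<in>{- K..N - 1}. x powi n) + (x powi N * stair s 0 + (\<Sum>n\<in>{N + 1..K}. x powi n))" .
  have "(1 - x) * (\<Sum>n\<in>{- K..K}. x powi n * stair s (n - N)) =
    - ((1 - x) * (\<Sum>n\<in>{- K..N - 1}. x powi n)) + (1 - x) * x powi N * s + (1 - x) * (\<Sum>n\<in>{N + 1..K}. x powi n)"
    unfolding E by (simp add: stair_def algebra_simps)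
  also have "\<dots> = x powi N * (1 + x + s * (1 - x)) - x powi (- K) - x powi (K + 1)"
  proof -
    have "(1 - x) * (\<Sum>n\<in>{- K..N - 1}. x powi n) = x powi (- K) - x powi N"
      "(1 - x) * (\<Sum>n\<in>{N + 1..K}. x powi n) = x powi (N + 1) - x powi (K + 1)"
      using geometric_sum_powi[OF assms(1), of "- K" "N - 1"] geometric_sum_powi[OF assms(1), of "N + 1" K] assms by simp_all
    then show ?thesis using assms(1) by (simp only:) (simp add: power_int_add algebra_simps)
  qed
  finally show ?thesis .
qed

definition order_sign :: "nat \<Rightarrow> nat \<Rightarrow> int" where
  "order_sign a b = (if a < b then 1 else if a = b then 0 else -1)"

text \<open>The three cases of \<open>rho\<close> are, up to the factor -1/2, the sums of
  \<open>stair_sum\<close> for N = 0 with values 1, 0, -1 at the step and the boundary terms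
  removed.\<close>

lemma rho_eq: "(1 - mu / lam) * rho a b = - (1 + mu / lam + of_int (order_sign a b) * (1 - mu / lam)) / 2"
  using scalar_facts by (auto simp: rho_def order_sign_def field_simps)

lemma rho_sum:
  assumes "- K \<le> N" "N \<le> K" "0 \<le> K"
  shows "(\<Sum>n\<in>{- K..K}. (mu / lam) powi n * ((stair (of_int (order_sign b j)) (n - N) - stair (of_int (order_sign i a)) n) / 2)) =
    rho i a - rho b j * (mu / lam) powi N"
proof -
  let ?x = "mu / lam"
  have x: "?x \<noteq> 0" "1 - ?x \<noteq> 0" using scalar_facts by auto
  have "(1 - ?x) * (\<Sum>n\<in>{- K..K}. ?x powi n * ((stair (of_int (order_sign b j)) (n - N) - stair (of_int (order_sign i a)) n) / 2)) =
    ((1 - ?x) * (\<Sum>n\<in>{- K..K}. ?x powi n * stair (of_int (order_sign b j)) (n - N)) -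
     (1 - ?x) * (\<Sum>n\<in>{- K..K}. ?x powi n * stair (of_int (order_sign i a)) (n - 0))) / 2"
  proof -
    have "(\<Sum>n\<in>{- K..K}. ?x powi n * ((stair (of_int (order_sign b j)) (n - N) - stair (of_int (order_sign i a)) n) / 2)) =
      ((\<Sum>n\<in>{- K..K}. ?x powi n * stair (of_int (order_sign b j)) (n - N)) -
       (\<Sum>n\<in>{- K..K}. ?x powi n * stair (of_int (order_sign i a)) (n - 0))) / 2"
      unfolding sum_subtractf[symmetric] sum_divide_distrib by (intro sum.cong refl) (simp add: right_diff_distrib)
    then show ?thesis by (simp only: right_diff_distrib times_divide_eq_right)
  qed
  also have "\<dots> = (?x powi N * (1 + ?x + of_int (order_sign b j) * (1 - ?x)) - (1 + ?x + of_int (order_sign i a) * (1 - ?x))) / 2"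
    using assms stair_sum[OF x(1), of K N] stair_sum[OF x(1), of K 0] by simp
  also have "\<dots> = (1 - ?x) * rho i a - ?x powi N * ((1 - ?x) * rho b j)"
  proof -
    have "(t * u - v) / 2 = - v / 2 - t * (- u / 2)" for t u v :: scalar by (simp add: diff_divide_distrib)
    then show ?thesis unfolding rho_eq .
  qed
  also have "\<dots> = (1 - ?x) * (rho i a - rho b j * ?x powi N)"
    by (simp add: algebra_simps)
  finally show ?thesis using mult_left_cancel[OF x(2)] by blast
qed

section \<open>Rerouting pairs of walks at a common vertex\<close>

context acyclic_cylinder begin

lemma crossings_append: "crossings \<Gamma> (p @ q) = crossings \<Gamma> p + crossings \<Gamma> q"
  by (simp add: crossings_def)

text \<open>A walk is cut in front of its edge \<open>k\<close> for \<open>d = 0\<close>, where two walks may separate, and behind it for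
  \<open>d = 1\<close>, where they may merge.\<close>

definition cut_vertex :: "nat \<Rightarrow> 'e list \<Rightarrow> nat \<Rightarrow> 'v" where
  "cut_vertex d p k = (if d = 0 then tail G (p ! k) else head G (p ! k))"

lemma walk_cut:
  assumes "awalk x p y" "k < length p" "d \<le> 1"
  shows "awalk x (take (k + d) p) (cut_vertex d p k)" "awalk (cut_vertex d p k) (drop (k + d) p) y"
proof -
  have "p = take k p @ p ! k # drop (Suc k) p" using assms(2) by (rule id_take_nth_drop)
  then have "awalk x (take k p @ p ! k # drop (Suc k) p) y" using assms(1) by simp
  then have 1: "awalk x (take k p) (tail G (p ! k))" "p ! k \<in> arcs G" "awalk (head G (p ! k)) (drop (Suc k) p) y"
    by (auto simp: awalk_Cons_iff)
  have d: "d = 0 \<or> d = 1" using assms(3) by auto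
  show "awalk x (take (k + d) p) (cut_vertex d p k)"
    using d 1 assms(2) awalk_appendI[OF 1(1) arc_implies_awalk[OF 1(2)]]
    by (auto simp: cut_vertex_def take_Suc_conv_app_nth simp del: awalk_append_iff)
  have "awalk (tail G (p ! k)) (p ! k # drop (Suc k) p) y" using 1 by (simp add: awalk_Cons_iff)
  then show "awalk (cut_vertex d p k) (drop (k + d) p) y"
    using d 1 assms(2) by (auto simp: cut_vertex_def Cons_nth_drop_Suc)
qed

definition walks :: "nat \<Rightarrow> nat \<Rightarrow> 'e list set" where
  "walks i j = {p. awalk (source \<Gamma> i) p (sink \<Gamma> j)}"

text \<open>Heights increase along a walk, so no arc recurs; this also makes the sets
  \<open>walks\<close> finite.\<close>

lemma walk_distinct:
  assumes "awalk x p y"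
  shows "distinct p"
proof -
  have "p ! i \<noteq> p ! k" if "i < k" "k < length p" for i k
    using walk_ordered[OF assms that] height_tail_less[OF walk_arc[OF assms, of i]] that by auto
  then show ?thesis unfolding distinct_conv_nth by (metis linorder_neqE_nat)
qed

lemma finite_walks: "finite (walks i j)"
proof (rule finite_subset)
  show "walks i j \<subseteq> {p. set p \<subseteq> arcs G \<and> distinct p}"
    using walk_distinct by (auto simp: walks_def)
  show "finite {p. set p \<subseteq> arcs G \<and> distinct p}" by (rule finite_subset_distinct) simp
qed

definition swap :: "nat \<Rightarrow> 'e list \<Rightarrow> 'e list \<Rightarrow> nat \<Rightarrow> nat \<Rightarrow> 'e list" where
  "swap d p q k l = take (k + d) p @ drop (l + d) q"

text \<open>The cut of the new walk is again at position \<open>k\<close>, so a second exchange at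
  the same places restores the walks. The edge at that position comes from \<open>q\<close> for d =
  0 and from \<open>p\<close> for d = 1.\<close>

lemma swap_props:
  assumes "k < length p" "l < length q" "d \<le> 1"
  shows "k < length (swap d p q k l)" "swap d (swap d p q k l) (swap d q p l k) k l = p"
    "swap d p q k l ! k = (if d = 0 then q ! l else p ! k)"
proof -
  have d: "d = 0 \<or> d = 1" using assms(3) by auto
  show "k < length (swap d p q k l)" using d assms(1,2) by (auto simp: swap_def)
  have "k + d \<le> length p" "l + d \<le> length q" using d assms(1,2) by auto
  then show "swap d (swap d p q k l) (swap d q p l k) k l = p" by (simp add: swap_def min_absorb2)
  show "swap d p q k l ! k = (if d = 0 then q ! l else p ! k)" using d assms(1,2) by (auto simp: swap_def nth_append)
qed

lemma swap_walk:
  assumes "p \<in> walks i j" "q \<in> walks a b" "k < length p" "l < length q" "d \<le> 1" "cut_vertex d p k = cut_vertex d q l"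
  shows "swap d p q k l \<in> walks i b"
  using walk_cut(1)[of "source \<Gamma> i" p "sink \<Gamma> j" k d] walk_cut(2)[of "source \<Gamma> a" q "sink \<Gamma> b" l d] assms
  unfolding walks_def swap_def by (auto intro: awalk_appendI simp del: awalk_append_iff)

lemma sum_pointed_pairs:
  assumes "finite A" "finite B"
  shows "(\<Sum>p\<in>A. \<Sum>q\<in>B. \<Sum>k<length p. \<Sum>l<length q. if R p q k l then H p q k l else 0) =
    (\<Sum>(p, q, k, l) | p \<in> A \<and> q \<in> B \<and> k < length p \<and> l < length q \<and> R p q k l. H p q k l)"
proof -
  let ?Z = "SIGMA p:A. SIGMA q:B. {..<length p} \<times> {..<length q}"
  have "(\<Sum>p\<in>A. \<Sum>q\<in>B. \<Sum>k<length p. \<Sum>l<length q. if R p q k l then H p q k l else 0) =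
    (\<Sum>(p, q, k, l)\<in>?Z. if R p q k l then H p q k l else 0)"
    using assms by (simp add: sum.Sigma sum.cartesian_product)
  also have "\<dots> = (\<Sum>z\<in>?Z. if (case z of (p, q, k, l) \<Rightarrow> R p q k l) then (case z of (p, q, k, l) \<Rightarrow> H p q k l) else 0)"
    by (intro sum.cong) auto
  also have "\<dots> = (\<Sum>z\<in>{z \<in> ?Z. case z of (p, q, k, l) \<Rightarrow> R p q k l}. case z of (p, q, k, l) \<Rightarrow> H p q k l)"
    using assms by (intro sum.inter_filter[symmetric]) auto
  also have "{z \<in> ?Z. case z of (p, q, k, l) \<Rightarrow> R p q k l} =
      {(p, q, k, l). p \<in> A \<and> q \<in> B \<and> k < length p \<and> l < length q \<and> R p q k l}" by auto
  finally show ?thesis .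
qed

text \<open>Exchange at a common vertex is a bijection of pairs with marked positions whose inverse
  is again an exchange. \<open>H\<close> takes both pairs as arguments so that either can be written
  in terms of the other.\<close>

lemma swap_reindex:
  fixes H :: "'e list \<Rightarrow> 'e list \<Rightarrow> nat \<Rightarrow> nat \<Rightarrow> 'e list \<Rightarrow> 'e list \<Rightarrow> 'c::comm_monoid_add"
  assumes d: "d \<le> 1"
  shows "(\<Sum>p\<in>walks i j. \<Sum>q\<in>walks a b. \<Sum>k<length p. \<Sum>l<length q.
      if cut_vertex d p k = cut_vertex d q l then H p q k l (swap d q p l k) (swap d p q k l) else 0) =
    (\<Sum>u\<in>walks a j. \<Sum>w\<in>walks i b. \<Sum>l<length u. \<Sum>k<length w.
      if cut_vertex d u l = cut_vertex d w k then H (swap d w u k l) (swap d u w l k) k l u w else 0)"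
  unfolding sum_pointed_pairs[OF finite_walks finite_walks]
proof (rule sum.reindex_bij_witness[where i = "\<lambda>(u, w, l, k). (swap d w u k l, swap d u w l k, k, l)"
      and j = "\<lambda>(p, q, k, l). (swap d q p l k, swap d p q k l, l, k)"], goal_cases)
  case (1 z)
  then show ?case using d swap_props(2)[of _ _ _ _ d] by auto
next
  case (2 z)
  then show ?case using d swap_walk[of _ _ _ _ _ _ _ _ d] swap_props(1,3)[of _ _ _ _ d]
    by (auto simp: cut_vertex_def split: if_splits)
next
  case (3 z)
  then show ?case using d swap_props(2)[of _ _ _ _ d] by auto
next
  case (4 z)
  then show ?case using d swap_walk[of _ _ _ _ _ _ _ _ d] swap_props(1,3)[of _ _ _ _ d]
    by (auto simp: cut_vertex_def split: if_splits)
next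
  case (5 z)
  then show ?case using d swap_props(2)[of _ _ _ _ d] by auto
qed

end

section \<open>Signed numbers of meetings, sheet by sheet\<close>

definition int_stair :: "int \<Rightarrow> int \<Rightarrow> int" where
  "int_stair s m = (if m = 0 then s else sgn m)"

lemma of_int_stair: "of_int (int_stair s m) = stair (of_int s) m"
  by (simp add: int_stair_def stair_def)

text \<open>Angles in (0, 2 pi) differ by less than a full turn, so a nonzero sheet difference
  decides the sign.\<close>

lemma sgn_angle_difference:
  fixes \<alpha> \<beta> :: real
  assumes "0 < \<alpha>" "\<alpha> < 2 * pi" "0 < \<beta>" "\<beta> < 2 * pi" "sgn (\<alpha> - \<beta>) = of_int s"
  shows "sgn (\<alpha> - \<beta> + 2 * pi * of_int m) = of_int (int_stair s m)"
proof -
  consider "m = 0" | "1 \<le> m" | "m \<le> - 1" by linarith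
  then show ?thesis
  proof cases
    case 2
    then have "2 * pi * 1 \<le> 2 * pi * of_int m" by (intro mult_left_mono) auto
    then have "0 < \<alpha> - \<beta> + 2 * pi * of_int m" using assms by linarith
    then show ?thesis using 2 by (simp add: int_stair_def sgn_if)
  next
    case 3
    then have "2 * pi * of_int m \<le> 2 * pi * (- 1)" by (intro mult_left_mono) auto
    then have "\<alpha> - \<beta> + 2 * pi * of_int m < 0" using assms by linarith
    then show ?thesis using 3 by (simp add: int_stair_def sgn_if)
  qed (use assms in \<open>simp add: int_stair_def\<close>)
qed

context acyclic_cylinder begin

text \<open>Numbering from top to bottom means decreasing arguments, so the smaller number gives
  sign 1.\<close>

lemma sgn_sinks:
  assumes "i \<in> {1..width \<Gamma>}" "j \<in> {1..width \<Gamma>}"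
  shows "sgn (Arg2pi (point \<Gamma> (sink \<Gamma> i)) - Arg2pi (point \<Gamma> (sink \<Gamma> j)) + 2 * pi * of_int m) = of_int (int_stair (order_sign i j) m)"
proof (rule sgn_angle_difference)
  have v: "sink \<Gamma> i \<in> verts G" "sink \<Gamma> j \<in> verts G" using boundary_verts assms by (auto simp: sinks_def)
  show "0 < Arg2pi (point \<Gamma> (sink \<Gamma> i))" "Arg2pi (point \<Gamma> (sink \<Gamma> i)) < 2 * pi"
    "0 < Arg2pi (point \<Gamma> (sink \<Gamma> j))" "Arg2pi (point \<Gamma> (sink \<Gamma> j)) < 2 * pi"
    using Arg2pi_point v by auto
  show "sgn (Arg2pi (point \<Gamma> (sink \<Gamma> i)) - Arg2pi (point \<Gamma> (sink \<Gamma> j))) = of_int (order_sign i j)"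
    using sinks_top_to_bottom[of i j] sinks_top_to_bottom[of j i] assms
    by (cases i j rule: linorder_cases) (auto simp: order_sign_def)
qed

lemma sgn_sources:
  assumes "i \<in> {1..width \<Gamma>}" "j \<in> {1..width \<Gamma>}"
  shows "sgn (Arg2pi (point \<Gamma> (source \<Gamma> i)) - Arg2pi (point \<Gamma> (source \<Gamma> j)) + 2 * pi * of_int m) = of_int (int_stair (order_sign i j) m)"
proof (rule sgn_angle_difference)
  have v: "source \<Gamma> i \<in> verts G" "source \<Gamma> j \<in> verts G" using boundary_verts assms by (auto simp: sources_def)
  show "0 < Arg2pi (point \<Gamma> (source \<Gamma> i))" "Arg2pi (point \<Gamma> (source \<Gamma> i)) < 2 * pi"
    "0 < Arg2pi (point \<Gamma> (source \<Gamma> j))" "Arg2pi (point \<Gamma> (source \<Gamma> j)) < 2 * pi"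
    using Arg2pi_point v by auto
  show "sgn (Arg2pi (point \<Gamma> (source \<Gamma> i)) - Arg2pi (point \<Gamma> (source \<Gamma> j))) = of_int (order_sign i j)"
    using sources_top_to_bottom[of i j] sources_top_to_bottom[of j i] assms
    by (cases i j rule: linorder_cases) (auto simp: order_sign_def)
qed

text \<open>All sheets at once; \<open>level_difference\<close> sorts the meetings into the sets
  \<open>meeting_points\<close> belonging to the various \<open>n\<close>.\<close>

definition meetings :: "'e list \<Rightarrow> 'e list \<Rightarrow> (nat \<times> nat) set" where
  "meetings u w = {(l, k). 0 < l \<and> l < length u \<and> 0 < k \<and> k < length w \<and> tail G (u ! l) = tail G (w ! k)}"

definition level_difference :: "'e list \<Rightarrow> 'e list \<Rightarrow> nat \<times> nat \<Rightarrow> int" where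
  "level_difference u w = (\<lambda>(l, k). crossings \<Gamma> (take l u) - crossings \<Gamma> (take k w))"

definition meeting_sign :: "'e list \<Rightarrow> 'e list \<Rightarrow> nat \<times> nat \<Rightarrow> int" where
  "meeting_sign u w = (\<lambda>(l, k). split_sign (u ! l) (w ! k) + merge_sign (u ! (l - 1)) (w ! (k - 1)))"

lemma finite_meetings: "finite (meetings u w)"
  by (rule finite_subset[of _ "{..<length u} \<times> {..<length w}"]) (auto simp: meetings_def)

lemma walksD:
  assumes "u \<in> walks a j" "a \<in> {1..width \<Gamma>}" "j \<in> {1..width \<Gamma>}"
  shows "awalk (source \<Gamma> a) u (sink \<Gamma> j)" "source \<Gamma> a \<in> sources \<Gamma>" "sink \<Gamma> j \<in> sinks \<Gamma>" "u \<noteq> []"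
proof -
  show 1: "awalk (source \<Gamma> a) u (sink \<Gamma> j)" "source \<Gamma> a \<in> sources \<Gamma>" "sink \<Gamma> j \<in> sinks \<Gamma>"
    using assms by (auto simp: walks_def sources_def sinks_def)
  show "u \<noteq> []" using 1 sources_sinks_disjoint by (auto simp: awalk_Nil_iff)
qed

lemma meetings_at_level:
  assumes idx: "i \<in> {1..width \<Gamma>}" "j \<in> {1..width \<Gamma>}" "a \<in> {1..width \<Gamma>}" "b \<in> {1..width \<Gamma>}"
    and u: "u \<in> walks a j" and w: "w \<in> walks i b"
  shows "(\<Sum>z\<in>{z \<in> meetings u w. level_difference u w z = n}. meeting_sign u w z) =
    int_stair (order_sign b j) (n - (crossings \<Gamma> u - crossings \<Gamma> w)) - int_stair (order_sign i a) n"
proof -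
  obtain \<phi> \<psi> where "is_walk_log (source \<Gamma> a) u (sink \<Gamma> j) \<phi>" "is_walk_log (source \<Gamma> i) w (sink \<Gamma> b) \<psi>"
    using walk_log_exists[OF walksD(1)[OF u idx(3,2)]] walk_log_exists[OF walksD(1)[OF w idx(1,4)]]
    unfolding is_walk_log_def by blast
  then interpret S: strands \<Gamma> u w "source \<Gamma> a" "sink \<Gamma> j" "source \<Gamma> i" "sink \<Gamma> b" n \<phi> \<psi>
    using walksD[OF u idx(3,2)] walksD[OF w idx(1,4)] by unfold_locales
  have "{z \<in> meetings u w. level_difference u w z = n} = S.meeting_points"
    by (auto simp: meetings_def level_difference_def S.meeting_points_def)
  then have "(of_int (\<Sum>z\<in>{z \<in> meetings u w. level_difference u w z = n}. meeting_sign u w z) :: real) =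
    of_int (\<Sum>(l, k)\<in>S.meeting_points. split_sign (u ! l) (w ! k) + merge_sign (u ! (l - 1)) (w ! (k - 1)))"
    by (simp add: meeting_sign_def)
  also have "\<dots> = of_int (int_stair (order_sign b j) (n - (crossings \<Gamma> u - crossings \<Gamma> w)) - int_stair (order_sign i a) n)"
    unfolding S.meeting_points_sum of_int_diff sgn_sinks[OF idx(4,2), symmetric] sgn_sources[OF idx(1,3), symmetric]
    by (simp add: algebra_simps)
  finally show ?thesis by (simp only: of_int_eq_iff)
qed

text \<open>Separations are indexed by the edges leaving a vertex and mergings by those arriving; a
  shift by one brings both to the same meeting. At sources and sinks the signs vanish.\<close>

lemma meetings_sum:
  fixes u w :: "'e list" and F :: "int \<Rightarrow> 'c::comm_ring_1"
  assumes idx: "i \<in> {1..width \<Gamma>}" "j \<in> {1..width \<Gamma>}" "a \<in> {1..width \<Gamma>}" "b \<in> {1..width \<Gamma>}"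
    and u: "u \<in> walks a j" and w: "w \<in> walks i b"
  shows "(\<Sum>l<length u. \<Sum>k<length w. of_int (split_sign (u ! l) (w ! k)) * F (level_difference u w (l, k)) +
      of_int (merge_sign (u ! l) (w ! k)) * F (level_difference u w (Suc l, Suc k))) =
    (\<Sum>z\<in>meetings u w. of_int (meeting_sign u w z) * F (level_difference u w z) :: 'c)"
proof -
  note U = walksD[OF u idx(3,2)] and W = walksD[OF w idx(1,4)]
  let ?Z = "{..<length u} \<times> {..<length w}"
  let ?R = "{(l, k). Suc l < length u \<and> Suc k < length w \<and> head G (u ! l) = head G (w ! k)}"
  have first: "tail G (u ! 0) \<notin> internal \<Gamma>" "tail G (w ! 0) \<notin> internal \<Gamma>"
    using walk_first[OF U(1,4)] walk_first[OF W(1,4)] U(2) W(2) by (auto simp: internal_def)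
  have last: "head G (u ! (length u - 1)) \<notin> internal \<Gamma>" "head G (w ! (length w - 1)) \<notin> internal \<Gamma>"
    using walk_last[OF U(1,4)] walk_last[OF W(1,4)] U(3) W(3) by (auto simp: internal_def)
  have "(\<Sum>l<length u. \<Sum>k<length w. of_int (split_sign (u ! l) (w ! k)) * F (level_difference u w (l, k))) =
    (\<Sum>(l, k)\<in>?Z. of_int (split_sign (u ! l) (w ! k)) * F (level_difference u w (l, k)))"
    by (simp add: sum.cartesian_product)
  also have "\<dots> = (\<Sum>(l, k)\<in>meetings u w. of_int (split_sign (u ! l) (w ! k)) * F (level_difference u w (l, k)))"
  proof (rule sum.mono_neutral_right)
    show "\<forall>z\<in>?Z - meetings u w. (case z of (l, k) \<Rightarrow> of_int (split_sign (u ! l) (w ! k)) * F (level_difference u w (l, k))) = 0"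
    proof (clarify)
      fix l k assume lk: "l < length u" "k < length w" "(l, k) \<notin> meetings u w"
      have "split_sign (u ! l) (w ! k) = 0"
      proof (rule ccontr)
        assume "split_sign (u ! l) (w ! k) \<noteq> 0"
        from sign_nonzero(1)[OF this] have t: "tail G (u ! l) = tail G (w ! k)" "tail G (u ! l) \<in> internal \<Gamma>" by auto
        have "l \<noteq> 0" using t(2) first(1) by metis
        moreover have "k \<noteq> 0" using t first(2) by metis
        ultimately show False using t lk by (simp add: meetings_def)
      qed
      then show "of_int (split_sign (u ! l) (w ! k)) * F (level_difference u w (l, k)) = 0" by simp
    qed
  qed (auto simp: meetings_def)
  finally have split: "(\<Sum>l<length u. \<Sum>k<length w. of_int (split_sign (u ! l) (w ! k)) * F (level_difference u w (l, k))) =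
    (\<Sum>(l, k)\<in>meetings u w. of_int (split_sign (u ! l) (w ! k)) * F (level_difference u w (l, k)))" .
  have "(\<Sum>l<length u. \<Sum>k<length w. of_int (merge_sign (u ! l) (w ! k)) * F (level_difference u w (Suc l, Suc k))) =
    (\<Sum>(l, k)\<in>?Z. of_int (merge_sign (u ! l) (w ! k)) * F (level_difference u w (Suc l, Suc k)))"
    by (simp add: sum.cartesian_product)
  also have "\<dots> = (\<Sum>(l, k)\<in>?R. of_int (merge_sign (u ! l) (w ! k)) * F (level_difference u w (Suc l, Suc k)))"
  proof (rule sum.mono_neutral_right)
    show "\<forall>z\<in>?Z - ?R. (case z of (l, k) \<Rightarrow> of_int (merge_sign (u ! l) (w ! k)) * F (level_difference u w (Suc l, Suc k))) = 0"
    proof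
      fix z assume "z \<in> ?Z - ?R"
      then obtain l k where z: "z = (l, k)" and lk: "l < length u" "k < length w" "(l, k) \<notin> ?R" by auto
      have "merge_sign (u ! l) (w ! k) = 0"
      proof (rule ccontr)
        assume "merge_sign (u ! l) (w ! k) \<noteq> 0"
        from sign_nonzero(2)[OF this] have t: "head G (u ! l) = head G (w ! k)" "head G (u ! l) \<in> internal \<Gamma>" by auto
        have "l \<noteq> length u - 1" using t(2) last(1) by metis
        moreover have "k \<noteq> length w - 1" using t last(2) by metis
        ultimately have "Suc l < length u" "Suc k < length w" using lk(1,2) by auto
        then show False using t lk by simp
      qed
      then show "(case z of (l, k) \<Rightarrow> of_int (merge_sign (u ! l) (w ! k)) * F (level_difference u w (Suc l, Suc k))) = 0"
        by (simp add: z)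
    qed
  qed auto
  also have "\<dots> = (\<Sum>(l, k)\<in>meetings u w. of_int (merge_sign (u ! (l - 1)) (w ! (k - 1))) * F (level_difference u w (l, k)))"
  proof (rule sum.reindex_bij_witness[where i = "\<lambda>(l, k). (l - 1, k - 1)" and j = "\<lambda>(l, k). (Suc l, Suc k)"], goal_cases)
    case (4 z)
    then obtain l k where z: "z = (l, k)" "0 < l" "l < length u" "0 < k" "k < length w" "tail G (u ! l) = tail G (w ! k)"
      by (auto simp: meetings_def)
    then show ?case using walk_step[OF U(1), of "l - 1"] walk_step[OF W(1), of "k - 1"] by simp
  next
    case (2 z)
    then show ?case using walk_step[OF U(1)] walk_step[OF W(1)] by (auto simp: meetings_def)
  qed (auto simp: meetings_def)
  finally have merge: "(\<Sum>l<length u. \<Sum>k<length w. of_int (merge_sign (u ! l) (w ! k)) * F (level_difference u w (Suc l, Suc k))) =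
    (\<Sum>(l, k)\<in>meetings u w. of_int (merge_sign (u ! (l - 1)) (w ! (k - 1))) * F (level_difference u w (l, k)))" .
  show ?thesis
    unfolding sum.distrib split merge unfolding sum.distrib[symmetric]
    by (intro sum.cong refl) (auto simp: meeting_sign_def distrib_right)
qed

lemma swap_crossings:
  "crossings \<Gamma> (swap d w u k l) = crossings \<Gamma> u - level_difference u w (l + d, k + d)"
  "crossings \<Gamma> (swap d u w l k) = crossings \<Gamma> w + level_difference u w (l + d, k + d)"
  using crossings_append[of "take (l + d) u" "drop (l + d) u"] crossings_append[of "take (k + d) w" "drop (k + d) w"]
  by (simp_all add: swap_def crossings_append level_difference_def)

text \<open>An exchange moves crossings from one walk to the other, and their number is the level
  difference at the cut.\<close>

lemma swap_weight:
  "lam powi crossings \<Gamma> (swap d w u k l) * mu powi crossings \<Gamma> (swap d u w l k) =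
    lam powi crossings \<Gamma> u * mu powi crossings \<Gamma> w * (mu / lam) powi level_difference u w (l + d, k + d)"
  unfolding swap_crossings(1)[of d w u k l] swap_crossings(2)[of d u w l k] using scalar_facts
  by (simp add: power_int_add power_int_diff power_int_divide_distrib)

text \<open>Everything that the rerouted pair \<open>(u, w)\<close> receives from the original pairs
  leading to it.\<close>

lemma coefficient:
  assumes idx: "i \<in> {1..width \<Gamma>}" "j \<in> {1..width \<Gamma>}" "a \<in> {1..width \<Gamma>}" "b \<in> {1..width \<Gamma>}"
    and u: "u \<in> walks a j" and w: "w \<in> walks i b"
  shows "(\<Sum>l<length u. \<Sum>k<length w.
      lam powi crossings \<Gamma> (swap 0 w u k l) * mu powi crossings \<Gamma> (swap 0 u w l k) * (of_int (split_sign (u ! l) (w ! k)) / 2) +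
      lam powi crossings \<Gamma> (swap 1 w u k l) * mu powi crossings \<Gamma> (swap 1 u w l k) * (of_int (merge_sign (u ! l) (w ! k)) / 2)) =
    rho i a * (lam powi crossings \<Gamma> u * mu powi crossings \<Gamma> w) - rho b j * (mu powi crossings \<Gamma> u * lam powi crossings \<Gamma> w)"
    (is "?L = _")
proof -
  let ?x = "mu / lam" and ?c = "lam powi crossings \<Gamma> u * mu powi crossings \<Gamma> w"
  let ?N = "crossings \<Gamma> u - crossings \<Gamma> w" and ?D = "level_difference u w" and ?Q = "meetings u w"
  \<comment> \<open>Large enough to contain all levels at which meetings occur as well as both
    steps, 0 and \<open>?N\<close>.\<close>
  define K where "K = \<bar>?N\<bar> + (\<Sum>z\<in>?Q. \<bar>?D z\<bar>)"
  have nn: "0 \<le> (\<Sum>z\<in>?Q. \<bar>?D z\<bar>)" by (rule sum_nonneg) simp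
  have K: "0 \<le> K" "- K \<le> ?N" "?N \<le> K" using nn abs_ge_self[of ?N] abs_ge_minus_self[of ?N] unfolding K_def by linarith+
  have range: "?D ` ?Q \<subseteq> {- K..K}"
  proof (rule image_subsetI)
    fix z assume "z \<in> ?Q"
    then have "\<bar>?D z\<bar> \<le> (\<Sum>z\<in>?Q. \<bar>?D z\<bar>)" using finite_meetings by (intro member_le_sum) auto
    then show "?D z \<in> {- K..K}" by (auto simp: K_def)
  qed
  have "?L = (\<Sum>l<length u. \<Sum>k<length w. of_int (split_sign (u ! l) (w ! k)) * (?c * ?x powi ?D (l, k) / 2) +
      of_int (merge_sign (u ! l) (w ! k)) * (?c * ?x powi ?D (Suc l, Suc k) / 2))"
    unfolding swap_weight by (intro sum.cong refl) (simp add: mult.commute)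
  also have "\<dots> = (\<Sum>z\<in>?Q. of_int (meeting_sign u w z) * (?c * ?x powi ?D z / 2))"
    by (rule meetings_sum[OF idx u w, where F = "\<lambda>n. ?c * ?x powi n / 2"])
  also have "\<dots> = (\<Sum>n\<in>{- K..K}. \<Sum>z\<in>{z \<in> ?Q. ?D z = n}. of_int (meeting_sign u w z) * (?c * ?x powi ?D z / 2))"
    by (rule sum.group[OF finite_meetings _ range, symmetric]) simp
  also have "\<dots> = (\<Sum>n\<in>{- K..K}. ?c * (?x powi n * ((stair (of_int (order_sign b j)) (n - ?N) - stair (of_int (order_sign i a)) n) / 2)))"
  proof (rule sum.cong[OF refl])
    fix n
    have "(\<Sum>z\<in>{z \<in> ?Q. ?D z = n}. of_int (meeting_sign u w z) * (?c * ?x powi ?D z / 2)) =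
      (\<Sum>z\<in>{z \<in> ?Q. ?D z = n}. of_int (meeting_sign u w z)) * (?c * ?x powi n / 2)"
      unfolding sum_distrib_right by (intro sum.cong) auto
    also have "(\<Sum>z\<in>{z \<in> ?Q. ?D z = n}. of_int (meeting_sign u w z) :: scalar) =
        of_int (int_stair (order_sign b j) (n - ?N) - int_stair (order_sign i a) n)"
      unfolding meetings_at_level[OF idx u w, symmetric] by simp
    also have "\<dots> * (?c * ?x powi n / 2) = ?c * (?x powi n * ((stair (of_int (order_sign b j)) (n - ?N) - stair (of_int (order_sign i a)) n) / 2))"
      unfolding of_int_diff of_int_stair by (simp add: mult_ac)
    finally show "(\<Sum>z\<in>{z \<in> ?Q. ?D z = n}. of_int (meeting_sign u w z) * (?c * ?x powi ?D z / 2)) =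
      ?c * (?x powi n * ((stair (of_int (order_sign b j)) (n - ?N) - stair (of_int (order_sign i a)) n) / 2))" .
  qed
  also have "\<dots> = ?c * (rho i a - rho b j * ?x powi ?N)"
    unfolding sum_distrib_left[symmetric] using rho_sum[OF K(2,3,1)] by simp
  also have "\<dots> = rho i a * ?c - rho b j * (?c * ?x powi ?N)" by (simp add: algebra_simps)
  also have "?c * ?x powi ?N = mu powi crossings \<Gamma> u * lam powi crossings \<Gamma> w"
    using scalar_facts by (simp add: power_int_diff power_int_divide_distrib)
  finally show ?thesis .
qed

end

section \<open>The bracket of boundary measurements in the torus category\<close>

lemma glue_tensor_tens: "glue_tensor \<Gamma> (tens p q) = tens (glue_path \<Gamma> p) (glue_path \<Gamma> q)"
  by (simp add: glue_tensor_def tens_def)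

lemma glue_tensor_simps: "glue_tensor \<Gamma> (s - t) = glue_tensor \<Gamma> s - glue_tensor \<Gamma> t"
  "glue_tensor \<Gamma> (scal c t) = scal c (glue_tensor \<Gamma> t)"
  "glue_tensor \<Gamma> (sum h A) = (\<Sum>x\<in>A. glue_tensor \<Gamma> (h x))"
  by (simp_all add: glue_tensor_def extend_linear_diff extend_linear_scal extend_linear_sum)

context acyclic_cylinder begin

abbreviation through :: "nat \<Rightarrow> 'e list \<Rightarrow> nat \<Rightarrow> ('v, 'e) dpath" where
  "through i p j \<equiv> glue_path \<Gamma> (source \<Gamma> i, p, sink \<Gamma> j)"

lemma boundary_measurement_walks:
  "boundary_measurement \<Gamma> x i j = (\<Sum>p\<in>walks i j. scal (x powi crossings \<Gamma> p) (basis (through i p j)))"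
  by (simp add: boundary_measurement_def walks_def)

lemma extend_bilinear_boundary_measurement:
  "extend_bilinear F (boundary_measurement \<Gamma> x i j) (boundary_measurement \<Gamma> y a b) =
    (\<Sum>p\<in>walks i j. \<Sum>q\<in>walks a b.
      scal (x powi crossings \<Gamma> p * y powi crossings \<Gamma> q) (F (through i p j) (through a q b)))"
  unfolding boundary_measurement_walks extend_bilinear_sum_left unfolding extend_bilinear_sum_right
  by (simp add: extend_bilinear_scal_left extend_bilinear_scal_right mult.commute)

definition swap_sign :: "nat \<Rightarrow> 'e \<Rightarrow> 'e \<Rightarrow> scalar" where
  "swap_sign d e f = (if d = 0 then of_int (split_sign e f) else - of_int (merge_sign e f)) / 2"

text \<open>The condition on the cut vertices excludes only terms with sign zero; it prepares for
  \<open>swap_reindex\<close>.\<close>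

lemma glued_corner_term:
  "glue_tensor \<Gamma> (corner_term (source \<Gamma> i, p, sink \<Gamma> j) (source \<Gamma> a, q, sink \<Gamma> b) k l) =
    (\<Sum>d\<in>{0, 1}. if cut_vertex d p k = cut_vertex d q l
      then scal (swap_sign d (p ! k) (q ! l)) (tens (through a (swap d q p l k) j) (through i (swap d p q k l) b)) else 0)"
proof -
  have "split_sign (p ! k) (q ! l) = 0" if "cut_vertex 0 p k \<noteq> cut_vertex 0 q l"
    using sign_nonzero(1)[of "p ! k" "q ! l"] that by (auto simp: cut_vertex_def)
  moreover have "merge_sign (p ! k) (q ! l) = 0" if "cut_vertex 1 p k \<noteq> cut_vertex 1 q l"
    using sign_nonzero(2)[of "p ! k" "q ! l"] that by (auto simp: cut_vertex_def)
  ultimately show ?thesis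
    by (auto simp: corner_term_def crossed_split_def glue_tensor_simps glue_tensor_tens swap_sign_def swap_def
        pm.scale_minus_left)
qed

lemma bracket_boundary_measurement:
  assumes br: "standard_bracket \<Gamma> br" and dbr: "torus_bracket \<Gamma> br dbr"
    and idx: "i \<in> {1..width \<Gamma>}" "j \<in> {1..width \<Gamma>}" "a \<in> {1..width \<Gamma>}" "b \<in> {1..width \<Gamma>}"
  shows "extend_bilinear dbr (boundary_measurement \<Gamma> lam i j) (boundary_measurement \<Gamma> mu a b) =
    scal (rho i a) (mor_tensor (boundary_measurement \<Gamma> lam a j) (boundary_measurement \<Gamma> mu i b)) -
    scal (rho b j) (mor_tensor (boundary_measurement \<Gamma> mu a j) (boundary_measurement \<Gamma> lam i b))"
proof -
  define g where "g = (\<lambda>u w. tens (through a u j) (through i w b))"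
  define x where "x = (\<lambda>p q. lam powi crossings \<Gamma> p * mu powi crossings \<Gamma> q)"
  define H where "H = (\<lambda>d p q k l u w. scal (x p q * swap_sign d (p ! k) (q ! l)) (g u w))"
  have pair: "dbr (through i p j) (through a q b) = (\<Sum>k<length p. \<Sum>l<length q. \<Sum>d\<in>{0, 1}.
      if cut_vertex d p k = cut_vertex d q l
      then scal (swap_sign d (p ! k) (q ! l)) (g (swap d q p l k) (swap d p q k l)) else 0)"
    if p: "p \<in> walks i j" and q: "q \<in> walks a b" for p q
  proof -
    have "(source \<Gamma> i, p, sink \<Gamma> j) \<in> through_paths \<Gamma>" "(source \<Gamma> a, q, sink \<Gamma> b) \<in> through_paths \<Gamma>"
      using p q idx by (auto simp: through_paths_def walks_def dpaths_def sources_def sinks_def)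
    then have "dbr (through i p j) (through a q b) =
        glue_tensor \<Gamma> (br (source \<Gamma> i, p, sink \<Gamma> j) (source \<Gamma> a, q, sink \<Gamma> b))"
      using dbr by (auto simp: torus_bracket_def)
    also have "br (source \<Gamma> i, p, sink \<Gamma> j) (source \<Gamma> a, q, sink \<Gamma> b) =
        (\<Sum>k<length p. \<Sum>l<length q. corner_term (source \<Gamma> i, p, sink \<Gamma> j) (source \<Gamma> a, q, sink \<Gamma> b) k l)"
      using p q by (intro br_walks[OF br]) (auto simp: walks_def)
    finally show ?thesis by (simp only: glue_tensor_simps glued_corner_term g_def)
  qed
  have "extend_bilinear dbr (boundary_measurement \<Gamma> lam i j) (boundary_measurement \<Gamma> mu a b) =
    (\<Sum>p\<in>walks i j. \<Sum>q\<in>walks a b. scal (x p q) (dbr (through i p j) (through a q b)))"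
    by (simp add: extend_bilinear_boundary_measurement x_def)
  also have "\<dots> = (\<Sum>p\<in>walks i j. \<Sum>q\<in>walks a b. \<Sum>k<length p. \<Sum>l<length q. \<Sum>d\<in>{0, 1}.
      if cut_vertex d p k = cut_vertex d q l then H d p q k l (swap d q p l k) (swap d p q k l) else 0)"
  proof (intro sum.cong[OF refl])
    fix p q assume pq: "p \<in> walks i j" "q \<in> walks a b"
    show "scal (x p q) (dbr (through i p j) (through a q b)) = (\<Sum>k<length p. \<Sum>l<length q. \<Sum>d\<in>{0, 1}.
      if cut_vertex d p k = cut_vertex d q l then H d p q k l (swap d q p l k) (swap d p q k l) else 0)"
      unfolding pair[OF pq] scal_sum by (intro sum.cong refl) (simp add: H_def)
  qed
  also have "\<dots> = (\<Sum>d\<in>{0, 1}. \<Sum>p\<in>walks i j. \<Sum>q\<in>walks a b. \<Sum>k<length p. \<Sum>l<length q.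
      if cut_vertex d p k = cut_vertex d q l then H d p q k l (swap d q p l k) (swap d p q k l) else 0)"
    by (simp add: sum.distrib)
  also have "\<dots> = (\<Sum>d\<in>{0, 1}. \<Sum>u\<in>walks a j. \<Sum>w\<in>walks i b. \<Sum>l<length u. \<Sum>k<length w.
      if cut_vertex d u l = cut_vertex d w k then H d (swap d w u k l) (swap d u w l k) k l u w else 0)"
    by (intro sum.cong refl swap_reindex) auto
  also have "\<dots> = (\<Sum>d\<in>{0, 1}. \<Sum>u\<in>walks a j. \<Sum>w\<in>walks i b. \<Sum>l<length u. \<Sum>k<length w.
      scal (x (swap d w u k l) (swap d u w l k) *
        (of_int (if d = 0 then split_sign (u ! l) (w ! k) else merge_sign (u ! l) (w ! k)) / 2)) (g u w))"
  proof (intro sum.cong refl)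
    fix d :: nat and u w :: "'e list" and k l :: nat
    assume d: "d \<in> {0, 1}" and l: "l \<in> {..<length u}" and k: "k \<in> {..<length w}"
    have d1: "d \<le> 1" using d by auto
    have nth: "swap d w u k l ! k = (if d = 0 then u ! l else w ! k)" "swap d u w l k ! l = (if d = 0 then w ! k else u ! l)"
      using swap_props(3)[OF _ _ d1, of k w l u] swap_props(3)[OF _ _ d1, of l u k w] l k by auto
    \<comment> \<open>For d = 1 the arriving edges now appear in the order w, u; antisymmetry of
      \<open>merge_sign\<close> cancels its minus sign, so both kinds of vertices enter with a
      plus.\<close>
    have "swap_sign d (swap d w u k l ! k) (swap d u w l k ! l) =
        of_int (if d = 0 then split_sign (u ! l) (w ! k) else merge_sign (u ! l) (w ! k)) / 2"
      unfolding nth swap_sign_def by (simp add: merge_sign_def)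
    moreover have "(if d = 0 then split_sign (u ! l) (w ! k) else merge_sign (u ! l) (w ! k)) = 0"
      if "cut_vertex d u l \<noteq> cut_vertex d w k"
      by (rule ccontr) (use that in \<open>auto simp: cut_vertex_def dest: sign_nonzero split: if_splits\<close>)
    ultimately show "(if cut_vertex d u l = cut_vertex d w k then H d (swap d w u k l) (swap d u w l k) k l u w else 0) =
      scal (x (swap d w u k l) (swap d u w l k) *
        (of_int (if d = 0 then split_sign (u ! l) (w ! k) else merge_sign (u ! l) (w ! k)) / 2)) (g u w)"
      by (simp add: H_def)
  qed
  also have "\<dots> = (\<Sum>u\<in>walks a j. \<Sum>w\<in>walks i b. scal (\<Sum>l<length u. \<Sum>k<length w.
      x (swap 0 w u k l) (swap 0 u w l k) * (of_int (split_sign (u ! l) (w ! k)) / 2) +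
      x (swap 1 w u k l) (swap 1 u w l k) * (of_int (merge_sign (u ! l) (w ! k)) / 2)) (g u w))"
    by (simp add: sum_scal pm.scale_left_distrib sum.distrib)
  also have "\<dots> = (\<Sum>u\<in>walks a j. \<Sum>w\<in>walks i b.
      scal (rho i a) (scal (x u w) (g u w)) - scal (rho b j) (scal (x w u) (g u w)))"
  proof (intro sum.cong refl)
    fix u w assume u: "u \<in> walks a j" and w: "w \<in> walks i b"
    show "scal (\<Sum>l<length u. \<Sum>k<length w.
      x (swap 0 w u k l) (swap 0 u w l k) * (of_int (split_sign (u ! l) (w ! k)) / 2) +
      x (swap 1 w u k l) (swap 1 u w l k) * (of_int (merge_sign (u ! l) (w ! k)) / 2)) (g u w) =
      scal (rho i a) (scal (x u w) (g u w)) - scal (rho b j) (scal (x w u) (g u w))"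
      unfolding x_def coefficient[OF idx u w] by (simp add: pm.scale_left_diff_distrib mult.commute)
  qed
  also have "\<dots> = scal (rho i a) (\<Sum>u\<in>walks a j. \<Sum>w\<in>walks i b. scal (x u w) (g u w)) -
      scal (rho b j) (\<Sum>u\<in>walks a j. \<Sum>w\<in>walks i b. scal (x w u) (g u w))"
    by (simp only: sum_subtractf scal_sum)
  also have "(\<Sum>u\<in>walks a j. \<Sum>w\<in>walks i b. scal (x u w) (g u w)) =
      mor_tensor (boundary_measurement \<Gamma> lam a j) (boundary_measurement \<Gamma> mu i b)"
    by (simp add: mor_tensor_def extend_bilinear_boundary_measurement x_def g_def)
  \<comment> \<open>In \<open>x w u\<close> the parameters have changed places: lam goes with w and
    mu with u.\<close>
  also have "(\<Sum>u\<in>walks a j. \<Sum>w\<in>walks i b. scal (x w u) (g u w)) =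
      mor_tensor (boundary_measurement \<Gamma> mu a j) (boundary_measurement \<Gamma> lam i b)"
    by (simp add: mor_tensor_def extend_bilinear_boundary_measurement x_def g_def mult.commute)
  finally show ?thesis .
qed

lemma glue_sink: "i \<in> {1..width \<Gamma>} \<Longrightarrow> glue \<Gamma> (sink \<Gamma> i) = source \<Gamma> i"
  using inj_sink by (simp add: glue_def sinks_def)

lemma glue_source: "i \<in> {1..width \<Gamma>} \<Longrightarrow> glue \<Gamma> (source \<Gamma> i) = source \<Gamma> i"
  using sources_sinks_disjoint imageI[of i "{1..width \<Gamma>}" "source \<Gamma>", folded sources_def] by (auto simp: glue_def)

lemma wf_torus: "wf_digraph (torus_digraph \<Gamma>)"
  by unfold_locales (auto simp: torus_digraph_def)

lemma torus_walk: "awalk x p y \<Longrightarrow> pre_digraph.awalk (torus_digraph \<Gamma>) (glue \<Gamma> x) p (glue \<Gamma> y)"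
proof (induction p arbitrary: x)
  case Nil
  then show ?case
    by (auto simp: awalk_Nil_iff wf_digraph.awalk_Nil_iff[OF wf_torus]) (simp add: torus_digraph_def)
next
  case (Cons e p)
  then show ?case
    by (auto simp: awalk_Cons_iff wf_digraph.awalk_Cons_iff[OF wf_torus]) (auto simp: torus_digraph_def)
qed

lemma torus_pathsI:
  assumes "p \<in> walks i j" "i \<in> {1..width \<Gamma>}" "j \<in> {1..width \<Gamma>}"
  shows "through i p j \<in> hom_paths (torus_paths \<Gamma>) (source \<Gamma> i) (source \<Gamma> j)"
  using torus_walk[of "source \<Gamma> i" p "sink \<Gamma> j"] assms
  by (simp add: walks_def hom_paths_def torus_paths_def dpaths_def glue_path_def glue_source glue_sink sources_def)

lemma boundary_measurement_hom:
  assumes "i \<in> {1..width \<Gamma>}" "j \<in> {1..width \<Gamma>}"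
  shows "boundary_measurement \<Gamma> x i j \<in> hom_space (torus_paths \<Gamma>) (source \<Gamma> i) (source \<Gamma> j)"
  unfolding hom_space_def boundary_measurement_walks mem_Collect_eq
proof (rule order.trans[OF keys_sum], rule UN_least, rule order.trans[OF keys_scal])
  fix p assume "p \<in> walks i j"
  from torus_pathsI[OF this assms] show "Poly_Mapping.keys (basis (through i p j)) \<subseteq>
      hom_paths (torus_paths \<Gamma>) (source \<Gamma> i) (source \<Gamma> j)" by simp
qed

lemma torus_paths_concat:
  assumes "p \<in> torus_paths \<Gamma>" "q \<in> torus_paths \<Gamma>" "ptgt p = psrc q"
  shows "concat_path p q \<in> torus_paths \<Gamma>"
  using assms wf_digraph.awalk_appendI[OF wf_torus]
  by (auto simp: torus_paths_def dpaths_def concat_path_def)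

lemma id_in_torus_paths:
  assumes "a \<in> {1..width \<Gamma>}"
  shows "id_path (source \<Gamma> a) \<in> torus_paths \<Gamma>"
proof -
  have "source \<Gamma> a \<in> sources \<Gamma>" using assms by (simp add: sources_def)
  moreover have "source \<Gamma> a \<in> verts (torus_digraph \<Gamma>)"
    using boundary_verts calculation glue_source[OF assms]
    by (auto simp: torus_digraph_def intro!: image_eqI[of _ _ "source \<Gamma> a"])
  ultimately show ?thesis
    by (simp add: torus_paths_def dpaths_def id_path_def wf_digraph.awalk_Nil_iff[OF wf_torus])
qed

end

theorem theorem32:
  fixes \<Gamma> :: "('v, 'e) cyl_network"
    and br dbr :: "('v, 'e) bracket"
    and k a b :: nat
  assumes "perfect_cylindrical_network \<Gamma>"
    and "acyclic_network \<Gamma>"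
    and "standard_bracket \<Gamma> br"
    and "torus_bracket \<Gamma> br dbr"
    and "1 \<le> k"
    and "a \<in> {1..width \<Gamma>}" and "b \<in> {1..width \<Gamma>}"
  shows "induced_bracket dbr
           (cyclic_class \<Gamma> (mat_trace \<Gamma> (mat_power \<Gamma> (boundary_measurement \<Gamma> lam) k)))
           (boundary_measurement \<Gamma> mu a b) =
         mat_mult \<Gamma> (lax_matrix \<Gamma> k) (boundary_measurement \<Gamma> mu) a b -
         mat_mult \<Gamma> (boundary_measurement \<Gamma> mu) (lax_matrix \<Gamma> k) a b"
proof -
  interpret acyclic_cylinder \<Gamma>
    by (intro acyclic_cylinder.intro acyclic_cylinder_axioms.intro assms(1,2))
  interpret B: path_matrix_bracket \<Gamma> "boundary_measurement \<Gamma> lam" dbr "boundary_measurement \<Gamma> mu a b"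
  proof unfold_locales
    show "bracket_hom (torus_paths \<Gamma>) dbr" "bracket_leibniz (torus_paths \<Gamma>) dbr"
      using assms(4) by (auto simp: torus_bracket_def)
    show "Poly_Mapping.keys (boundary_measurement \<Gamma> mu a b) \<subseteq> torus_paths \<Gamma>"
      using boundary_measurement_hom[OF assms(6,7), of mu] by (auto simp: hom_space_def hom_paths_def)
  qed (auto intro: boundary_measurement_hom torus_paths_concat id_in_torus_paths)
  obtain m where k: "k = Suc m" using assms(5) by (cases k) auto
  show ?thesis
    unfolding k lax_matrix_def
    by (rule B.induced_bracket_lax[OF assms(6,7) bracket_boundary_measurement[OF assms(3,4) _ _ assms(6,7)]])
qed

end
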